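(* There is an algorithm that, given an $n$-vertex graph $G$ together with a tree decomposition of width $\mathrm{tw}(G)$, computes the number of forests in $G$ (i.e. the number of edge sets $A\subseteq E(G)$ such that $(V(G),A)$ is acyclic) in time $64^{\mathrm{tw}(G)}n^{O(1)}$. *)

theory Defs
  imports Main
begin

section \<open>Graphs, forests and tree decompositions\<close>

definition graph :: "'a set \<Rightarrow> 'a set set \<Rightarrow> bool" where
  "graph V E \<longleftrightarrow> finite V \<and> (\<forall>e\<in>E. e \<subseteq> V \<and> card e = 2)"

definition cycle :: "'a set set \<Rightarrow> 'a list \<Rightarrow> bool" where
  "cycle E vs \<longleftrightarrow> 3 \<le> length vs \<and> distinct vs \<and>
     (\<forall>i<length vs. {vs ! i, vs ! (Suc i mod length vs)} \<in> E)"

definition acyclic_edges :: "'a set set \<Rightarrow> bool" where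
  "acyclic_edges E \<longleftrightarrow> \<not> (\<exists>vs. cycle E vs)"

definition forests :: "'a set set \<Rightarrow> 'a set set set" where
  "forests E = {A. A \<subseteq> E \<and> acyclic_edges A}"

text \<open>Edges leaving \<open>V\<close> are ignored, so \<open>connected_graph S E\<close> for \<open>S \<subseteq> V\<close> says that the
  subgraph of \<open>(V, E)\<close> induced by \<open>S\<close> is connected.\<close>

definition connected_graph :: "'a set \<Rightarrow> 'a set set \<Rightarrow> bool" where
  "connected_graph V E \<longleftrightarrow> V \<noteq> {} \<and>
     (\<forall>u\<in>V. \<forall>v\<in>V. (u, v) \<in> {(x, y). x \<in> V \<and> y \<in> V \<and> {x, y} \<in> E}\<^sup>*)"

definition tree_graph :: "'a set \<Rightarrow> 'a set set \<Rightarrow> bool" where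
  "tree_graph V E \<longleftrightarrow> graph V E \<and> connected_graph V E \<and> acyclic_edges E"

definition tree_decomposition ::
  "'a set \<Rightarrow> 'a set set \<Rightarrow> 'b set \<Rightarrow> 'b set set \<Rightarrow> ('b \<Rightarrow> 'a set) \<Rightarrow> bool" where
  "tree_decomposition V E I F B \<longleftrightarrow>
     tree_graph I F \<and>
     (\<Union>i\<in>I. B i) = V \<and>
     (\<forall>e\<in>E. \<exists>i\<in>I. e \<subseteq> B i) \<and>
     (\<forall>v\<in>V. connected_graph {i\<in>I. v \<in> B i} F)"

text \<open>Truncated subtraction only matters for the graph without vertices, which gets width
  \<open>0\<close> instead of \<open>-1\<close>.\<close>

definition width :: "'b set \<Rightarrow> ('b \<Rightarrow> 'a set) \<Rightarrow> nat" where
  "width I B = Max ((\<lambda>i. card (B i)) ` I) - 1"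

text \<open>Every finite tree is isomorphic to one whose nodes are natural numbers.\<close>

definition treewidth :: "'a set \<Rightarrow> 'a set set \<Rightarrow> nat" where
  "treewidth V E = (LEAST w. \<exists>(I :: nat set) F B. tree_decomposition V E I F B \<and> width I B = w)"


section \<open>Model of computation\<close>

text \<open>
  Programs of a first-order, call-by-value functional language over binary trees with the
  single atom \<open>Atom\<close> (pure LISP; compare the languages WHILE and F in Jones, \<^emph>\<open>Computability
  and Complexity from a Programming Perspective\<close>).  A program is a finite list of function
  bodies, and \<open>Call f es\<close> refers to the body at position \<open>f\<close>.  Variables are de Bruijn
  indices into the environment: a call starts with the list of its arguments, \<open>Let\<close> pushes one
  value.

  Every operation has cost 1.  This is realistic: trees are represented by pointers, so all the
  operations are constant-time pointer manipulations; there is no primitive arithmetic, and the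
  only test is whether a tree is an atom.  The length of an environment is bounded in terms of
  the program alone.  Hence \<open>t\<close> steps take time \<open>O(t)\<close> on a pointer machine and
  \<open>O(t log t)\<close> on a random access machine with logarithmic cost.
\<close>

datatype sexp = Atom | Node sexp sexp

datatype expr =
    Var nat
  | AtomE
  | NodeE expr expr
  | Hd expr
  | Tl expr
  | IfNode expr expr expr
  | Let expr expr
  | Call nat "expr list"

type_synonym program = "expr list"

fun hd_sexp :: "sexp \<Rightarrow> sexp" where
  "hd_sexp Atom = Atom"
| "hd_sexp (Node x y) = x"

fun tl_sexp :: "sexp \<Rightarrow> sexp" where
  "tl_sexp Atom = Atom"
| "tl_sexp (Node x y) = y"

text \<open>\<open>eval P env e v t\<close>: in environment \<open>env\<close>, expression \<open>e\<close> evaluates to \<open>v\<close> in exactly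
  \<open>t\<close> steps.  Out-of-range variables and function names have no value.\<close>

inductive eval :: "program \<Rightarrow> sexp list \<Rightarrow> expr \<Rightarrow> sexp \<Rightarrow> nat \<Rightarrow> bool"
  and evals :: "program \<Rightarrow> sexp list \<Rightarrow> expr list \<Rightarrow> sexp list \<Rightarrow> nat \<Rightarrow> bool"
  for P :: program where
  eval_Var: "i < length env \<Longrightarrow> eval P env (Var i) (env ! i) 1"
| eval_Atom: "eval P env AtomE Atom 1"
| eval_Node: "eval P env e1 v1 t1 \<Longrightarrow> eval P env e2 v2 t2 \<Longrightarrow>
    eval P env (NodeE e1 e2) (Node v1 v2) (Suc (t1 + t2))"
| eval_Hd: "eval P env e v t \<Longrightarrow> eval P env (Hd e) (hd_sexp v) (Suc t)"
| eval_Tl: "eval P env e v t \<Longrightarrow> eval P env (Tl e) (tl_sexp v) (Suc t)"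
| eval_If_Node: "eval P env e (Node x y) t \<Longrightarrow> eval P env e1 v1 t1 \<Longrightarrow>
    eval P env (IfNode e e1 e2) v1 (Suc (t + t1))"
| eval_If_Atom: "eval P env e Atom t \<Longrightarrow> eval P env e2 v2 t2 \<Longrightarrow>
    eval P env (IfNode e e1 e2) v2 (Suc (t + t2))"
| eval_Let: "eval P env e1 v1 t1 \<Longrightarrow> eval P (v1 # env) e2 v2 t2 \<Longrightarrow>
    eval P env (Let e1 e2) v2 (Suc (t1 + t2))"
| eval_Call: "f < length P \<Longrightarrow> evals P env es vs t1 \<Longrightarrow> eval P vs (P ! f) v t2 \<Longrightarrow>
    eval P env (Call f es) v (Suc (t1 + t2))"
| evals_Nil: "evals P env [] [] 0"
| evals_Cons: "eval P env e v t1 \<Longrightarrow> evals P env es vs t2 \<Longrightarrow>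
    evals P env (e # es) (v # vs) (t1 + t2)"

definition runs :: "program \<Rightarrow> sexp \<Rightarrow> sexp \<Rightarrow> nat \<Rightarrow> bool" where
  "runs P x y t \<longleftrightarrow> eval P [x] (Call 0 [Var 0]) y t"

inductive_cases eval_VarE: "eval P env (Var i) v t"
inductive_cases eval_AtomE: "eval P env AtomE v t"
inductive_cases eval_NodeE: "eval P env (NodeE e1 e2) v t"
inductive_cases eval_HdE: "eval P env (Hd e) v t"
inductive_cases eval_TlE: "eval P env (Tl e) v t"
inductive_cases eval_IfE: "eval P env (IfNode e e1 e2) v t"
inductive_cases eval_LetE: "eval P env (Let e1 e2) v t"
inductive_cases eval_CallE: "eval P env (Call f es) v t"
inductive_cases evals_NilE: "evals P env [] vs t"
inductive_cases evals_ConsE: "evals P env (e # es) vs t"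

lemma eval_deterministic:
  "eval P env e v t \<Longrightarrow> (\<forall>v' t'. eval P env e v' t' \<longrightarrow> v' = v \<and> t' = t)"
  "evals P env es vs s \<Longrightarrow> (\<forall>vs' s'. evals P env es vs' s' \<longrightarrow> vs' = vs \<and> s' = s)"
proof (induction rule: eval_evals.inducts)
  case eval_Var
  show ?case by (intro allI impI, elim eval_VarE) (use eval_Var in \<open>simp_all\<close>)
next
  case eval_Atom
  show ?case by (intro allI impI, elim eval_AtomE) (use eval_Atom in \<open>simp_all\<close>)
next
  case eval_Node
  show ?case by (intro allI impI, elim eval_NodeE) (use eval_Node in \<open>metis\<close>)
next
  case eval_Hd
  show ?case by (intro allI impI, elim eval_HdE) (use eval_Hd in \<open>metis\<close>)
next
  case eval_Tl
  show ?case by (intro allI impI, elim eval_TlE) (use eval_Tl in \<open>metis\<close>)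
next
  case eval_If_Node
  show ?case by (intro allI impI, elim eval_IfE) (use eval_If_Node in \<open>metis sexp.distinct(1)\<close>, use eval_If_Node in \<open>metis sexp.distinct(1)\<close>)
next
  case eval_If_Atom
  show ?case by (intro allI impI, elim eval_IfE) (use eval_If_Atom in \<open>metis sexp.distinct(1)\<close>, use eval_If_Atom in \<open>metis sexp.distinct(1)\<close>)
next
  case eval_Let
  show ?case by (intro allI impI, elim eval_LetE) (use eval_Let in \<open>metis\<close>)
next
  case eval_Call
  show ?case by (intro allI impI, elim eval_CallE) (use eval_Call in \<open>metis\<close>)
next
  case evals_Nil
  show ?case by (intro allI impI, elim evals_NilE) (use evals_Nil in \<open>simp_all\<close>)
next
  case evals_Cons
  show ?case by (intro allI impI, elim evals_ConsE) (use evals_Cons in \<open>metis\<close>)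
qed

lemma runs_deterministic:
  "runs P x y t \<Longrightarrow> runs P x y' t' \<Longrightarrow> y' = y \<and> t' = t"
  unfolding runs_def using eval_deterministic(1) by blast


section \<open>Encoding of inputs and outputs\<close>

fun enc_list :: "('a \<Rightarrow> sexp) \<Rightarrow> 'a list \<Rightarrow> sexp" where
  "enc_list f [] = Atom"
| "enc_list f (x # xs) = Node (f x) (enc_list f xs)"

fun enc_prod :: "('a \<Rightarrow> sexp) \<Rightarrow> ('b \<Rightarrow> sexp) \<Rightarrow> 'a \<times> 'b \<Rightarrow> sexp" where
  "enc_prod f g (x, y) = Node (f x) (g y)"

fun enc_bool :: "bool \<Rightarrow> sexp" where
  "enc_bool False = Atom"
| "enc_bool True = Node Atom Atom"

text \<open>Binary digits, least significant first, no leading zeros.\<close>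

fun bits :: "nat \<Rightarrow> bool list" where
  "bits n = (if n = 0 then [] else odd n # bits (n div 2))"

declare bits.simps [simp del]

definition enc_nat :: "nat \<Rightarrow> sexp" where
  "enc_nat n = enc_list enc_bool (bits n)"

definition lists_edges :: "('a \<times> 'a) list \<Rightarrow> 'a set set \<Rightarrow> bool" where
  "lists_edges es E \<longleftrightarrow>
     distinct (map (\<lambda>(u, v). {u, v}) es) \<and> set (map (\<lambda>(u, v). {u, v}) es) = E"

definition lists_bags :: "'a list list \<Rightarrow> nat \<Rightarrow> (nat \<Rightarrow> 'a set) \<Rightarrow> bool" where
  "lists_bags bs N B \<longleftrightarrow>
     length bs = N \<and> (\<forall>i<N. distinct (bs ! i) \<and> set (bs ! i) = B i)"

text \<open>\<open>x\<close> encodes the graph \<open>({..<n}, E)\<close> together with the tree \<open>({..<N}, F)\<close> and the bags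
  \<open>B 0, \<dots>, B (N - 1)\<close>.  Edges and bag elements may be listed in any order, and edges in either
  orientation, but without repetition.\<close>

definition encodes_instance ::
  "sexp \<Rightarrow> nat \<Rightarrow> nat set set \<Rightarrow> nat \<Rightarrow> nat set set \<Rightarrow> (nat \<Rightarrow> nat set) \<Rightarrow> bool" where
  "encodes_instance x n E N F B \<longleftrightarrow>
     (\<exists>es fs bs. lists_edges es E \<and> lists_edges fs F \<and> lists_bags bs N B \<and>
        x = Node (enc_nat n)
             (Node (enc_list (enc_prod enc_nat enc_nat) es)
               (Node (enc_list (enc_prod enc_nat enc_nat) fs)
                 (enc_list (enc_list enc_nat) bs))))"

end

theory Submission
  imports Defs
begin

text \<open>
  Let \<open>a\<^sub>v, b\<^sub>v\<close> be anticommuting generators, one pair for every vertex, \<open>\<tau>\<^sub>v = a\<^sub>v b\<^sub>v\<close> and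
  \<open>f\<^sub>u\<^sub>v = (a\<^sub>u - a\<^sub>v) (b\<^sub>u - b\<^sub>v) (1 - \<tau>\<^sub>v)\<close> (Caracciolo, Jacobsen, Saleur, Sokal, Sportiello).  The product of
  the \<open>f\<^sub>e\<close> over the edges of a path from \<open>u\<close> to \<open>v\<close> annihilates \<open>a\<^sub>u - a\<^sub>v\<close> and \<open>b\<^sub>u - b\<^sub>v\<close>,
  hence the product over a cycle vanishes.  If \<open>v\<close> is a leaf with neighbour \<open>u\<close>, then
  \<open>(1 + \<tau>\<^sub>v) f\<^sub>u\<^sub>v\<close> and \<open>\<tau>\<^sub>v\<close> differ by terms that miss a generator of \<open>v\<close>.  Therefore the number of
  forests is the coefficient of the product of all generators in
  \<open>\<Prod>\<^sub>v (1 + \<tau>\<^sub>v) \<Prod>\<^sub>e (1 + f\<^sub>e)\<close>.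

  This coefficient is computed by eliminating vertices in the order of a tree decomposition: multiply
  all factors that contain \<open>v\<close> and take the coefficient of \<open>\<tau>\<^sub>v\<close>.  All these factors live on one bag with
  \<open>k\<close> vertices, where the algebra has dimension \<open>4\<^sup>k\<close>, so the naive multiplication of two elements
  takes \<open>4\<^sup>k \<cdot> 4\<^sup>k \<cdot> 4\<^sup>k = 64\<^sup>k\<close> steps, up to polynomial factors.
\<close>

section \<open>The Grassmann algebra\<close>

text \<open>Composition of additive operators on integer functions of sets supplies the ring laws at
  once, so only the sign rule of the generators needs proof. The ring is not commutative, but every
  factor that is multiplied is even and even elements commute; this is what allows vertices to be
  eliminated in any order. Three obstacles shape the rest. The order: as long as vertices remain,
  one of them has all its factors inside a single scope, because a tree decomposition makes the
  graph chordal, and such a vertex is found by search. The size: elements are trees over all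
  \<open>2*n\<close> generators, yet their cost must depend on one bag only, so branches outside the
  support are pruned. The numbers: arithmetic works on bits, so a submultiplicative norm, at most
  \<open>16^|E| * 2^n\<close> for the whole product, limits every coefficient to O(n^2) bits. A bag
  may have one vertex more than the treewidth; the surplus factor 64 goes into the constant.\<close>

typedef fop = "{F :: (nat set \<Rightarrow> int) \<Rightarrow> nat set \<Rightarrow> int.
    \<forall>f g. F (\<lambda>S. f S + g S) = (\<lambda>S. F f S + F g S)}"
  by (rule exI[of _ "\<lambda>f. f"]) simp

setup_lifting type_definition_fop

instantiation fop :: ring_1
begin

lift_definition zero_fop :: fop is "\<lambda>f S. 0" by simp
lift_definition one_fop :: fop is "\<lambda>f. f" by simp
lift_definition plus_fop :: "fop \<Rightarrow> fop \<Rightarrow> fop" is "\<lambda>F G f S. F f S + G f S" by auto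
lift_definition minus_fop :: "fop \<Rightarrow> fop \<Rightarrow> fop" is "\<lambda>F G f S. F f S - G f S" by auto
lift_definition uminus_fop :: "fop \<Rightarrow> fop" is "\<lambda>F f S. - F f S" by auto
lift_definition times_fop :: "fop \<Rightarrow> fop \<Rightarrow> fop" is "\<lambda>F G f. F (G f)" by simp

instance
proof
  show "(0::fop) \<noteq> 1"
    by transfer (metis zero_neq_one)
qed (transfer; simp add: algebra_simps fun_eq_iff)+

end

definition app :: "fop \<Rightarrow> (nat set \<Rightarrow> int) \<Rightarrow> nat set \<Rightarrow> int" where
  "app = Rep_fop"

lemma app_simps [simp]:
  "app 0 f S = 0" "app 1 f = f" "app (x + y) f S = app x f S + app y f S"
  "app (x - y) f S = app x f S - app y f S" "app (- x) f S = - app x f S"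
  "app (x * y) f = app x (app y f)"
  unfolding app_def
  by (simp_all add: zero_fop.rep_eq one_fop.rep_eq plus_fop.rep_eq minus_fop.rep_eq uminus_fop.rep_eq times_fop.rep_eq)

lemma app_of_nat [simp]: "app (of_nat k) f S = int k * f S"
  by (induction k) (auto simp: algebra_simps)

lemma app_of_int [simp]: "app (of_int z) f S = z * f S"
proof (cases z)
  case (neg n)
  have "(of_int z :: fop) = - of_nat (Suc n)"
    unfolding neg by (simp only: of_int_minus of_int_of_nat_eq)
  then show ?thesis using neg by (simp add: algebra_simps del: of_nat_Suc)
qed (simp add: algebra_simps)

lemma fop_eqI: "(\<And>f S. app x f S = app y f S) \<Longrightarrow> x = y"
  unfolding app_def by (simp add: Rep_fop_inject[symmetric] fun_eq_iff)

text \<open>The creation operator of the \<open>k\<close>-th generator; the sign is the parity of the number of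
  transpositions that move it into place.\<close>

lift_definition th :: "nat \<Rightarrow> fop" is
  "\<lambda>k f S. if k \<in> S then (-1) ^ card {j\<in>S. j < k} * f (S - {k}) else 0"
  by (auto simp: algebra_simps fun_eq_iff)

lemma app_th: "app (th k) f S = (if k \<in> S then (-1) ^ card {j\<in>S. j < k} * f (S - {k}) else 0)"
  unfolding app_def by (simp add: th.rep_eq)

text \<open>Removing the smaller index lowers by one the number of elements below the larger,
  whereas removing the larger leaves the number below the smaller unchanged.\<close>

lemma th_anticomm_less:
  assumes "g < h"
  shows "th g * th h = - (th h * th g)"
proof (rule fop_eqI)
  fix f :: "nat set \<Rightarrow> int" and S
  show "app (th g * th h) f S = app (- (th h * th g)) f S"
  proof (cases "g \<in> S \<and> h \<in> S")
    case True
    have 1: "{j \<in> S - {h}. j < g} = {j \<in> S. j < g}" using assms by auto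
    have 2: "{j \<in> S. j < h} = insert g {j \<in> S - {g}. j < h}" using True assms by auto
    have "card {j \<in> S. j < h} = Suc (card {j \<in> S - {g}. j < h})"
      unfolding 2 by (subst card_insert_disjoint) auto
    moreover have "S - {g} - {h} = S - {h} - {g}" by auto
    ultimately show ?thesis using True assms 1 by (simp add: app_th)
  qed (auto simp: app_th)
qed

lemma th_sq [simp]: "th g * th g = 0"
  by (rule fop_eqI) (auto simp: app_th)

lemma th_sq_left [simp]: "th g * (th g * x) = 0"
  by (simp flip: mult.assoc)

lemma th_anticomm: "th g * th h = - (th h * th g)"
  by (cases g h rule: linorder_cases) (use th_anticomm_less in \<open>auto\<close>)

text \<open>Semantic form of "\<open>x\<close> does not involve the generator \<open>g\<close>":
  functions supported on sets without \<open>g\<close> stay so. All ring operations preserve it, so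
  no normal form of \<open>x\<close> is required.\<close>

definition free :: "nat \<Rightarrow> fop \<Rightarrow> bool" where
  "free g x \<longleftrightarrow> (\<forall>f. (\<forall>S. g \<in> S \<longrightarrow> f S = 0) \<longrightarrow> (\<forall>S. g \<in> S \<longrightarrow> app x f S = 0))"

lemma free_add: "free g x \<Longrightarrow> free g y \<Longrightarrow> free g (x + y)"
  and free_diff: "free g x \<Longrightarrow> free g y \<Longrightarrow> free g (x - y)"
  and free_minus: "free g x \<Longrightarrow> free g (- x)"
  and free_mult: "free g x \<Longrightarrow> free g y \<Longrightarrow> free g (x * y)"
  and free_0: "free g 0" and free_1: "free g 1" and free_of_int: "free g (of_int z)"
  unfolding free_def by auto

lemma free_th: "g \<noteq> h \<Longrightarrow> free g (th h)"
  unfolding free_def by (auto simp: app_th)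

lemma free_prod_list: "(\<And>x. x \<in> set xs \<Longrightarrow> free g x) \<Longrightarrow> free g (prod_list xs)"
  by (induction xs) (auto intro: free_mult free_1)

text \<open>The Berezin integral: \<open>x\<close> acts on the vacuum, and the coefficient of the
  increasing product of the generators below \<open>m\<close> is read off.\<close>

definition top_coeff :: "nat \<Rightarrow> fop \<Rightarrow> int" where
  "top_coeff m x = app x (\<lambda>S. if S = {} then 1 else 0) {..<m}"

lemma top_coeff_linear [simp]:
  "top_coeff m (x + y) = top_coeff m x + top_coeff m y"
  "top_coeff m (x - y) = top_coeff m x - top_coeff m y"
  "top_coeff m (- x) = - top_coeff m x"
  "top_coeff m 0 = 0"
  by (simp_all add: top_coeff_def)

lemma top_coeff_free: "free g x \<Longrightarrow> g < m \<Longrightarrow> top_coeff m x = 0"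
  unfolding top_coeff_def free_def by force

definition tau :: "nat \<Rightarrow> fop" where
  "tau v = th (2 * v) * th (2 * v + 1)"

definition ff :: "nat \<Rightarrow> nat \<Rightarrow> fop" where
  "ff u v = (th (2*u) - th (2*v)) * (th (2*u+1) - th (2*v+1)) * (1 - tau v)"

section \<open>Even elements commute\<close>

inductive even_op :: "fop \<Rightarrow> bool" where
  even_op_of_int: "even_op (of_int z)"
| even_op_th: "even_op (th g * th h)"
| even_op_add: "even_op x \<Longrightarrow> even_op y \<Longrightarrow> even_op (x + y)"
| even_op_mult: "even_op x \<Longrightarrow> even_op y \<Longrightarrow> even_op (x * y)"

text \<open>Passing \<open>th g\<close> through a pair of generators changes the sign twice.\<close>

lemma even_op_th_comm: "even_op x \<Longrightarrow> x * th g = th g * x"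
proof (induction rule: even_op.induct)
  case (even_op_of_int z)
  then show ?case by (simp add: mult_of_int_commute)
next
  case (even_op_th h k)
  have "th h * th k * th g = - (th h * th g * th k)"
    by (metis minus_mult_left minus_mult_right mult.assoc th_anticomm)
  also have "\<dots> = th g * th h * th k"
    by (metis minus_mult_left minus_minus th_anticomm)
  finally show ?case by (simp add: mult.assoc)
next
  case (even_op_add x y)
  then show ?case by (simp add: algebra_simps)
next
  case (even_op_mult x y)
  then show ?case by (metis mult.assoc)
qed

lemma even_op_comm: "even_op x \<Longrightarrow> even_op y \<Longrightarrow> x * y = y * x"
proof (induction rule: even_op.induct)
  case (even_op_of_int z)
  then show ?case by (simp add: mult_of_int_commute)
next
  case (even_op_th h k)
  then show ?case by (metis mult.assoc even_op_th_comm)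
next
  case (even_op_add x z)
  then show ?case by (simp add: algebra_simps)
next
  case (even_op_mult x z)
  then show ?case by (metis mult.assoc)
qed

lemma even_op_0 [simp]: "even_op 0" and even_op_1 [simp]: "even_op 1"
  using even_op_of_int[of 0] even_op_of_int[of 1] by simp_all

lemma even_op_minus: "even_op x \<Longrightarrow> even_op (- x)"
  using even_op_mult[OF even_op_of_int[of "-1"], of x] by simp

lemma even_op_diff: "even_op x \<Longrightarrow> even_op y \<Longrightarrow> even_op (x - y)"
  using even_op_add[OF _ even_op_minus, of x y] by simp

lemma even_op_tau [simp]: "even_op (tau v)"
  unfolding tau_def by (rule even_op_th)

lemma even_op_ff [simp]: "even_op (ff u v)"
proof -
  have "even_op ((th (2*u) - th (2*v)) * (th (2*u+1) - th (2*v+1)))"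
    by (simp add: left_diff_distrib right_diff_distrib even_op_th even_op_diff)
  then show ?thesis
    unfolding ff_def by (rule even_op_mult) (simp add: even_op_diff)
qed

lemma even_op_prod_list: "(\<And>x. x \<in> set xs \<Longrightarrow> even_op x) \<Longrightarrow> even_op (prod_list xs)"
  by (induction xs) (auto intro: even_op_mult)

text \<open>Products are lists because the ring is not commutative; evenness of the factors is what
  lets \<open>y\<close> move to the front.\<close>

lemma prod_list_extract:
  assumes "\<And>x. x \<in> set (xs @ y # zs) \<Longrightarrow> even_op x"
  shows "prod_list (xs @ y # zs) = y * prod_list (xs @ zs)"
proof -
  have "prod_list xs * y = y * prod_list xs"
    using assms by (intro even_op_comm even_op_prod_list) auto
  then show ?thesis by (simp flip: mult.assoc)
qed

section \<open>Leaves and simplicial vertices\<close>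

text \<open>A longest path starts at a leaf: by maximality every neighbour of \<open>p ! 0\<close>
  lies on the path, and one other than \<open>p ! 1\<close> would close a cycle.\<close>

lemma acyclic_edges_leaf:
  assumes fin: "finite A" and two: "\<And>e. e \<in> A \<Longrightarrow> card e = 2"
    and acyc: "acyclic_edges A" and ne: "A \<noteq> {}"
  shows "\<exists>u v. u \<noteq> v \<and> {u, v} \<in> A \<and> (\<forall>e\<in>A. v \<in> e \<longrightarrow> e = {u, v})"
proof -
  define path where "path p \<longleftrightarrow> distinct p \<and> 2 \<le> length p \<and>
    (\<forall>i. Suc i < length p \<longrightarrow> {p ! i, p ! Suc i} \<in> A)" for p
  have finU: "finite (\<Union>A)"
    using fin two by (metis card.infinite finite_Union zero_neq_numeral)
  have bound: "length p \<le> card (\<Union>A)" if "path p" for p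
  proof -
    have "p ! i \<in> \<Union>A" if "i < length p" for i
    proof (cases i)
      case 0
      then show ?thesis using \<open>path p\<close> unfolding path_def
        by (intro UnionI[of "{p ! 0, p ! Suc 0}"]) auto
    next
      case (Suc j)
      then show ?thesis using \<open>path p\<close> that unfolding path_def
        by (intro UnionI[of "{p ! j, p ! Suc j}"]) auto
    qed
    then have "set p \<subseteq> \<Union>A" by (auto simp: in_set_conv_nth)
    then show ?thesis
      using card_mono[OF finU, of "set p"] that distinct_card[of p] unfolding path_def by simp
  qed
  obtain e0 where e0: "e0 \<in> A" using ne by blast
  then obtain x0 y0 where "e0 = {x0, y0}" "x0 \<noteq> y0"
    using two[of e0] by (auto simp: card_2_iff)
  then have "path [x0, y0]" using e0 unfolding path_def by (auto simp: less_Suc_eq)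
  \<comment> \<open>Path lengths are bounded by the number of covered vertices, so a longest path
    exists.\<close>
  then obtain p where p: "path p" and pmax: "\<And>q. path q \<Longrightarrow> length q \<le> length p"
    using ex_has_greatest_nat[of path "[x0, y0]" length "Suc (card (\<Union>A))"] bound
    by (auto simp: less_Suc_eq_le)
  from p have len: "2 \<le> length p" and dist: "distinct p"
    and edges: "\<And>i. Suc i < length p \<Longrightarrow> {p ! i, p ! Suc i} \<in> A"
    unfolding path_def by auto
  have all: "e = {p ! 1, p ! 0}" if e: "e \<in> A" "p ! 0 \<in> e" for e
  proof -
    obtain z where z: "e = {p ! 0, z}" "z \<noteq> p ! 0"
      using two[OF e(1)] e(2) by (auto simp: card_2_iff doubleton_eq_iff)
    have "z \<in> set p"
    proof (rule ccontr)
      assume "z \<notin> set p"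
      have "{(z # p) ! i, (z # p) ! Suc i} \<in> A" if "Suc i < length (z # p)" for i
        using that edges z e by (cases i) (auto simp: insert_commute)
      then have "path (z # p)"
        using \<open>z \<notin> set p\<close> dist len unfolding path_def by auto
      from pmax[OF this] show False by simp
    qed
    then obtain j where j: "j < length p" "p ! j = z" by (metis in_set_conv_nth)
    have "j \<noteq> 0" using j z by metis
    show ?thesis
    proof (cases "j = 1")
      case True
      then show ?thesis using z j by auto
    next
      case False
      \<comment> \<open>The segment up to \<open>z\<close>, closed by the edge \<open>e\<close>, is
        a cycle, as \<open>j\<close> is at least 2 here.\<close>
      define c where "c = take (Suc j) p"
      have lc: "length c = Suc j" unfolding c_def using j by simp
      have "cycle A c"
        unfolding cycle_def
      proof (intro conjI allI impI)
        show "3 \<le> length c" using lc False \<open>j \<noteq> 0\<close> by simp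
        show "distinct c" unfolding c_def using dist by simp
        fix i assume i: "i < length c"
        show "{c ! i, c ! (Suc i mod length c)} \<in> A"
        proof (cases "i = j")
          case True
          then have "c ! i = z" "c ! (Suc i mod length c) = p ! 0" using lc j by (simp_all add: c_def)
          then show ?thesis using z(1) e(1) by (metis insert_commute)
        next
          case False
          then have "Suc i < length c" using i lc by simp
          then show ?thesis using edges[of i] j lc by (simp add: c_def)
        qed
      qed
      then show ?thesis using acyc unfolding acyclic_edges_def by blast
    qed
  qed
  have mem: "{p ! 1, p ! 0} \<in> A" using edges[of 0] len by (simp add: insert_commute)
  have neq: "p ! 1 \<noteq> p ! 0"
  proof -
    have "1 < length p" "0 < length p" using len by linarith+
    from nth_eq_iff_index_eq[OF dist this] show ?thesis by simp
  qed
  have "p ! 1 \<noteq> p ! 0 \<and> {p ! 1, p ! 0} \<in> A \<and> (\<forall>e\<in>A. p ! 0 \<in> e \<longrightarrow> e = {p ! 1, p ! 0})"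
    by (intro conjI neq mem ballI impI all)
  then show ?thesis
    by - (rule exI[of _ "p ! 1"], rule exI[of _ "p ! 0"])
qed

text \<open>Retracting \<open>l\<close> to its only neighbour \<open>j\<close> in \<open>S\<close>
  turns a walk into one that avoids \<open>l\<close>; a step between \<open>l\<close> and
  \<open>j\<close> becomes a standstill.\<close>

lemma connected_graph_remove_leaf:
  assumes conn: "connected_graph S F" and jl: "j \<noteq> l"
    and leaf: "\<And>k. k \<in> S \<Longrightarrow> {l, k} \<in> F \<Longrightarrow> k = j" and ne: "S - {l} \<noteq> {}"
  shows "connected_graph (S - {l}) F"
  unfolding connected_graph_def
proof (intro conjI ballI ne)
  fix u v assume uv: "u \<in> S - {l}" "v \<in> S - {l}"
  let ?R = "{(x, y). x \<in> S \<and> y \<in> S \<and> {x, y} \<in> F}"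
  let ?R' = "{(x, y). x \<in> S - {l} \<and> y \<in> S - {l} \<and> {x, y} \<in> F}"
  have "(u, w) \<in> ?R\<^sup>* \<Longrightarrow> (u, if w = l then j else w) \<in> ?R'\<^sup>*" for w
  proof (induction rule: rtrancl_induct)
    case base
    then show ?case using uv by auto
  next
    case (step y z)
    consider "y = l" "z = l" | "y = l" "z \<noteq> l" | "y \<noteq> l" "z = l" | "y \<noteq> l" "z \<noteq> l" by blast
    then show ?case
    proof cases
      case 2
      then show ?thesis using step leaf[of z] by auto
    next
      case 3
      then show ?thesis using step leaf[of y] by (auto simp: insert_commute)
    next
      case 4
      then have "(y, z) \<in> ?R'" using step by auto
      then show ?thesis using 4 step.IH by (auto intro: rtrancl_into_rtrancl)
    qed (use step in auto)
  qed
  from this[of v] show "(u, v) \<in> ?R'\<^sup>*"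
    using conn uv unfolding connected_graph_def by auto
qed

lemma connected_graph_neighbour:
  assumes "connected_graph S F" "u \<in> S" "v \<in> S" "u \<noteq> v"
  shows "\<exists>w\<in>S. {u, w} \<in> F"
proof -
  have "(u, v) \<in> {(x, y). x \<in> S \<and> y \<in> S \<and> {x, y} \<in> F}\<^sup>*"
    using assms unfolding connected_graph_def by auto
  then show ?thesis using \<open>u \<noteq> v\<close> by (cases rule: converse_rtranclE) auto
qed

text \<open>A tree decomposition makes the graph chordal; this is the existence of a simplicial vertex
  among the vertices \<open>R\<close> that are still present.\<close>

lemma simplicial_vertex_ex:
  assumes "finite I" "connected_graph I F" "acyclic_edges F" "\<And>e. e \<in> F \<Longrightarrow> card e = 2"
    and "\<And>v. v \<in> R \<Longrightarrow> connected_graph {i\<in>I. v \<in> B i} F" and "R \<noteq> {}"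
  shows "\<exists>v\<in>R. \<exists>i\<in>I. v \<in> B i \<and> (\<forall>k\<in>I. v \<in> B k \<longrightarrow> B k \<inter> R \<subseteq> B i)"
  using assms
proof (induction "card I" arbitrary: I)
  case 0
  then show ?case by (simp add: connected_graph_def)
next
  case (Suc n)
  \<comment> \<open>\<open>F\<close> is kept while nodes are deleted, so the leaf is sought among
    the edges inside the current \<open>I\<close>.\<close>
  define A where "A = {e\<in>F. e \<subseteq> I}"
  show ?case
  proof (cases "A = {}")
    case True
    obtain v where v: "v \<in> R" using Suc.prems(6) by auto
    then obtain i where i: "i \<in> I" "v \<in> B i"
      using Suc.prems(5)[OF v] unfolding connected_graph_def by auto
    have "k = i" if "k \<in> I" for k
    proof (rule ccontr)
      assume "k \<noteq> i"
      from connected_graph_neighbour[OF Suc.prems(2) that i(1) this] show False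
        using True that unfolding A_def by auto
    qed
    then show ?thesis using v i by blast
  next
    case False
    have "finite A" unfolding A_def using Suc.prems(1) by (auto intro: finite_subset[of _ "Pow I"])
    moreover have "acyclic_edges A"
    proof -
      have "cycle F vs" if "cycle A vs" for vs using that unfolding cycle_def A_def by simp
      then show ?thesis using Suc.prems(3) unfolding acyclic_edges_def by blast
    qed
    moreover have "card e = 2" if "e \<in> A" for e using that Suc.prems(4) unfolding A_def by auto
    ultimately have "\<exists>j l. j \<noteq> l \<and> {j, l} \<in> A \<and> (\<forall>e\<in>A. l \<in> e \<longrightarrow> e = {j, l})"
      using False by (intro acyclic_edges_leaf)
    then obtain j l where jl: "j \<noteq> l" "{j, l} \<in> A" and leaf: "\<And>e. e \<in> A \<Longrightarrow> l \<in> e \<Longrightarrow> e = {j, l}"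
      by blast
    have jI: "j \<in> I" "l \<in> I" using jl unfolding A_def by auto
    have leaf': "k = j" if "k \<in> I" "{l, k} \<in> F" for k
    proof -
      have "{l, k} = {j, l}" using leaf[of "{l, k}"] that jI unfolding A_def by auto
      then show ?thesis using jl by (auto simp: doubleton_eq_iff)
    qed
    \<comment> \<open>A connected set of nodes that contains \<open>l\<close> and some other node
      must contain the only neighbour \<open>j\<close> of \<open>l\<close>.\<close>
    have only: "l \<in> B' \<Longrightarrow> B' \<subseteq> I \<Longrightarrow> connected_graph B' F \<Longrightarrow> B' = {l} \<or> j \<in> B'" for B'
    proof -
      assume a: "l \<in> B'" "B' \<subseteq> I" "connected_graph B' F"
      show ?thesis
      proof (cases "B' = {l}")
        case False
        then obtain k where "k \<in> B'" "l \<noteq> k" using a by blast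
        from connected_graph_neighbour[OF a(3) a(1) this] show ?thesis using leaf' a by auto
      qed simp
    qed
    show ?thesis
    proof (cases "B l \<inter> R \<subseteq> B j")
      case False
      then obtain v where v: "v \<in> B l" "v \<in> R" "v \<notin> B j" by blast
      \<comment> \<open>The nodes of \<open>v\<close> are connected and avoid \<open>j\<close>, so
        \<open>v\<close> is private to the leaf bag and therefore simplicial.\<close>
      have "{i \<in> I. v \<in> B i} = {l}"
        using only[of "{i \<in> I. v \<in> B i}"] Suc.prems(5)[OF v(2)] v jI by auto
      then have "k = l" if "k \<in> I" "v \<in> B k" for k using that by blast
      then have "\<forall>k\<in>I. v \<in> B k \<longrightarrow> B k \<inter> R \<subseteq> B l" by auto
      then show ?thesis using v jI by blast
    next
      case True
      have conn: "connected_graph {i \<in> I - {l}. v \<in> B i} F" if v: "v \<in> R" for v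
      proof -
        have eq: "{i \<in> I - {l}. v \<in> B i} = {i \<in> I. v \<in> B i} - {l}" by auto
        have "{i \<in> I. v \<in> B i} \<noteq> {}" using Suc.prems(5)[OF v] unfolding connected_graph_def by simp
        then have "{i \<in> I. v \<in> B i} - {l} \<noteq> {}"
          using True v jl jI by blast
        then show ?thesis unfolding eq
          by (intro connected_graph_remove_leaf[OF Suc.prems(5)[OF v] jl(1)]) (use leaf' in auto)
      qed
      have "\<exists>v\<in>R. \<exists>i\<in>I - {l}. v \<in> B i \<and> (\<forall>k\<in>I - {l}. v \<in> B k \<longrightarrow> B k \<inter> R \<subseteq> B i)"
      proof (rule Suc.hyps(1))
        show "n = card (I - {l})" using Suc.hyps(2) Suc.prems(1) jI by simp
        show "connected_graph (I - {l}) F"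
          by (rule connected_graph_remove_leaf[OF Suc.prems(2) jl(1)]) (use leaf' jI jl in auto)
      qed (use Suc.prems conn in auto)
      then obtain v i where vi: "v \<in> R" "i \<in> I - {l}" "v \<in> B i"
        and max: "\<forall>k\<in>I - {l}. v \<in> B k \<longrightarrow> B k \<inter> R \<subseteq> B i" by blast
      \<comment> \<open>The deleted bag is dominated by the bag of \<open>j\<close>; if it contains
        \<open>v\<close>, so does the latter, and domination passes on to
        \<open>B i\<close>.\<close>
      have "B l \<inter> R \<subseteq> B i" if "v \<in> B l"
      proof -
        have "v \<in> B j" using that True vi by blast
        then have "B j \<inter> R \<subseteq> B i" using max jI jl by auto
        then show ?thesis using True by blast
      qed
      then have "\<forall>k\<in>I. v \<in> B k \<longrightarrow> B k \<inter> R \<subseteq> B i" using max by auto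
      then show ?thesis using vi by blast
    qed
  qed
qed

section \<open>Forests and the top coefficient\<close>

lemma odd_diff_anticomm:
  "(th a - th b) * (th c - th d) = - ((th c - th d) * (th a - th b))"
  by (simp add: left_diff_distrib right_diff_distrib th_anticomm[of c a] th_anticomm[of c b]
      th_anticomm[of d a] th_anticomm[of d b])

lemma odd_diff_sq: "(th a - th b) * (th a - th b) = 0"
  by (simp add: left_diff_distrib right_diff_distrib th_anticomm[of b a])

lemma th_tau: "th (2 * v) * tau v = 0" "th (Suc (2 * v)) * tau v = 0"
proof -
  show "th (2 * v) * tau v = 0" by (simp add: tau_def)
  show "th (Suc (2 * v)) * tau v = 0"
    using even_op_th_comm[OF even_op_tau, of v "Suc (2 * v)"]
    by (simp add: tau_def mult.assoc)
qed

lemma tau_sq: "tau v * tau v = 0"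
  by (subst (1) tau_def) (simp add: mult.assoc th_tau)

text \<open>Multiplication by \<open>tau v\<close> kills every term with a generator of
  \<open>v\<close>, so only \<open>tau u * tau v\<close> survives from the quadratic part. The
  resulting form is symmetric in \<open>u\<close> and \<open>v\<close>, which makes the orientation
  of a listed edge irrelevant.\<close>

lemma ff_eq:
  "ff u v = (th (2*u) - th (2*v)) * (th (2*u+1) - th (2*v+1)) - tau u * tau v"
proof -
  have "(th (2*u) - th (2*v)) * (th (2*u+1) - th (2*v+1)) * tau v
      = (th (2*u) - th (2*v)) * (tau v * th (2*u+1))"
    by (simp add: mult.assoc left_diff_distrib th_tau even_op_th_comm)
  also have "\<dots> = th (2*u) * tau v * th (2*u+1)"
    by (simp add: left_diff_distrib th_tau flip: mult.assoc)
  also have "\<dots> = tau u * tau v"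
    by (simp add: mult.assoc even_op_th_comm) (simp add: tau_def mult.assoc)
  finally show ?thesis by (simp add: ff_def right_diff_distrib)
qed

lemma ff_sym: "ff u v = ff v u"
proof -
  have "(th (2*u) - th (2*v)) * (th (2*u+1) - th (2*v+1)) =
      (th (2*v) - th (2*u)) * (th (2*v+1) - th (2*u+1))"
    by (metis minus_diff_eq minus_mult_minus)
  then show ?thesis
    using even_op_comm[OF even_op_tau even_op_tau, of u v] by (simp add: ff_eq)
qed

text \<open>As \<open>tau v\<close> squares to zero, \<open>(1 + tau v) * (1 - tau v) = 1\<close>:
  the vertex weight cancels the last factor of \<open>ff u v\<close>.\<close>

lemma ff_leaf: "(1 + tau v) * ff u v = (th (2*u) - th (2*v)) * (th (2*u+1) - th (2*v+1))"
proof -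
  have "even_op ((th (2*u) - th (2*v)) * (th (2*u+1) - th (2*v+1)))"
    by (simp add: left_diff_distrib right_diff_distrib even_op_th even_op_diff)
  then have "(1 + tau v) * ((th (2*u) - th (2*v)) * (th (2*u+1) - th (2*v+1))) =
      (th (2*u) - th (2*v)) * (th (2*u+1) - th (2*v+1)) * (1 + tau v)"
    by (rule even_op_comm[rotated]) (simp add: even_op_add)
  moreover have "(1 + tau v) * ff u v =
      (1 + tau v) * ((th (2*u) - th (2*v)) * (th (2*u+1) - th (2*v+1))) * (1 - tau v)"
    by (simp only: ff_def mult.assoc)
  ultimately have "(1 + tau v) * ff u v =
      (th (2*u) - th (2*v)) * (th (2*u+1) - th (2*v+1)) * ((1 + tau v) * (1 - tau v))"
    by (simp only: mult.assoc)
  then show ?thesis by (simp add: algebra_simps tau_sq)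
qed

lemma free_tau: "u \<noteq> g div 2 \<Longrightarrow> free g (tau u)"
  unfolding tau_def by (intro free_mult free_th) auto

lemma free_ff: "u \<noteq> g div 2 \<Longrightarrow> v \<noteq> g div 2 \<Longrightarrow> free g (ff u v)"
  unfolding ff_def by (intro free_mult free_diff free_1 free_th free_tau) auto

text \<open>The step that removes a leaf \<open>v\<close>, with everything else collected in
  \<open>y\<close>. Of the four terms of the expansion only \<open>tau v\<close> contains both
  generators of \<open>v\<close>.\<close>

lemma top_coeff_leaf:
  assumes "free (2*v) y" "free (2*v+1) y" "u \<noteq> v" "v < n"
  shows "top_coeff (2*n) (y * ((1 + tau v) * ff u v)) = top_coeff (2*n) (y * tau v)"
proof -
  have "y * ((1 + tau v) * ff u v) =
     y * tau u - y * (th (2*u) * th (2*v+1)) - y * (th (2*v) * th (2*u+1)) + y * tau v"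
    unfolding ff_leaf by (simp add: tau_def algebra_simps)
  moreover have lt: "2*v < 2*n" "2*v+1 < 2*n" and ne: "2*v \<noteq> 2*u" "2*v \<noteq> 2*v+1" "2*v \<noteq> 2*u+1" "2*v+1 \<noteq> 2*u" "2*v+1 \<noteq> 2*v" "2*v+1 \<noteq> 2*u+1"
    using assms(3,4) by presburger+
  moreover have "top_coeff (2*n) (y * tau u) = 0"
    unfolding tau_def by (rule top_coeff_free[OF _ lt(1)]) (intro free_mult free_th ne assms)
  moreover have "top_coeff (2*n) (y * (th (2*u) * th (2*v+1))) = 0"
    by (rule top_coeff_free[OF _ lt(1)]) (intro free_mult free_th ne assms)
  moreover have "top_coeff (2*n) (y * (th (2*v) * th (2*u+1))) = 0"
    by (rule top_coeff_free[OF _ lt(2)]) (intro free_mult free_th ne assms)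
  ultimately show ?thesis by (simp only: top_coeff_linear)
qed

lemma top_coeff_prod_tau: "top_coeff (2*n) (prod_list (map tau [0..<n])) = 1"
proof -
  \<comment> \<open>Generalised to the vertices from \<open>k\<close> on: \<open>tau k\<close>
    strips the two least elements, and this carries no sign.\<close>
  have "app (prod_list (map tau [k..<n])) (\<lambda>S. if S = {} then 1 else 0) {2*k..<2*n} = 1"
    if "k \<le> n" for k
    using that
  proof (induction rule: inc_induct)
    case (step k)
    have sets: "{j \<in> {2*k..<2*n}. j < 2*k} = {}" "{j \<in> {2*k..<2*n} - {2*k}. j < 2*k+1} = {}"
      "{2*k..<2*n} - {2*k} - {2*k+1} = {2 * Suc k..<2*n}" by auto
    have "app (tau k) f {2*k..<2*n} = f {2 * Suc k..<2*n}" for f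
      unfolding tau_def using step.hyps by (simp only: app_simps app_th sets) simp
    then show ?case using step by (simp add: upt_conv_Cons)
  qed simp
  from this[of 0] show ?thesis by (simp add: top_coeff_def lessThan_atLeast0)
qed

text \<open>\<open>R\<close> is the set of vertices still open. The weight of a vertex outside has
  been reduced to \<open>tau v\<close>, by removing a leaf or by extracting the coefficient of
  \<open>tau v\<close>; both inductions shrink \<open>R\<close>.\<close>

definition weight :: "nat \<Rightarrow> nat set \<Rightarrow> fop" where
  "weight n R = prod_list (map (\<lambda>v. if v \<in> R then 1 + tau v else tau v) [0..<n])"

definition weight_except :: "nat \<Rightarrow> nat set \<Rightarrow> nat \<Rightarrow> fop" where
  "weight_except n R w = prod_list (map (\<lambda>v. if v \<in> R then 1 + tau v else tau v) (filter (\<lambda>v. v \<noteq> w) [0..<n]))"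

lemma even_op_weight [simp]: "even_op (weight n R)"
  and even_op_weight_except [simp]: "even_op (weight_except n R w)"
  unfolding weight_def weight_except_def by (auto intro!: even_op_prod_list even_op_add)

lemma free_weight_except: "g div 2 = w \<Longrightarrow> free g (weight_except n R w)"
  unfolding weight_except_def
  by (intro free_prod_list) (auto intro!: free_add free_1 free_tau)

lemma weight_extract:
  assumes "w < n"
  shows "weight n R = weight_except n R w * (if w \<in> R then 1 + tau w else tau w)"
proof -
  let ?g = "\<lambda>v. if v \<in> R then 1 + tau v else tau v"
  have split: "[0..<n] = [0..<w] @ w # [Suc w..<n]"
    using assms by (metis less_imp_le_nat upt_add_eq_append upt_conv_Cons le_add_diff_inverse le0 add_0)
  have filt: "filter (\<lambda>v. v \<noteq> w) [0..<n] = [0..<w] @ [Suc w..<n]"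
    unfolding split by (auto simp: filter_id_conv)
  have "weight n R = ?g w * weight_except n R w"
    unfolding weight_def weight_except_def filt unfolding split map_append list.map
    by (rule prod_list_extract) (auto intro!: even_op_add)
  then show ?thesis using even_op_comm[of "?g w"] by (auto simp: even_op_add)
qed

lemma weight_except_remove: "weight_except n (R - {w}) w = weight_except n R w"
  unfolding weight_except_def by (intro arg_cong[of _ _ prod_list] map_cong) auto

abbreviation edge_prod :: "(nat \<times> nat) list \<Rightarrow> fop" where
  "edge_prod as \<equiv> prod_list (map (\<lambda>(u, v). ff u v) as)"

lemma even_op_edge_prod [simp]: "even_op (edge_prod as)"
  by (auto intro!: even_op_prod_list)

lemma edge_prod_extract:
  assumes "{u, v} \<in> (\<lambda>(u, v). {u, v}) ` set as"
  obtains as1 p q as2 where "as = as1 @ (p, q) # as2" "{p, q} = {u, v}"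
    "edge_prod as = edge_prod (as1 @ as2) * ff u v"
proof -
  obtain p q where pq: "(p, q) \<in> set as" "{p, q} = {u, v}" using assms by auto
  then obtain as1 as2 where as: "as = as1 @ (p, q) # as2" by (meson split_list)
  have "ff p q = ff u v" using pq(2) ff_sym by (auto simp: doubleton_eq_iff)
  moreover have "edge_prod as = ff p q * edge_prod (as1 @ as2)"
    unfolding as map_append list.map case_prod_conv by (rule prod_list_extract) auto
  ultimately have "edge_prod as = edge_prod (as1 @ as2) * ff u v"
    using even_op_comm[OF even_op_ff even_op_edge_prod] by metis
  with as pq(2) show thesis by (rule that)
qed

text \<open>In the presence of \<open>x\<close> the generators of \<open>u\<close> and
  \<open>v\<close> are identified. The relation is transitive and survives left multiplication, so
  it spreads along paths.\<close>

definition connects :: "fop \<Rightarrow> nat \<Rightarrow> nat \<Rightarrow> bool" where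
  "connects x u v \<longleftrightarrow> x * (th (2*u) - th (2*v)) = 0 \<and> x * (th (2*u+1) - th (2*v+1)) = 0"

lemma connects_trans: "connects x u v \<Longrightarrow> connects x v w \<Longrightarrow> connects x u w"
  unfolding connects_def by (simp add: right_diff_distrib)

lemma connects_mult: "connects x u v \<Longrightarrow> connects (y * x) u v"
  unfolding connects_def by (simp add: mult.assoc)

text \<open>Besides the even factor \<open>1 - tau v\<close>, the element contains each of the two
  differences, and these anticommute and square to zero.\<close>

lemma connects_ff: "connects (ff u v) u v"
proof -
  let ?d = "th (2*u) - th (2*v)" and ?e = "th (2*u+1) - th (2*v+1)"
  have comm: "(1 - tau v) * (th g - th h) = (th g - th h) * (1 - tau v)" for g h
    by (simp add: algebra_simps even_op_th_comm)
  have "?d * ?e * (?d * (1 - tau v)) = - (?e * ?d) * (?d * (1 - tau v))"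
    by (subst odd_diff_anticomm) simp
  also have "\<dots> = - (?e * (?d * ?d) * (1 - tau v))" by (simp only: minus_mult_left mult.assoc)
  finally have "ff u v * ?d = 0"
    unfolding ff_def mult.assoc[of _ "1 - tau v"] comm by (simp add: odd_diff_sq)
  moreover have "ff u v * ?e = ?d * (?e * ?e) * (1 - tau v)"
    unfolding ff_def mult.assoc[of _ "1 - tau v"] comm by (simp only: mult.assoc)
  ultimately show ?thesis unfolding connects_def by (simp add: odd_diff_sq)
qed

lemma connects_annihilates: "connects x u v \<Longrightarrow> x * ff u v = 0"
  unfolding connects_def ff_def by (simp flip: mult.assoc)

lemma edge_prod_cycle:
  assumes "\<not> acyclic_edges ((\<lambda>(u, v). {u, v}) ` set as)"
  shows "edge_prod as = 0"
proof -
  let ?A = "(\<lambda>(u, v). {u, v}) ` set as"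
  obtain vs where "cycle ?A vs" using assms unfolding acyclic_edges_def by blast
  then have vs: "3 \<le> length vs" "distinct vs"
    and edges: "\<And>i. i < length vs \<Longrightarrow> {vs ! i, vs ! (Suc i mod length vs)} \<in> ?A"
    unfolding cycle_def by simp_all
  define l where "l = length vs - 1"
  have l: "length vs = Suc l" "2 \<le> l" using vs(1) unfolding l_def by auto
  have "{vs ! l, vs ! 0} \<in> ?A" using edges[of l] l by simp
  then obtain as1 p q as2 where as: "as = as1 @ (p, q) # as2" and pq: "{p, q} = {vs ! l, vs ! 0}"
    and prod: "edge_prod as = edge_prod (as1 @ as2) * ff (vs ! l) (vs ! 0)"
    by (rule edge_prod_extract)
  let ?x = "edge_prod (as1 @ as2)"
  have step: "connects ?x (vs ! Suc i) (vs ! i)" if i: "i < l" for i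
  proof -
    have ne: "vs ! Suc i \<noteq> vs ! 0" "vs ! i \<noteq> vs ! l"
      "i \<noteq> 0 \<Longrightarrow> vs ! i \<noteq> vs ! 0" "Suc i \<noteq> l \<Longrightarrow> vs ! Suc i \<noteq> vs ! l"
      using nth_eq_iff_index_eq[OF vs(2)] i l by auto
    \<comment> \<open>A cycle has at least three vertices, so its other edges differ from the
      closing one and remain in the shortened list.\<close>
    have "{vs ! Suc i, vs ! i} \<noteq> {p, q}"
      unfolding pq using ne i l by (cases "i = 0") (auto simp: doubleton_eq_iff)
    moreover have "{vs ! Suc i, vs ! i} \<in> ?A"
      using edges[of i] i l by (simp add: insert_commute)
    ultimately have "{vs ! Suc i, vs ! i} \<in> (\<lambda>(u, v). {u, v}) ` set (as1 @ as2)"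
      unfolding as by auto
    then obtain bs1 r s bs2 where "?x = edge_prod (bs1 @ bs2) * ff (vs ! Suc i) (vs ! i)"
      by (rule edge_prod_extract)
    then show ?thesis using connects_mult[OF connects_ff] by simp
  qed
  have "i \<le> l \<Longrightarrow> connects ?x (vs ! i) (vs ! 0)" for i
  proof (induction i)
    case 0
    then show ?case by (simp add: connects_def)
  next
    case (Suc i)
    then show ?case using step[of i] connects_trans by auto
  qed
  from connects_annihilates[OF this[of l]] show ?thesis using prod by simp
qed

text \<open>Each step of the induction takes one vertex out of \<open>R\<close>: a leaf together
  with its edge, or any vertex once no edges are left. In the end only the product of all
  \<open>tau v\<close> remains.\<close>

lemma top_coeff_acyclic:
  assumes "acyclic_edges ((\<lambda>(u, v). {u, v}) ` set as)"
    and "distinct (map (\<lambda>(u, v). {u, v}) as)"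
    and "\<And>u v. (u, v) \<in> set as \<Longrightarrow> u \<noteq> v \<and> u \<in> R \<and> v \<in> R"
    and "R \<subseteq> {..<n}"
  shows "top_coeff (2*n) (weight n R * edge_prod as) = 1"
proof -
  have "finite R" using assms(4) by (rule finite_subset) simp
  then show ?thesis using assms
  proof (induction R arbitrary: as rule: finite_psubset_induct)
    case (psubset R)
    let ?A = "(\<lambda>(u, v). {u, v}) ` set as"
    show ?case
    proof (cases "as = []")
      case True
      show ?thesis
      proof (cases "R = {}")
        case True
        then show ?thesis using \<open>as = []\<close> top_coeff_prod_tau[of n]
          by (simp add: weight_def)
      next
        case False
        then obtain v where v: "v \<in> R" by blast
        have "v < n" using v psubset.prems(4) by auto
        have "top_coeff (2*n) (weight n (R - {v}) * edge_prod []) = 1"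
          by (rule psubset.IH) (use v psubset.prems in \<open>auto simp: acyclic_edges_def cycle_def\<close>)
        moreover have "top_coeff (2*n) (weight_except n R v) = 0"
          by (rule top_coeff_free[OF free_weight_except[of "2*v"]]) (use \<open>v < n\<close> in auto)
        ultimately show ?thesis
          using v \<open>as = []\<close> \<open>v < n\<close> by (simp add: weight_extract[of v] weight_except_remove distrib_left)
      qed
    next
      case False
      have "\<exists>u v. u \<noteq> v \<and> {u, v} \<in> ?A \<and> (\<forall>e\<in>?A. v \<in> e \<longrightarrow> e = {u, v})"
      proof (rule acyclic_edges_leaf)
        show "card e = 2" if "e \<in> ?A" for e using that psubset.prems(3) by auto
      qed (use False psubset.prems(1) in auto)
      then obtain u v where *: "u \<noteq> v \<and> {u, v} \<in> ?A \<and> (\<forall>e\<in>?A. v \<in> e \<longrightarrow> e = {u, v})"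
        by (elim exE)
      then have uv: "u \<noteq> v" "{u, v} \<in> ?A" by (rule conjunct1, elim conjE)
      have leaf: "e = {u, v}" if "e \<in> ?A" "v \<in> e" for e
        using *[THEN conjunct2, THEN conjunct2, THEN bspec, OF that(1)] that(2) by (rule mp)
      obtain as1 p q as2 where as: "as = as1 @ (p, q) # as2" and pq: "{p, q} = {u, v}"
        and prod: "edge_prod as = edge_prod (as1 @ as2) * ff u v"
        by (rule edge_prod_extract[OF uv(2)])
      have "(p, q) \<in> set as" unfolding as by simp
      from psubset.prems(3)[OF this] have "p \<in> R" "q \<in> R" by blast+
      moreover have "v \<in> {p, q}" unfolding pq by simp
      ultimately have v: "v \<in> R" "v < n" using psubset.prems(4) by blast+
      have "r \<noteq> v \<and> s \<noteq> v" if "(r, s) \<in> set (as1 @ as2)" for r s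
      proof -
        have "{p, q} \<notin> (\<lambda>(u, v). {u, v}) ` set (as1 @ as2)"
          using psubset.prems(2) unfolding as by (simp add: image_Un)
        moreover have "{r, s} \<in> (\<lambda>(u, v). {u, v}) ` set (as1 @ as2)" using that by force
        ultimately have "{r, s} \<noteq> {u, v}" unfolding pq by metis
        moreover have "{r, s} \<in> ?A" using that unfolding as by force
        ultimately have "v \<notin> {r, s}" using leaf by metis
        then show ?thesis by auto
      qed
      then have nv: "(v, s) \<notin> set as1" "(s, v) \<notin> set as1" "(v, s) \<notin> set as2" "(s, v) \<notin> set as2" for s
        by auto
      have IH: "top_coeff (2*n) (weight n (R - {v}) * edge_prod (as1 @ as2)) = 1"
      proof (rule psubset.IH)
        show "acyclic_edges ((\<lambda>(u, v). {u, v}) ` set (as1 @ as2))"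
          using psubset.prems(1) unfolding as acyclic_edges_def cycle_def by fastforce
      qed (use v psubset.prems nv in \<open>auto simp: as\<close>)
      let ?y = "weight_except n R v * edge_prod (as1 @ as2)"
      have free: "free (2*v) ?y" "free (2*v+1) ?y"
        by (auto intro!: free_mult free_weight_except free_prod_list free_ff simp: nv)
      have comm: "edge_prod (as1 @ as2) * x = x * edge_prod (as1 @ as2)" if "even_op x" for x
        by (rule even_op_comm[OF even_op_edge_prod that])
      have "weight n R * edge_prod as = ?y * ((1 + tau v) * ff u v)"
        unfolding prod weight_extract[OF v(2)] using v comm[of "1 + tau v"]
        by (simp add: even_op_add mult.assoc) (simp add: even_op_add flip: mult.assoc)
      also have "top_coeff (2*n) \<dots> = top_coeff (2*n) (?y * tau v)"
        by (rule top_coeff_leaf[OF free uv(1) v(2)])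
      also have "?y * tau v = weight n (R - {v}) * edge_prod (as1 @ as2)"
        unfolding weight_extract[OF v(2)] weight_except_remove using comm[of "tau v"]
        by (simp add: mult.assoc)
      finally show ?thesis using IH by simp
    qed
  qed
qed

text \<open>\<open>as\<close> holds the edges already chosen. Expanding one factor
  \<open>1 + ff u v\<close> splits the edge sets according to whether they contain
  \<open>{u, v}\<close>.\<close>

lemma top_coeff_expand:
  assumes "distinct (map (\<lambda>(u, v). {u, v}) (as @ es))"
    and "\<And>u v. (u, v) \<in> set (as @ es) \<Longrightarrow> u \<noteq> v \<and> u < n \<and> v < n"
  shows "top_coeff (2*n) (weight n {..<n} * edge_prod as * prod_list (map (\<lambda>(u, v). 1 + ff u v) es)) =
    int (card {A. A \<subseteq> (\<lambda>(u, v). {u, v}) ` set es \<and> acyclic_edges ((\<lambda>(u, v). {u, v}) ` set as \<union> A)})"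
  using assms
proof (induction es arbitrary: as)
  case Nil
  show ?case
  proof (cases "acyclic_edges ((\<lambda>(u, v). {u, v}) ` set as)")
    case True
    then have "{A. A \<subseteq> {} \<and> acyclic_edges ((\<lambda>(u, v). {u, v}) ` set as \<union> A)} = {{}}" by auto
    moreover have "top_coeff (2*n) (weight n {..<n} * edge_prod as) = 1"
      by (rule top_coeff_acyclic) (use Nil True in auto)
    ultimately show ?thesis by simp
  next
    case False
    then have "{A. A \<subseteq> {} \<and> acyclic_edges ((\<lambda>(u, v). {u, v}) ` set as \<union> A)} = {}" by auto
    with False show ?thesis by (simp add: edge_prod_cycle)
  qed
next
  case (Cons e es)
  obtain u v where e: "e = (u, v)" by (cases e)
  let ?A = "(\<lambda>(u, v). {u, v}) ` set as" and ?E = "(\<lambda>(u, v). {u, v}) ` set es"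
  let ?W = "weight n {..<n}" and ?Q = "prod_list (map (\<lambda>(u, v). 1 + ff u v) es)"
  have new: "{u, v} \<notin> ?E" using Cons.prems(1) unfolding e by auto
  have "{A. A \<subseteq> insert {u, v} ?E \<and> acyclic_edges (?A \<union> A)} =
     {A. A \<subseteq> ?E \<and> acyclic_edges (?A \<union> A)} \<union>
     insert {u, v} ` {A. A \<subseteq> ?E \<and> acyclic_edges (insert {u, v} ?A \<union> A)}" (is "?L = ?L1 \<union> ?g ` ?L2")
  proof (intro equalityI subsetI)
    fix A assume A: "A \<in> ?L"
    show "A \<in> ?L1 \<union> ?g ` ?L2"
    proof (cases "{u, v} \<in> A")
      case True
      have "A = insert {u, v} (A - {{u, v}})" "insert {u, v} ?A \<union> (A - {{u, v}}) = ?A \<union> A"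
        using True by auto
      moreover from this have "A - {{u, v}} \<in> ?L2" using A by auto
      ultimately have "A = insert {u, v} (A - {{u, v}})" "A - {{u, v}} \<in> ?L2" by blast+
      then show ?thesis by blast
    qed (use A in auto)
  qed auto
  moreover have "card (?L1 \<union> ?g ` ?L2) = card ?L1 + card (?g ` ?L2)"
    by (rule card_Un_disjoint) (use new in auto)
  moreover have "card (?g ` ?L2) = card ?L2"
  proof (rule card_image, rule inj_onI)
    fix A B assume AB: "A \<in> ?L2" "B \<in> ?L2" "insert {u, v} A = insert {u, v} B"
    then have "{u, v} \<notin> A" "{u, v} \<notin> B" using new by auto
    with AB(3) show "A = B" by (simp add: insert_ident)
  qed
  ultimately have card: "card {A. A \<subseteq> (\<lambda>(u, v). {u, v}) ` set (e # es) \<and> acyclic_edges (?A \<union> A)} =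
      card ?L1 + card ?L2" by (simp add: e)
  have "top_coeff (2*n) (?W * edge_prod as * ?Q) = int (card ?L1)"
    by (rule Cons.IH) (use Cons.prems in auto)
  moreover have "top_coeff (2*n) (?W * edge_prod (as @ [e]) * ?Q) = int (card ?L2)"
    using Cons.IH[of "as @ [e]"] Cons.prems by (simp add: e)
  ultimately show ?case unfolding card
    by (simp add: e algebra_simps)
qed

theorem forests_top_coeff:
  assumes "distinct (map (\<lambda>(u, v). {u, v}) es)"
    and "\<And>u v. (u, v) \<in> set es \<Longrightarrow> u \<noteq> v \<and> u < n \<and> v < n"
  shows "top_coeff (2*n) (weight n {..<n} * prod_list (map (\<lambda>(u, v). 1 + ff u v) es)) =
    int (card (forests (set (map (\<lambda>(u, v). {u, v}) es))))"
  using top_coeff_expand[of "[]" es n] assms by (simp add: forests_def)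

section \<open>Values and running times of calls\<close>

definition halts :: "program \<Rightarrow> nat \<Rightarrow> sexp list \<Rightarrow> bool" where
  "halts P f vs \<longleftrightarrow> f < length P \<and> (\<exists>v t. eval P vs (P ! f) v t)"

text \<open>Evaluation is deterministic, so value and step count of a call are functions;
  simplification can then execute a body symbolically, with calls as known functions.\<close>

definition result :: "program \<Rightarrow> nat \<Rightarrow> sexp list \<Rightarrow> sexp" where
  "result P f vs = (THE v. \<exists>t. eval P vs (P ! f) v t)"

definition steps :: "program \<Rightarrow> nat \<Rightarrow> sexp list \<Rightarrow> nat" where
  "steps P f vs = (THE t. \<exists>v. eval P vs (P ! f) v t)"

lemma eval_result_steps:
  assumes "eval P vs (P ! f) v t"
  shows "result P f vs = v" "steps P f vs = t"
  using assms eval_deterministic(1)[OF assms] unfolding result_def steps_def by blast+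

text \<open>Value and running time of an expression as functions, relative to the values and running
  times of the calls in it; they are meaningful if the evaluation is defined.\<close>

fun val :: "program \<Rightarrow> sexp list \<Rightarrow> expr \<Rightarrow> sexp" where
  "val P env (Var i) = env ! i"
| "val P env AtomE = Atom"
| "val P env (NodeE a b) = Node (val P env a) (val P env b)"
| "val P env (Hd a) = hd_sexp (val P env a)"
| "val P env (Tl a) = tl_sexp (val P env a)"
| "val P env (IfNode c a b) = (if val P env c = Atom then val P env b else val P env a)"
| "val P env (Let a b) = val P (val P env a # env) b"
| "val P env (Call f es) = result P f (map (val P env) es)"

fun tim :: "program \<Rightarrow> sexp list \<Rightarrow> expr \<Rightarrow> nat" where
  "tim P env (Var i) = 1"
| "tim P env AtomE = 1"
| "tim P env (NodeE a b) = Suc (tim P env a + tim P env b)"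
| "tim P env (Hd a) = Suc (tim P env a)"
| "tim P env (Tl a) = Suc (tim P env a)"
| "tim P env (IfNode c a b) = Suc (tim P env c + (if val P env c = Atom then tim P env b else tim P env a))"
| "tim P env (Let a b) = Suc (tim P env a + tim P (val P env a # env) b)"
| "tim P env (Call f es) = Suc (sum_list (map (tim P env) es) + steps P f (map (val P env) es))"

text \<open>Calls enter through \<open>halts\<close> and not by unfolding, so the induction
  hypothesis for a smaller argument discharges a recursive call.\<close>

fun defined :: "program \<Rightarrow> sexp list \<Rightarrow> expr \<Rightarrow> bool" where
  "defined P env (Var i) \<longleftrightarrow> i < length env"
| "defined P env AtomE \<longleftrightarrow> True"
| "defined P env (NodeE a b) \<longleftrightarrow> defined P env a \<and> defined P env b"
| "defined P env (Hd a) \<longleftrightarrow> defined P env a"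
| "defined P env (Tl a) \<longleftrightarrow> defined P env a"
| "defined P env (IfNode c a b) \<longleftrightarrow> defined P env c \<and>
     (if val P env c = Atom then defined P env b else defined P env a)"
| "defined P env (Let a b) \<longleftrightarrow> defined P env a \<and> defined P (val P env a # env) b"
| "defined P env (Call f es) \<longleftrightarrow> list_all (defined P env) es \<and> halts P f (map (val P env) es)"

lemma evals_map:
  "(\<And>e. e \<in> set es \<Longrightarrow> eval P env e (g e) (h e)) \<Longrightarrow> evals P env es (map g es) (sum_list (map h es))"
  by (induction es) (auto intro: eval_evals.intros)

lemma eval_val_tim: "defined P env e \<Longrightarrow> eval P env e (val P env e) (tim P env e)"
proof (induction P env e rule: defined.induct)
  case (6 P env c a b)
  then show ?case
    by (cases "val P env c") (auto intro: eval_evals.intros)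
next
  case (8 P env f es)
  let ?vs = "map (val P env) es"
  obtain v t where vt: "f < length P" "eval P ?vs (P ! f) v t"
    using 8 unfolding defined.simps halts_def by blast
  have "evals P env es ?vs (sum_list (map (tim P env) es))"
    by (rule evals_map) (use 8 in \<open>auto simp: list_all_iff\<close>)
  from eval_Call[OF vt(1) this vt(2)] show ?case
    by (simp add: eval_result_steps[OF vt(2)])
qed (auto intro: eval_evals.intros simp flip: One_nat_def)

text \<open>Exact step counts are weakened to upper bounds here; cost recurrences are solved in this
  form.\<close>

definition computes :: "program \<Rightarrow> nat \<Rightarrow> sexp list \<Rightarrow> sexp \<Rightarrow> nat \<Rightarrow> bool" where
  "computes P f vs v B \<longleftrightarrow> halts P f vs \<and> result P f vs = v \<and> steps P f vs \<le> B"

lemma computesI: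
  assumes "f < length P" "P ! f = e" "defined P vs e" "val P vs e = v" "tim P vs e \<le> B"
  shows "computes P f vs v B"
proof -
  have "eval P vs (P ! f) v (tim P vs e)" using eval_val_tim[OF assms(3)] assms(2,4) by simp
  from eval_result_steps[OF this] this show ?thesis
    using assms(1,5) unfolding computes_def halts_def by auto
qed

lemma computesD:
  assumes "computes P f vs v B"
  shows "halts P f vs" "result P f vs = v" "steps P f vs \<le> B"
  using assms unfolding computes_def by auto

lemma computes_mono: "computes P f vs v B \<Longrightarrow> B \<le> B' \<Longrightarrow> computes P f vs v B'"
  unfolding computes_def by auto

lemma computes_eval: "computes P f vs v B \<Longrightarrow> \<exists>t\<le>B. f < length P \<and> eval P vs (P ! f) v t"
  unfolding computes_def halts_def by (auto dest: eval_result_steps)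

section \<open>The program\<close>

abbreviation (input) MAIN :: nat where "MAIN \<equiv> 0"
abbreviation (input) DBL :: nat where "DBL \<equiv> Suc 0"
abbreviation (input) ADDC :: nat where "ADDC \<equiv> 2"
abbreviation (input) MULN :: nat where "MULN \<equiv> 3"
abbreviation (input) SUBC :: nat where "SUBC \<equiv> 4"
abbreviation (input) EQS :: nat where "EQS \<equiv> 5"
abbreviation (input) ONE :: nat where "ONE \<equiv> 6"
abbreviation (input) GEN :: nat where "GEN \<equiv> 7"
abbreviation (input) ADD :: nat where "ADD \<equiv> 8"
abbreviation (input) NEG :: nat where "NEG \<equiv> 9"
abbreviation (input) INV :: nat where "INV \<equiv> 10"
abbreviation (input) MUL :: nat where "MUL \<equiv> 11"
abbreviation (input) DER :: nat where "DER \<equiv> 12"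
abbreviation (input) GDIFF :: nat where "GDIFF \<equiv> 13"
abbreviation (input) VERT :: nat where "VERT \<equiv> 14"
abbreviation (input) EDGE :: nat where "EDGE \<equiv> 15"
abbreviation (input) MEM :: nat where "MEM \<equiv> 16"
abbreviation (input) SUBS :: nat where "SUBS \<equiv> 17"
abbreviation (input) DEL :: nat where "DEL \<equiv> 18"
abbreviation (input) GOOD :: nat where "GOOD \<equiv> 19"
abbreviation (input) FINDV :: nat where "FINDV \<equiv> 20"
abbreviation (input) FINDB :: nat where "FINDB \<equiv> 21"
abbreviation (input) PRODV :: nat where "PRODV \<equiv> 22"
abbreviation (input) FILT :: nat where "FILT \<equiv> 23"
abbreviation (input) PALL :: nat where "PALL \<equiv> 24"
abbreviation (input) EXTR :: nat where "EXTR \<equiv> 25"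
abbreviation (input) SOLVE :: nat where "SOLVE \<equiv> 26"
abbreviation (input) RANGE :: nat where "RANGE \<equiv> 27"
abbreviation (input) INITE :: nat where "INITE \<equiv> 28"
abbreviation (input) INITB :: nat where "INITB \<equiv> 29"

text \<open>An algebra element is \<open>Atom\<close> (zero), a \<open>LEAF\<close> with the natural numbers \<open>p\<close> and \<open>q\<close> for the
  integer \<open>p - q\<close>, or a branch \<open>BR\<close>; the last two are told apart by their heads.\<close>

abbreviation (input) TT :: expr where "TT \<equiv> NodeE AtomE AtomE"
abbreviation (input) NOT :: "expr \<Rightarrow> expr" where "NOT e \<equiv> IfNode e AtomE TT"
abbreviation (input) LEAF :: "expr \<Rightarrow> expr \<Rightarrow> expr" where "LEAF p q \<equiv> NodeE AtomE (NodeE p q)"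
abbreviation (input) BR :: "expr \<Rightarrow> expr \<Rightarrow> expr" where "BR x y \<equiv> NodeE (NodeE x y) AtomE"
abbreviation V0 :: expr where "V0 \<equiv> Var 0"
abbreviation V1 :: expr where "V1 \<equiv> Var (Suc 0)"
abbreviation V2 :: expr where "V2 \<equiv> Var 2"

section \<open>Code for natural numbers\<close>

definition "dbl_code = IfNode V0 (NodeE AtomE V0) AtomE"

definition "adder_code = IfNode (Hd V0)
  (IfNode (Hd V1) (NodeE V2 (Call ADDC [Tl V0, Tl V1, TT])) (NodeE (NOT V2) (Call ADDC [Tl V0, Tl V1, V2])))
  (IfNode (Hd V1) (NodeE (NOT V2) (Call ADDC [Tl V0, Tl V1, V2])) (NodeE V2 (Call ADDC [Tl V0, Tl V1, AtomE])))"

definition "addc_code = IfNode V0 adder_code (IfNode V1 adder_code (IfNode V2 (NodeE TT AtomE) AtomE))"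

definition "muln_code =
  IfNode V0 (Call ADDC [IfNode (Hd V0) V1 AtomE, Call DBL [Call MULN [Tl V0, V1]], AtomE]) AtomE"

text \<open>A low bit 0 is prepended by \<open>DBL\<close>, which keeps zero as \<open>Atom\<close>
  and so avoids leading zeros.\<close>

definition "subc_code = IfNode V0
  (IfNode (Hd V0)
    (IfNode (Hd V1)
      (IfNode V2 (NodeE TT (Call SUBC [Tl V0, Tl V1, V2])) (Call DBL [Call SUBC [Tl V0, Tl V1, V2]]))
      (IfNode V2 (Call DBL [Call SUBC [Tl V0, Tl V1, AtomE]]) (NodeE TT (Call SUBC [Tl V0, Tl V1, AtomE]))))
    (IfNode (Hd V1)
      (IfNode V2 (Call DBL [Call SUBC [Tl V0, Tl V1, TT]]) (NodeE TT (Call SUBC [Tl V0, Tl V1, TT])))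
      (IfNode V2 (NodeE TT (Call SUBC [Tl V0, Tl V1, V2])) (Call DBL [Call SUBC [Tl V0, Tl V1, V2]]))))
  AtomE"

definition "eqs_code = IfNode V0
  (IfNode V1 (IfNode (Call EQS [Hd V0, Hd V1]) (Call EQS [Tl V0, Tl V1]) AtomE) AtomE)
  (IfNode V1 AtomE TT)"

section \<open>Code for algebra elements\<close>

definition "one_code = IfNode V0 (BR (Call ONE [Tl V0]) AtomE) (LEAF (NodeE TT AtomE) AtomE)"

definition "gen_code = IfNode V0
  (IfNode (Call EQS [Hd V0, V1]) (BR AtomE (Call ONE [Tl V0])) (BR (Call GEN [Tl V0, V1]) AtomE))
  AtomE"

definition "add_code = IfNode V0
  (IfNode V1
    (IfNode (Hd V0)
      (BR (Call ADD [Hd (Hd V0), Hd (Hd V1)]) (Call ADD [Tl (Hd V0), Tl (Hd V1)]))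
      (LEAF (Call ADDC [Hd (Tl V0), Hd (Tl V1), AtomE]) (Call ADDC [Tl (Tl V0), Tl (Tl V1), AtomE])))
    V0)
  V1"

definition "neg_code = IfNode V0
  (IfNode (Hd V0) (BR (Call NEG [Hd (Hd V0)]) (Call NEG [Tl (Hd V0)])) (LEAF (Tl (Tl V0)) (Hd (Tl V0))))
  AtomE"

definition "inv_code = IfNode V1
  (IfNode (Hd V1)
    (BR (Call INV [V0, Hd (Hd V1)]) (Call INV [NOT V0, Tl (Hd V1)]))
    (IfNode V0 (LEAF (Tl (Tl V1)) (Hd (Tl V1))) V1))
  AtomE"

definition "mul_code = IfNode V0
  (IfNode V1
    (IfNode (Hd V0)
      (BR (Call MUL [Hd (Hd V0), Hd (Hd V1)])
        (Call ADD [Call MUL [Hd (Hd V0), Tl (Hd V1)],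
          Call MUL [Tl (Hd V0), Call INV [AtomE, Hd (Hd V1)]]]))
      (LEAF
        (Call ADDC [Call MULN [Hd (Tl V0), Hd (Tl V1)], Call MULN [Tl (Tl V0), Tl (Tl V1)], AtomE])
        (Call ADDC [Call MULN [Hd (Tl V0), Tl (Tl V1)], Call MULN [Tl (Tl V0), Hd (Tl V1)], AtomE])))
    AtomE)
  AtomE"

definition "der_code = IfNode V1
  (IfNode V0
    (IfNode (Call EQS [Hd V0, V2])
      (BR (Tl (Hd V1)) AtomE)
      (BR (Call DER [Tl V0, Hd (Hd V1), V2]) (Call NEG [Call DER [Tl V0, Tl (Hd V1), V2]])))
    AtomE)
  AtomE"

definition "gdiff_code = Call ADD [Call GEN [V0, V1], Call NEG [Call GEN [V0, V2]]]"

definition "vert_code = Call ADD [Call ONE [V0],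
  Call MUL [Call GEN [V0, NodeE AtomE V1], Call GEN [V0, NodeE TT V1]]]"

definition "edge_code = Call ADD [Call ONE [V0], Call MUL
  [Call MUL [Call GDIFF [V0, NodeE AtomE V1, NodeE AtomE V2], Call GDIFF [V0, NodeE TT V1, NodeE TT V2]],
   Call ADD [Call ONE [V0], Call NEG [Call MUL [Call GEN [V0, NodeE AtomE V2], Call GEN [V0, NodeE TT V2]]]]]]"

section \<open>Code for scopes and the search for a vertex\<close>

definition "mem_code = IfNode V1
  (IfNode (Call EQS [V0, Hd V1]) TT (Call MEM [V0, Tl V1]))
  AtomE"

definition "subs_code = IfNode V0
  (IfNode (Call MEM [Hd V0, V1]) (Call SUBS [Tl V0, V1]) AtomE)
  TT"

definition "del_code = IfNode V1
  (IfNode (Call EQS [V0, Hd V1]) (Call DEL [V0, Tl V1]) (NodeE (Hd V1) (Call DEL [V0, Tl V1])))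
  AtomE"

definition "good_code = IfNode V2
  (IfNode (Call MEM [V0, Hd (Hd V2)])
    (IfNode (Call SUBS [Hd (Hd V2), V1]) (Call GOOD [V0, V1, Tl V2]) AtomE)
    (Call GOOD [V0, V1, Tl V2]))
  TT"

definition "findv_code = IfNode V0
  (IfNode (Call GOOD [Hd V0, V1, V2]) (NodeE (Hd V0) V1) (Call FINDV [Tl V0, V1, V2]))
  AtomE"

text \<open>Under the \<open>Let\<close>, \<open>V0\<close> is the outcome for the first scope,
  \<open>V1\<close> the list being searched and \<open>V2\<close> the list of all factors.\<close>

definition "findb_code = IfNode V0
  (Let (Call FINDV [Hd (Hd V0), Hd (Hd V0), V1]) (IfNode V0 V0 (Call FINDB [Tl V1, V2])))
  AtomE"

section \<open>Code for multiplying factors and eliminating vertices\<close>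

definition "prod_code = IfNode V1
  (IfNode (Call MEM [V0, Hd (Hd V1)])
    (Call PRODV [V0, Tl V1, Call MUL [V2, Tl (Hd V1)]])
    (Call PRODV [V0, Tl V1, V2]))
  V2"

definition "filt_code = IfNode V1
  (IfNode (Call MEM [V0, Hd (Hd V1)]) (Call FILT [V0, Tl V1]) (NodeE (Hd V1) (Call FILT [V0, Tl V1])))
  AtomE"

definition "pall_code = IfNode V0 (Call PALL [Tl V0, Call MUL [V1, Tl (Hd V0)]]) V1"

definition "extr_code = IfNode V0
  (IfNode (Hd V0) (Call EXTR [Hd (Hd V0)]) (Call SUBC [Hd (Tl V0), Tl (Tl V0), AtomE]))
  AtomE"

text \<open>Under the \<open>Let\<close>, \<open>V0\<close> is the chosen vertex with its scope,
  \<open>V1\<close> the generators and \<open>V2\<close> the factors. The coefficient is taken for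
  the second generator of the vertex and then for the first, so \<open>tau v\<close> comes off the
  right end without a sign.\<close>

definition "solve_code = Let (Call FINDB [V1, V1])
  (IfNode V0
    (Call SOLVE [V1, NodeE
      (NodeE (Call DEL [Hd V0, Tl V0])
        (Call DER [V1, Call DER [V1, Call PRODV [Hd V0, V2, Call VERT [V1, Hd V0]],
          NodeE TT (Hd V0)], NodeE AtomE (Hd V0)]))
      (Call FILT [Hd V0, V2])])
    (Call EXTR [Call PALL [V2, Call ONE [V1]]]))"

definition "range_code = IfNode (Call EQS [V0, V1])
  AtomE
  (NodeE (NodeE AtomE V0) (NodeE (NodeE TT V0) (Call RANGE [Call ADDC [V0, AtomE, TT], V1])))"

definition "inite_code = IfNode V1
  (NodeE
    (NodeE (NodeE (Hd (Hd V1)) (NodeE (Tl (Hd V1)) AtomE)) (Call EDGE [V0, Hd (Hd V1), Tl (Hd V1)]))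
    (Call INITE [V0, Tl V1, V2]))
  V2"

definition "initb_code = IfNode V1
  (NodeE (NodeE (Hd V1) (Call ONE [V0])) (Call INITB [V0, Tl V1]))
  AtomE"

definition "main_code = Let (Call RANGE [AtomE, Hd V0])
  (Call SOLVE [V0, Call INITE [V0, Hd (Tl V1), Call INITB [V0, Tl (Tl (Tl V1))]]])"

definition forest_program :: program where
  "forest_program = [main_code, dbl_code, addc_code, muln_code, subc_code, eqs_code, one_code, gen_code,
    add_code, neg_code, inv_code, mul_code, der_code, gdiff_code, vert_code, edge_code, mem_code,
    subs_code, del_code, good_code, findv_code, findb_code, prod_code, filt_code, pall_code,
    extr_code, solve_code, range_code, inite_code, initb_code]"

abbreviation call :: "nat \<Rightarrow> sexp list \<Rightarrow> sexp \<Rightarrow> nat \<Rightarrow> bool" where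
  "call \<equiv> computes forest_program"

lemma length_forest_program: "length forest_program = 30"
  by (simp add: forest_program_def)

lemma forest_program_nth:
  "forest_program ! MAIN = main_code" "forest_program ! DBL = dbl_code" "forest_program ! ADDC = addc_code"
  "forest_program ! MULN = muln_code" "forest_program ! SUBC = subc_code" "forest_program ! EQS = eqs_code"
  "forest_program ! ONE = one_code" "forest_program ! GEN = gen_code" "forest_program ! ADD = add_code"
  "forest_program ! NEG = neg_code" "forest_program ! INV = inv_code" "forest_program ! MUL = mul_code"
  "forest_program ! DER = der_code" "forest_program ! GDIFF = gdiff_code" "forest_program ! VERT = vert_code"
  "forest_program ! EDGE = edge_code" "forest_program ! MEM = mem_code" "forest_program ! SUBS = subs_code"
  "forest_program ! DEL = del_code" "forest_program ! GOOD = good_code" "forest_program ! FINDV = findv_code"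
  "forest_program ! FINDB = findb_code" "forest_program ! PRODV = prod_code" "forest_program ! FILT = filt_code"
  "forest_program ! PALL = pall_code" "forest_program ! EXTR = extr_code" "forest_program ! SOLVE = solve_code"
  "forest_program ! RANGE = range_code" "forest_program ! INITE = inite_code" "forest_program ! INITB = initb_code"
  by (simp_all add: forest_program_def)

lemma comp_code:
  assumes "forest_program ! f = e" "f < 30" "defined forest_program vs e"
    "val forest_program vs e = v" "tim forest_program vs e \<le> B"
  shows "call f vs v B"
  using computesI[of f forest_program] assms by (simp add: length_forest_program)

section \<open>Binary numbers as trees\<close>

lemma enc_nat_0 [simp]: "enc_nat 0 = Atom"
  by (simp add: enc_nat_def bits.simps)

lemma enc_nat_Node: "0 < n \<Longrightarrow> enc_nat n = Node (enc_bool (odd n)) (enc_nat (n div 2))"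
  unfolding enc_nat_def by (subst bits.simps) simp

lemma enc_nat_Atom_iff [simp]: "enc_nat n = Atom \<longleftrightarrow> n = 0"
  by (cases "n = 0") (auto simp: enc_nat_Node)

lemma hd_enc_nat [simp]: "hd_sexp (enc_nat n) = enc_bool (odd n)"
  by (cases "n = 0") (auto simp: enc_nat_Node)

lemma tl_enc_nat [simp]: "tl_sexp (enc_nat n) = enc_nat (n div 2)"
  by (cases "n = 0") (auto simp: enc_nat_Node)

lemma enc_bool_Atom_iff [simp]: "enc_bool b = Atom \<longleftrightarrow> \<not> b"
  by (cases b) auto

lemma enc_nat_1: "enc_nat (Suc 0) = Node (Node Atom Atom) Atom"
  by (simp add: enc_nat_Node)

lemma comp_DBL: "call DBL [enc_nat n] (enc_nat (2 * n)) 5"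
proof (rule comp_code[OF forest_program_nth(2)])
  show "val forest_program [enc_nat n] dbl_code = enc_nat (2 * n)"
    by (cases "n = 0") (auto simp: dbl_code_def enc_nat_Node[of "2 * n"])
qed (auto simp: dbl_code_def)

section \<open>Arithmetic\<close>

lemma comp_ADDC:
  "a < 2 ^ m \<Longrightarrow> b < 2 ^ m \<Longrightarrow> call ADDC [enc_nat a, enc_nat b, enc_bool c] (enc_nat (a + b + of_bool c)) (30 * (m + 1))"
proof (induction m arbitrary: a b c)
  case 0
  show ?case
    by (rule comp_code[OF forest_program_nth(3)]; cases c)
       (use 0 in \<open>auto simp: addc_code_def enc_nat_1\<close>)
next
  case (Suc m)
  show ?case
  proof (cases "a = 0 \<and> b = 0")
    case True
    show ?thesis
      by (rule comp_code[OF forest_program_nth(3)]; cases c) (use True in \<open>auto simp: addc_code_def enc_nat_1\<close>)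
  next
    case False
    have IH: "call ADDC [enc_nat (a div 2), enc_nat (b div 2), enc_bool c'] (enc_nat (a div 2 + b div 2 + of_bool c')) (30 * (m + 1))" for c'
      by (rule Suc.IH) (use Suc.prems in auto)
    note IHT = IH[of True, simplified] and IHF = IH[of False, simplified]
    have "enc_nat (a + b + of_bool c) =
        Node (enc_bool (odd (a + b + of_bool c))) (enc_nat ((a + b + of_bool c) div 2))"
      using False by (intro enc_nat_Node) auto
    moreover have "(a + b + of_bool c) div 2 =
        a div 2 + b div 2 + of_bool (odd a \<and> odd b \<or> c \<and> (odd a \<or> odd b))"
      by (cases c) (simp_all, presburger+)
    ultimately have sum: "enc_nat (a + b + of_bool c) = Node (enc_bool (odd (a + b + of_bool c)))
        (enc_nat (a div 2 + b div 2 + of_bool (odd a \<and> odd b \<or> c \<and> (odd a \<or> odd b))))" by simp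
    show ?thesis
      unfolding sum
      by (rule comp_code[OF forest_program_nth(3)]; cases c; cases "odd a"; cases "odd b"; cases "a = 0"; cases "b = 0")
         (use False computesD[OF IHT] computesD[OF IHF] in
           \<open>simp_all add: addc_code_def adder_code_def\<close>)
  qed
qed

lemma comp_ADD0:
  "a < 2 ^ m \<Longrightarrow> b < 2 ^ m \<Longrightarrow> call ADDC [enc_nat a, enc_nat b, Atom] (enc_nat (a + b)) (30 * (m + 1))"
  using comp_ADDC[of a m b False] by simp

text \<open>School multiplication: one addition of numbers with at most \<open>l + m\<close> bits
  for each bit of the first factor.\<close>

lemma comp_MULN:
  "a < 2 ^ l \<Longrightarrow> b < 2 ^ m \<Longrightarrow> call MULN [enc_nat a, enc_nat b] (enc_nat (a * b)) (60 * (l + m + 1) * (l + 1))"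
proof (induction l arbitrary: a)
  case 0
  show ?case
    by (rule comp_code[OF forest_program_nth(4)]) (use 0 in \<open>simp_all add: muln_code_def\<close>)
next
  case (Suc l)
  show ?case
  proof (cases "a = 0")
    case True
    then show ?thesis
      by (intro comp_code[OF forest_program_nth(4)]) (simp_all add: muln_code_def)
  next
    case False
    have IH: "call MULN [enc_nat (a div 2), enc_nat b] (enc_nat (a div 2 * b)) (60 * (l + m + 1) * (l + 1))"
      by (rule Suc.IH) (use Suc.prems in auto)
    have less: "a * b < 2 ^ (Suc l + m)"
      unfolding power_add using Suc.prems by (intro mult_strict_mono) auto
    let ?c = "if odd a then b else 0"
    have sum: "a * b = ?c + 2 * (a div 2 * b)"
      by (cases "even a") (auto elim!: evenE oddE simp: algebra_simps)
    have add: "call ADDC [enc_nat ?c, enc_nat (2 * (a div 2 * b)), Atom] (enc_nat (a * b)) (30 * (Suc l + m + 1))"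
      unfolding sum by (rule comp_ADD0) (use less sum in linarith)+
    have "60 * (l + m + 1) * (l + 1) + 60 * (Suc l + m + 1) \<le> 60 * (Suc l + m + 1) * (Suc l + 1)"
      by (simp add: algebra_simps)
    then show ?thesis
      by (intro comp_code[OF forest_program_nth(4)]; cases "odd a")
         (use False computesD[OF IH] computesD[OF comp_DBL[of "a div 2 * b"]] computesD[OF add] in
           \<open>simp_all add: muln_code_def\<close>)
  qed
qed

text \<open>One column of subtraction with borrow. The assumption rules out truncation and passes on
  to the higher digits.\<close>

lemma subtract_bit:
  fixes p q :: nat
  assumes "2 * q + of_bool y + of_bool c \<le> 2 * p + of_bool x"
  shows "q + of_bool (if x then y \<and> c else y \<or> c) \<le> p"
    and "2 * p + of_bool x - (2 * q + of_bool y) - of_bool c =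
      of_bool (x \<noteq> (y \<noteq> c)) + 2 * (p - q - of_bool (if x then y \<and> c else y \<or> c))"
  using assms by (cases x; cases y; cases c; simp; linarith)+

lemma comp_SUBC:
  "a < 2 ^ m \<Longrightarrow> b + of_bool c \<le> a \<Longrightarrow>
    call SUBC [enc_nat a, enc_nat b, enc_bool c] (enc_nat (a - b - of_bool c)) (40 * (m + 1))"
proof (induction m arbitrary: a b c)
  case 0
  show ?case
    by (rule comp_code[OF forest_program_nth(5)]; cases c)
       (use 0 in \<open>simp_all add: subc_code_def\<close>)
next
  case (Suc m)
  show ?case
  proof (cases "a = 0")
    case True
    then show ?thesis
      by (intro comp_code[OF forest_program_nth(5)]; cases c) (use Suc.prems in \<open>simp_all add: subc_code_def\<close>)
  next
    case False
    define c' where "c' \<longleftrightarrow> (if odd a then odd b \<and> c else odd b \<or> c)"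
    have bits: "2 * (k div 2) + of_bool (odd k) = k" for k :: nat
      by (cases "odd k") auto
    have c': "b div 2 + of_bool c' \<le> a div 2"
      "a - b - of_bool c = of_bool (odd a \<noteq> (odd b \<noteq> c)) + 2 * (a div 2 - b div 2 - of_bool c')"
      using subtract_bit[of "b div 2" "odd b" c "a div 2" "odd a"] Suc.prems(2)
      unfolding bits c'_def by blast+
    let ?r = "a div 2 - b div 2 - of_bool c'"
    have IH: "call SUBC [enc_nat (a div 2), enc_nat (b div 2), enc_bool c'] (enc_nat ?r) (40 * (m + 1))"
      by (rule Suc.IH) (use Suc.prems c' in auto)
    have odd: "enc_nat (Suc (2 * k)) = Node (Node Atom Atom) (enc_nat k)" for k
      by (simp add: enc_nat_Node)
    show ?thesis
      unfolding c'(2)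
      by (rule comp_code[OF forest_program_nth(5)]; cases c; cases "odd a"; cases "odd b")
         (use False computesD[OF IH] computesD[OF comp_DBL[of ?r]] in
           \<open>simp_all add: subc_code_def c'_def odd\<close>)
  qed
qed

fun ssize :: "sexp \<Rightarrow> nat" where
  "ssize Atom = 1"
| "ssize (Node x y) = Suc (ssize x + ssize y)"

text \<open>Comparison stops as soon as either argument is an atom, so the size of the first alone
  bounds the cost.\<close>

lemma comp_EQS: "call EQS [x, y] (enc_bool (x = y)) (20 * ssize x)"
proof (induction x arbitrary: y)
  case Atom
  show ?case
    by (rule comp_code[OF forest_program_nth(6)]; cases y) (simp_all add: eqs_code_def)
next
  case (Node x1 x2)
  show ?case
  proof (cases y)
    case (Node y1 y2)
    show ?thesis
      unfolding Node
      by (rule comp_code[OF forest_program_nth(6)]; cases "x1 = y1")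
         (use computesD[OF Node.IH(1)[of y1]] computesD[OF Node.IH(2)[of y2]] in \<open>simp_all add: eqs_code_def\<close>)
  qed (rule comp_code[OF forest_program_nth(6)]; simp add: eqs_code_def)
qed

lemma ssize_enc_nat: "n < 2 ^ m \<Longrightarrow> ssize (enc_nat n) \<le> 4 * m + 1"
proof (induction m arbitrary: n)
  case (Suc m)
  show ?case
  proof (cases "n = 0")
    case False
    have "ssize (enc_bool (odd n)) \<le> 3" by (cases "odd n") auto
    moreover have "ssize (enc_nat (n div 2)) \<le> 4 * m + 1" by (rule Suc.IH) (use Suc.prems in auto)
    ultimately show ?thesis using False by (simp add: enc_nat_Node)
  qed simp
qed simp

lemma enc_nat_inject [simp]: "enc_nat a = enc_nat b \<longleftrightarrow> a = b"
proof (induction a arbitrary: b rule: less_induct)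
  case (less a)
  have enc_bool_inject: "enc_bool x = enc_bool y \<longleftrightarrow> x = y" for x y by (cases x; cases y) auto
  consider "a = 0" | "b = 0" | "a > 0" "b > 0" by blast
  then show ?case
  proof cases
    case 3
    have "(odd a = odd b \<and> a div 2 = b div 2) = (a = b)" by presburger
    then show ?thesis using 3 less[of "a div 2" "b div 2"]
      by (simp add: enc_nat_Node enc_bool_inject)
  next
    case 2
    then show ?thesis using enc_nat_Atom_iff[of a] by auto
  next
    case 1
    then show ?thesis using enc_nat_Atom_iff[of b] by (metis enc_nat_0)
  qed
qed

section \<open>Elements of the Grassmann algebra as trees\<close>

text \<open>A tree over the list \<open>L\<close> of generators denotes an element of the Grassmann algebra:
  \<open>B x y\<close> is \<open>x + y \<theta>\<close> for the first generator \<open>\<theta>\<close> of \<open>L\<close>, a leaf \<open>C p q\<close> is the integer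
  \<open>p - q\<close>, and \<open>Z\<close> is zero at any depth.\<close>

datatype gp = Z | C nat nat | B gp gp

fun den :: "nat list \<Rightarrow> gp \<Rightarrow> fop" where
  "den L Z = 0"
| "den [] (C p q) = of_int (int p - int q)"
| "den (g # L) (B x y) = den L x + den L y * th g"
| "den L x = 0"

text \<open>Right children vanish at the generators outside \<open>S\<close>, and \<open>b\<close> tells whether the element is
  even.\<close>

fun wf_gp :: "nat set \<Rightarrow> nat list \<Rightarrow> bool \<Rightarrow> gp \<Rightarrow> bool" where
  "wf_gp S L b Z \<longleftrightarrow> True"
| "wf_gp S [] b (C p q) \<longleftrightarrow> b"
| "wf_gp S (g # L) b (B x y) \<longleftrightarrow> wf_gp S L b x \<and> wf_gp S L (\<not> b) y \<and> (g \<in> S \<or> y = Z)"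
| "wf_gp S L b x \<longleftrightarrow> False"

lemma wf_gp_Nil: "wf_gp S [] b x \<longleftrightarrow> x = Z \<or> b \<and> (\<exists>p q. x = C p q)"
  by (cases x) auto

lemma wf_gp_Cons: "wf_gp S (g # L) b x \<longleftrightarrow> x = Z \<or>
    (\<exists>y z. x = B y z \<and> wf_gp S L b y \<and> wf_gp S L (\<not> b) z \<and> (g \<in> S \<or> z = Z))"
  by (cases x) auto

lemma wf_gp_mono: "wf_gp S L b x \<Longrightarrow> S \<inter> set L \<subseteq> S' \<Longrightarrow> wf_gp S' L b x"
  by (induction S L b x rule: wf_gp.induct) auto

fun gsize :: "gp \<Rightarrow> nat" where
  "gsize Z = 1"
| "gsize (C p q) = 1"
| "gsize (B x y) = Suc (gsize x + gsize y)"

lemma gsize_pos [simp]: "0 < gsize x" by (cases x) auto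

text \<open>\<open>p\<close> and \<open>q\<close> are not cancelled against each other, so the
  stored numbers themselves are bounded. The norm is subadditive and submultiplicative, which
  controls bit lengths over the whole run.\<close>

fun norm_gp :: "gp \<Rightarrow> nat" where
  "norm_gp Z = 0"
| "norm_gp (C p q) = p + q"
| "norm_gp (B x y) = norm_gp x + norm_gp y"

abbreviation count_in :: "nat set \<Rightarrow> nat list \<Rightarrow> nat" where
  "count_in S L \<equiv> length (filter (\<lambda>g. g \<in> S) L)"

text \<open>Branching happens only at generators in \<open>S\<close>; at the others the right child
  is \<open>Z\<close>. This leaves \<open>2 ^ count_in S L\<close> long paths of linear
  length.\<close>

lemma gsize_le: "wf_gp S L b x \<Longrightarrow> gsize x \<le> (2 * length L + 1) * 2 ^ count_in S L"
proof (induction L arbitrary: b x)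
  case (Cons g L)
  show ?case
  proof (cases "x = Z")
    case False
    then obtain y z where x: "x = B y z" and yz: "wf_gp S L b y" "wf_gp S L (\<not> b) z" "g \<in> S \<or> z = Z"
      using Cons.prems by (auto simp: wf_gp_Cons)
    show ?thesis
    proof (cases "g \<in> S")
      case True
      have "Suc (gsize y + gsize z) \<le> 1 + 2 * ((2 * length L + 1) * 2 ^ count_in S L)"
        using Cons.IH[OF yz(1)] Cons.IH[OF yz(2)] by simp
      also have "\<dots> \<le> (2 * Suc (length L) + 1) * 2 ^ Suc (count_in S L)"
        using one_le_power[of "2::nat" "count_in S L"] by (simp add: algebra_simps)
      finally show ?thesis using True x by simp
    next
      case False
      then have "Suc (gsize y + gsize z) \<le> 2 + (2 * length L + 1) * 2 ^ count_in S L"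
        using Cons.IH[OF yz(1)] yz(3) by simp
      also have "\<dots> \<le> (2 * Suc (length L) + 1) * 2 ^ count_in S L"
        using one_le_power[of "2::nat" "count_in S L"] by (simp add: algebra_simps)
      finally show ?thesis using False x by simp
    qed
  qed (simp add: Suc_le_eq)
qed (auto simp: wf_gp_Nil)

text \<open>Oddness is expressed by becoming even after multiplication with any generator, so no
  predicate for odd elements is introduced.\<close>

lemma even_op_den: "wf_gp S L b x \<Longrightarrow> if b then even_op (den L x) else \<forall>h. even_op (den L x * th h)"
proof (induction S L b x rule: wf_gp.induct)
  case (3 S g L b x y)
  show ?case
  proof (cases b)
    case True
    then show ?thesis using 3 by (auto intro: even_op_add)
  next
    case False
    have "even_op (den L y * (th g * th h))" for h
      using 3 False by (auto intro!: even_op_mult even_op_th)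
    then show ?thesis using 3 False by (auto simp: distrib_right mult.assoc intro: even_op_add)
  qed
qed (auto intro: even_op_of_int simp del: of_int_diff)

lemma free_den: "wf_gp S L b x \<Longrightarrow> g \<notin> S \<Longrightarrow> free g (den L x)"
proof (induction S L b x rule: wf_gp.induct)
  case (3 S h L b x y)
  then show ?case by (cases "h = g") (auto intro!: free_add free_mult free_th free_0)
qed (auto intro: free_0 free_of_int simp del: of_int_diff)

section \<open>Operations on trees\<close>

fun gadd :: "gp \<Rightarrow> gp \<Rightarrow> gp" where
  "gadd Z y = y"
| "gadd x Z = x"
| "gadd (C p q) (C p' q') = C (p + p') (q + q')"
| "gadd (B x y) (B x' y') = B (gadd x x') (gadd y y')"
| "gadd x y = Z"

lemma gadd_Z [simp]: "gadd x Z = x"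
  by (cases x) auto

fun gneg :: "gp \<Rightarrow> gp" where
  "gneg Z = Z"
| "gneg (C p q) = C q p"
| "gneg (B x y) = B (gneg x) (gneg y)"

text \<open>The grade involution \<open>\<theta> \<mapsto> -\<theta>\<close>, negated if \<open>s\<close> holds.\<close>

fun ginv :: "bool \<Rightarrow> gp \<Rightarrow> gp" where
  "ginv s Z = Z"
| "ginv s (C p q) = (if s then C q p else C p q)"
| "ginv s (B x y) = B (ginv s x) (ginv (\<not> s) y)"

text \<open>In \<open>(x + y \<theta>) (x' + y' \<theta>)\<close> the product of the two
  \<theta>-terms vanishes, and moving \<theta> past \<open>x'\<close> applies the grade involution.
  Three recursive products remain.\<close>

fun gmul :: "gp \<Rightarrow> gp \<Rightarrow> gp" where
  "gmul (C p q) (C p' q') = C (p * p' + q * q') (p * q' + q * p')"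
| "gmul (B x y) (B x' y') = B (gmul x x') (gadd (gmul x y') (gmul y (ginv False x')))"
| "gmul x y = Z"

lemma gmul_Z [simp]: "gmul x Z = Z"
  by (cases x) auto

text \<open>The coefficient of \<open>th g\<close> when \<open>th g\<close> is written at the right
  end; the right child gets a sign because \<open>th g\<close> has to pass
  \<open>th h\<close>.\<close>

fun gder :: "nat list \<Rightarrow> nat \<Rightarrow> gp \<Rightarrow> gp" where
  "gder (h # L) g (B x y) = (if h = g then B y Z else B (gder L g x) (gneg (gder L g y)))"
| "gder L g x = Z"

fun gone :: "nat list \<Rightarrow> gp" where
  "gone [] = C 1 0"
| "gone (g # L) = B (gone L) Z"

fun ggen :: "nat list \<Rightarrow> nat \<Rightarrow> gp" where
  "ggen [] g = Z"
| "ggen (h # L) g = (if h = g then B Z (gone L) else B (ggen L g) Z)"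

lemma wf_gadd: "wf_gp S L b x \<Longrightarrow> wf_gp S L b y \<Longrightarrow> wf_gp S L b (gadd x y)"
  by (induction L arbitrary: b x y) (auto simp: wf_gp_Nil wf_gp_Cons)

lemma gneg_Z_iff [simp]: "gneg x = Z \<longleftrightarrow> x = Z" and ginv_Z_iff [simp]: "ginv s x = Z \<longleftrightarrow> x = Z"
  by (cases x; simp)+

lemma wf_gneg: "wf_gp S L b x \<Longrightarrow> wf_gp S L b (gneg x)"
  by (induction L arbitrary: b x) (auto simp: wf_gp_Nil wf_gp_Cons)

lemma wf_ginv: "wf_gp S L b x \<Longrightarrow> wf_gp S L b (ginv s x)"
  by (induction L arbitrary: b s x) (auto simp: wf_gp_Nil wf_gp_Cons)

lemma wf_gmul: "wf_gp S L b x \<Longrightarrow> wf_gp S L c y \<Longrightarrow> wf_gp S L (b = c) (gmul x y)"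
proof (induction L arbitrary: b c x y)
  case (Cons g L)
  show ?case
  proof (cases "x = Z \<or> y = Z")
    case False
    then obtain x0 x1 y0 y1 where xy: "x = B x0 x1" "y = B y0 y1"
      and wf: "wf_gp S L b x0" "wf_gp S L (\<not> b) x1" "wf_gp S L c y0" "wf_gp S L (\<not> c) y1"
      and g: "g \<in> S \<or> x1 = Z" "g \<in> S \<or> y1 = Z"
      using Cons.prems by (auto simp: wf_gp_Cons)
    have "wf_gp S L (\<not> (b = c)) (gmul x0 y1)" "wf_gp S L (\<not> (b = c)) (gmul x1 (ginv False y0))"
      using Cons.IH[OF wf(1,4)] Cons.IH[OF wf(2) wf_ginv[OF wf(3)]] by (cases b; cases c; simp)+
    then show ?thesis using Cons.IH[OF wf(1,3)] g by (auto simp: xy intro: wf_gadd)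
  qed auto
qed (auto simp: wf_gp_Nil)

text \<open>The derivative clears \<open>g\<close> from the support; this is how a scope loses the
  eliminated vertex.\<close>

lemma wf_gder:
  "wf_gp S L b x \<Longrightarrow> distinct L \<Longrightarrow> wf_gp (S - {g}) L (\<not> b) (gder L g x)"
proof (induction L arbitrary: b x)
  case (Cons h L)
  show ?case
  proof (cases "x = Z")
    case False
    then obtain x0 x1 where x: "x = B x0 x1"
      and wf: "wf_gp S L b x0" "wf_gp S L (\<not> b) x1" "h \<in> S \<or> x1 = Z"
      using Cons.prems by (auto simp: wf_gp_Cons)
    show ?thesis
    proof (cases "h = g")
      case True
      then show ?thesis using x Cons.prems(2) by (auto intro!: wf_gp_mono[OF wf(2)])
    next
      case False
      then show ?thesis using x wf Cons.IH[OF wf(1)] Cons.IH[OF wf(2)] Cons.prems(2)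
        by (auto intro: wf_gneg)
    qed
  qed auto
qed (auto simp: wf_gp_Nil)

lemma wf_gone: "wf_gp S L True (gone L)"
  by (induction L) auto

lemma wf_ggen: "g \<in> S \<Longrightarrow> wf_gp S L False (ggen L g)"
  by (induction L) (auto simp: wf_gone)

lemma den_gadd: "wf_gp S L b x \<Longrightarrow> wf_gp S L b y \<Longrightarrow> den L (gadd x y) = den L x + den L y"
proof (induction L arbitrary: b x y)
  case (Cons g L)
  then show ?case by (auto simp: wf_gp_Cons Cons.IH[of _] algebra_simps)
qed (auto simp: wf_gp_Nil)

lemma den_gneg: "den L (gneg x) = - den L x"
  by (induction L x rule: den.induct) auto

lemma den_ginv_True: "den L (ginv True x) = - den L (ginv False x)"
  by (induction L x rule: den.induct) auto

lemma th_den: "wf_gp S L b x \<Longrightarrow> th g * den L x = den L (ginv False x) * th g"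
proof (induction S L b x rule: wf_gp.induct)
  case (3 S h L b x y)
  have "th g * (den L y * th h) = den L (ginv False y) * (th g * th h)"
    using 3 by (simp flip: mult.assoc)
  also have "\<dots> = - (den L (ginv False y) * th h * th g)"
    by (subst th_anticomm) (simp add: mult.assoc)
  finally show ?case using 3 by (simp add: algebra_simps den_ginv_True)
qed (auto simp: mult_of_int_commute simp del: of_int_diff)

lemma den_gmul: "wf_gp S L b x \<Longrightarrow> wf_gp S L c y \<Longrightarrow> den L (gmul x y) = den L x * den L y"
proof (induction L arbitrary: b c x y)
  case (Cons g L)
  show ?case
  proof (cases "x = Z \<or> y = Z")
    case False
    then obtain x0 x1 y0 y1 where xy: "x = B x0 x1" "y = B y0 y1"
      and wf: "wf_gp S L b x0" "wf_gp S L (\<not> b) x1" "wf_gp S L c y0" "wf_gp S L (\<not> c) y1"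
      using Cons.prems by (auto simp: wf_gp_Cons)
    have mul: "den L (gmul x0 y0) = den L x0 * den L y0" "den L (gmul x0 y1) = den L x0 * den L y1"
      "den L (gmul x1 (ginv False y0)) = den L x1 * den L (ginv False y0)"
      using Cons.IH wf wf_ginv by blast+
    have wf': "wf_gp S L (\<not> (b = c)) (gmul x0 y1)" "wf_gp S L (\<not> (b = c)) (gmul x1 (ginv False y0))"
      using wf_gmul[OF wf(1,4)] wf_gmul[OF wf(2) wf_ginv[OF wf(3)]] by (cases b; cases c; simp)+
    \<comment> \<open>Moving the left \<open>th g\<close> past \<open>den L y1\<close> makes the
      square of \<open>th g\<close> appear.\<close>
    have "den L x1 * th g * (den L y1 * th g) = den L x1 * den L (ginv False y1) * (th g * th g)"
      using th_den[OF wf(4), of g] by (metis mult.assoc)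
    then have "den L x1 * th g * (den L y1 * th g) = 0" by simp
    moreover have "den L x1 * th g * den L y0 = den L x1 * den L (ginv False y0) * th g"
      using th_den[OF wf(3), of g] by (simp add: mult.assoc)
    ultimately show ?thesis
      by (simp add: xy mul den_gadd[OF wf'] distrib_left distrib_right mult.assoc)
  qed auto
qed (auto simp: wf_gp_Nil algebra_simps)

text \<open>The part \<open>a\<close> misses \<open>g\<close> and will drop out of the top
  coefficient.\<close>

lemma den_gder:
  assumes "wf_gp S L b x" "distinct L" "g \<in> set L"
  shows "\<exists>a. free g a \<and> den L x = a + den L (gder L g x) * th g"
  using assms
proof (induction L arbitrary: b x)
  case (Cons h L)
  show ?case
  proof (cases "x = Z")
    case False
    then obtain x0 x1 where x: "x = B x0 x1" and wf: "wf_gp S L b x0" "wf_gp S L (\<not> b) x1"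
      using Cons.prems by (auto simp: wf_gp_Cons)
    show ?thesis
    proof (cases "h = g")
      case True
      then have "free g (den L x0)"
        using Cons.prems(2) by (intro free_den[OF wf_gp_mono[OF wf(1), of "set L"]]) auto
      then show ?thesis using True by (auto simp: x)
    next
      case False
      then have L: "distinct L" "g \<in> set L" using Cons.prems by auto
      obtain a0 where a0: "free g a0" "den L x0 = a0 + den L (gder L g x0) * th g"
        using Cons.IH[OF wf(1) L] by blast
      obtain a1 where a1: "free g a1" "den L x1 = a1 + den L (gder L g x1) * th g"
        using Cons.IH[OF wf(2) L] by blast
      have "den L (gder L g x1) * th g * th h = - (den L (gder L g x1) * th h * th g)"
        unfolding mult.assoc by (subst th_anticomm) (simp add: mult.assoc)
      then have "den (h # L) x = (a0 + a1 * th h) + den (h # L) (gder (h # L) g x) * th g"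
        using False by (simp add: x a0(2) a1(2) den_gneg distrib_right) (simp add: algebra_simps)
      moreover have "free g (a0 + a1 * th h)"
        using a0(1) a1(1) False by (intro free_add free_mult free_th) auto
      ultimately show ?thesis by blast
    qed
  qed (auto intro: free_0)
qed simp

lemma den_gone: "den L (gone L) = 1"
  by (induction L) auto

lemma den_ggen: "g \<in> set L \<Longrightarrow> den L (ggen L g) = th g"
  by (induction L) (auto simp: den_gone)

lemma norm_gadd: "norm_gp (gadd x y) \<le> norm_gp x + norm_gp y"
  by (induction x y rule: gadd.induct) auto

lemma norm_gneg [simp]: "norm_gp (gneg x) = norm_gp x"
  by (induction x) auto

lemma norm_ginv [simp]: "norm_gp (ginv s x) = norm_gp x"
  by (induction x arbitrary: s) auto

lemma norm_gmul: "norm_gp (gmul x y) \<le> norm_gp x * norm_gp y"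
proof (induction x y rule: gmul.induct)
  case (2 x y x' y')
  then show ?case
    using norm_gadd[of "gmul x y'" "gmul y (ginv False x')"] by (simp add: algebra_simps)
qed (auto simp: algebra_simps)

lemma norm_gder: "norm_gp (gder L g x) \<le> norm_gp x"
  by (induction L g x rule: gder.induct) auto

lemma gsize_gneg [simp]: "gsize (gneg x) = gsize x"
  by (induction x) auto

lemma gsize_gder: "gsize (gder L g x) \<le> gsize x"
proof (induction L g x rule: gder.induct)
  case (1 h L g x y)
  then show ?case by (cases "h = g") (auto simp: Suc_le_eq)
qed (auto simp: Suc_le_eq)

lemma norm_gone [simp]: "norm_gp (gone L) = 1"
  by (induction L) auto

lemma norm_ggen: "norm_gp (ggen L g) \<le> 1"
  by (induction L) auto

section \<open>Vertex and edge factors as trees\<close>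

definition gdiff :: "nat list \<Rightarrow> nat \<Rightarrow> nat \<Rightarrow> gp" where
  "gdiff L g h = gadd (ggen L g) (gneg (ggen L h))"

definition gvert :: "nat list \<Rightarrow> nat \<Rightarrow> gp" where
  "gvert L v = gadd (gone L) (gmul (ggen L (2*v)) (ggen L (2*v+1)))"

definition gedge :: "nat list \<Rightarrow> nat \<Rightarrow> nat \<Rightarrow> gp" where
  "gedge L u v = gadd (gone L) (gmul
     (gmul (gdiff L (2*u) (2*v)) (gdiff L (2*u+1) (2*v+1)))
     (gadd (gone L) (gneg (gmul (ggen L (2*v)) (ggen L (2*v+1))))))"

lemma wf_gdiff: "g \<in> S \<Longrightarrow> h \<in> S \<Longrightarrow> wf_gp S L False (gdiff L g h)"
  unfolding gdiff_def by (intro wf_gadd wf_gneg wf_ggen)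

lemma wf_gen_pair: "g \<in> S \<Longrightarrow> h \<in> S \<Longrightarrow> wf_gp S L True (gmul (ggen L g) (ggen L h))"
  using wf_gmul[OF wf_ggen wf_ggen, of g S h L] by simp

lemma wf_gvert: "2*v \<in> S \<Longrightarrow> 2*v+1 \<in> S \<Longrightarrow> wf_gp S L True (gvert L v)"
  unfolding gvert_def by (intro wf_gadd wf_gone wf_gen_pair)

lemma den_gvert: "2*v \<in> set L \<Longrightarrow> 2*v+1 \<in> set L \<Longrightarrow> den L (gvert L v) = 1 + tau v"
  unfolding gvert_def tau_def
  by (subst den_gadd[OF wf_gone wf_gen_pair], auto simp: den_gone)
     (subst den_gmul[OF wf_ggen wf_ggen], auto simp: den_ggen)

lemma norm_gvert: "norm_gp (gvert L v) \<le> 2"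
proof -
  have "norm_gp (gmul (ggen L (2*v)) (ggen L (2*v+1))) \<le> 1 * 1"
    by (rule order_trans[OF norm_gmul]) (intro mult_le_mono norm_ggen)
  then show ?thesis unfolding gvert_def by (intro order_trans[OF norm_gadd]) simp
qed

lemma norm_gdiff: "norm_gp (gdiff L g h) \<le> 2"
  unfolding gdiff_def using norm_ggen[of L g] norm_ggen[of L h]
  by (intro order_trans[OF norm_gadd]) simp

context
  fixes S :: "nat set" and u v :: nat and L :: "nat list"
  assumes S: "2*u \<in> S" "2*u+1 \<in> S" "2*v \<in> S" "2*v+1 \<in> S"
begin

lemma wf_gedge_parts:
  "wf_gp S L True (gmul (gdiff L (2*u) (2*v)) (gdiff L (2*u+1) (2*v+1)))"
  "wf_gp S L True (gadd (gone L) (gneg (gmul (ggen L (2*v)) (ggen L (2*v+1)))))"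
  using wf_gmul[OF wf_gdiff wf_gdiff, of "2*u" S "2*v" "2*u+1" "2*v+1" L] S
  by (auto intro!: wf_gadd wf_gone wf_gneg wf_gen_pair)

lemma wf_gedge: "wf_gp S L True (gedge L u v)"
  unfolding gedge_def using wf_gmul[OF wf_gedge_parts] by (intro wf_gadd wf_gone) simp

end

lemma norm_gedge_parts:
  "norm_gp (gmul (gdiff L (2*u) (2*v)) (gdiff L (2*u+1) (2*v+1))) \<le> 4"
  "norm_gp (gadd (gone L) (gneg (gmul (ggen L (2*v)) (ggen L (2*v+1))))) \<le> 2"
proof -
  have "norm_gp (gmul (gdiff L (2*u) (2*v)) (gdiff L (2*u+1) (2*v+1))) \<le> 2 * 2"
    by (rule order_trans[OF norm_gmul]) (intro mult_le_mono norm_gdiff)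
  then show "norm_gp (gmul (gdiff L (2*u) (2*v)) (gdiff L (2*u+1) (2*v+1))) \<le> 4" by simp
  have "norm_gp (gmul (ggen L (2*v)) (ggen L (2*v+1))) \<le> 1 * 1"
    by (rule order_trans[OF norm_gmul]) (intro mult_le_mono norm_ggen)
  then show "norm_gp (gadd (gone L) (gneg (gmul (ggen L (2*v)) (ggen L (2*v+1))))) \<le> 2"
    by (intro order_trans[OF norm_gadd]) simp
qed

text \<open>9 = 1 + 4 * 2: each of the two differences has norm at most 2, and so has
  \<open>1 - tau v\<close>.\<close>

lemma norm_gedge: "norm_gp (gedge L u v) \<le> 9"
proof -
  have "norm_gp (gmul (gmul (gdiff L (2*u) (2*v)) (gdiff L (2*u+1) (2*v+1)))
     (gadd (gone L) (gneg (gmul (ggen L (2*v)) (ggen L (2*v+1)))))) \<le> 4 * 2"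
    by (rule order_trans[OF norm_gmul]) (intro mult_le_mono norm_gedge_parts)
  then show ?thesis unfolding gedge_def by (intro order_trans[OF norm_gadd]) simp
qed

lemma den_gedge:
  assumes L: "2*u \<in> set L" "2*u+1 \<in> set L" "2*v \<in> set L" "2*v+1 \<in> set L"
  shows "den L (gedge L u v) = 1 + ff u v"
proof -
  note wf = wf_gedge_parts[OF L, of L] wf_gen_pair[OF L(3,4), of L]
  have prod: "wf_gp (set L) L True (gmul (gmul (gdiff L (2*u) (2*v)) (gdiff L (2*u+1) (2*v+1)))
      (gadd (gone L) (gneg (gmul (ggen L (2*v)) (ggen L (2*v+1))))))"
    using wf_gmul[OF wf(1,2)] by simp
  have diff: "den L (gdiff L g h) = th g - th h" if "g \<in> set L" "h \<in> set L" for g h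
    unfolding gdiff_def
    by (subst den_gadd[OF wf_ggen wf_gneg[OF wf_ggen]]) (use that in \<open>auto simp: den_gneg den_ggen\<close>)
  have "den L (gmul (gdiff L (2*u) (2*v)) (gdiff L (2*u+1) (2*v+1))) =
      (th (2*u) - th (2*v)) * (th (2*u+1) - th (2*v+1))"
    by (subst den_gmul[OF wf_gdiff wf_gdiff]) (use L diff in auto)
  moreover have "den L (gmul (ggen L (2*v)) (ggen L (2*v+1))) = tau v"
    by (subst den_gmul[OF wf_ggen wf_ggen]) (use L in \<open>auto simp: den_ggen tau_def\<close>)
  ultimately show ?thesis
    unfolding gedge_def ff_def den_gadd[OF wf_gone prod]
      den_gmul[OF wf(1,2)] den_gadd[OF wf_gone wf_gneg[OF wf(3)]]
    by (simp add: den_gone den_gneg)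
qed

section \<open>Encoding of elements and cost of the algebra operations\<close>

fun enc_gp :: "gp \<Rightarrow> sexp" where
  "enc_gp Z = Atom"
| "enc_gp (C p q) = Node Atom (Node (enc_nat p) (enc_nat q))"
| "enc_gp (B x y) = Node (Node (enc_gp x) (enc_gp y)) Atom"

text \<open>Parity and vertex are stored separately, so both labels of a vertex are built without
  arithmetic.\<close>

definition lab :: "nat \<Rightarrow> sexp" where
  "lab g = Node (enc_bool (odd g)) (enc_nat (g div 2))"

lemma lab_simps [simp]:
  "lab (2 * v) = Node Atom (enc_nat v)" "lab (Suc (2 * v)) = Node (Node Atom Atom) (enc_nat v)"
  by (simp_all add: lab_def)

lemma lab_eq_iff [simp]: "lab g = lab h \<longleftrightarrow> g = h"
proof -
  have "enc_bool x = enc_bool y \<longleftrightarrow> x = y" for x y by (cases x; cases y) auto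
  moreover have "odd g = odd h \<and> g div 2 = h div 2 \<longleftrightarrow> g = h" by presburger
  ultimately show ?thesis by (simp add: lab_def)
qed

lemma ssize_lab: "g div 2 < 2 ^ m \<Longrightarrow> ssize (lab g) \<le> 4 * m + 5"
  using ssize_enc_nat[of "g div 2" m] by (cases "odd g") (simp_all add: lab_def)

text \<open>If one tree is \<open>Z\<close>, the other is returned as it is, so the first argument
  alone bounds the recursion. The norm bounds limit the leaves to \<open>m\<close> bits.\<close>

lemma comp_ADD:
  "wf_gp S L b x \<Longrightarrow> wf_gp S L b y \<Longrightarrow> norm_gp x < 2 ^ m \<Longrightarrow> norm_gp y < 2 ^ m \<Longrightarrow>
    call ADD [enc_gp x, enc_gp y] (enc_gp (gadd x y)) (100 * (m + 1) * gsize x)"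
proof (induction x arbitrary: y L b)
  case Z
  show ?case by (rule comp_code[OF forest_program_nth(9)]) (simp_all add: add_code_def)
next
  case (C p q)
  show ?case
  proof (cases "y = Z")
    case True
    show ?thesis
      by (rule comp_code[OF forest_program_nth(9)]) (simp_all add: add_code_def True)
  next
    case False
    then obtain p' q' where y: "y = C p' q'"
      using C.prems by (cases L; cases y) auto
    have add: "call ADDC [enc_nat p, enc_nat p', Atom] (enc_nat (p + p')) (30 * (m + 1))"
      "call ADDC [enc_nat q, enc_nat q', Atom] (enc_nat (q + q')) (30 * (m + 1))"
      by (rule comp_ADD0; use C.prems y in simp)+
    show ?thesis
      by (rule comp_code[OF forest_program_nth(9)])
         (use computesD[OF add(1)] computesD[OF add(2)] in \<open>simp_all add: add_code_def y\<close>)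
  qed
next
  case (B x0 x1)
  show ?case
  proof (cases "y = Z")
    case True
    show ?thesis
      by (rule comp_code[OF forest_program_nth(9)]) (simp_all add: add_code_def True)
  next
    case False
    then obtain g L' y0 y1 where L: "L = g # L'" and y: "y = B y0 y1"
      using B.prems by (cases L; cases y) auto
    have add: "call ADD [enc_gp x0, enc_gp y0] (enc_gp (gadd x0 y0)) (100 * (m + 1) * gsize x0)"
      "call ADD [enc_gp x1, enc_gp y1] (enc_gp (gadd x1 y1)) (100 * (m + 1) * gsize x1)"
    proof -
      have w: "wf_gp S L' b x0" "wf_gp S L' b y0" "wf_gp S L' (\<not> b) x1" "wf_gp S L' (\<not> b) y1"
        using B.prems(1,2) by (auto simp: L y)
      have n: "norm_gp x0 < 2 ^ m" "norm_gp x1 < 2 ^ m" "norm_gp y0 < 2 ^ m" "norm_gp y1 < 2 ^ m"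
        using B.prems(3,4) by (auto simp: y)
      show "call ADD [enc_gp x0, enc_gp y0] (enc_gp (gadd x0 y0)) (100 * (m + 1) * gsize x0)"
        by (rule B.IH(1)[OF w(1,2) n(1,3)])
      show "call ADD [enc_gp x1, enc_gp y1] (enc_gp (gadd x1 y1)) (100 * (m + 1) * gsize x1)"
        by (rule B.IH(2)[OF w(3,4) n(2,4)])
    qed
    have "100 * (m + 1) * gsize (B x0 x1) =
        100 * (m + 1) + 100 * (m + 1) * gsize x0 + 100 * (m + 1) * gsize x1"
      by (simp add: algebra_simps)
    then show ?thesis
      by (intro comp_code[OF forest_program_nth(9)])
         (use computesD[OF add(1)] computesD[OF add(2)] in \<open>simp_all add: add_code_def y\<close>)
  qed
qed

lemma comp_NEG: "call NEG [enc_gp x] (enc_gp (gneg x)) (40 * gsize x)"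
proof (induction x)
  case (B x y)
  show ?case
    by (rule comp_code[OF forest_program_nth(10)])
       (use computesD[OF B.IH(1)] computesD[OF B.IH(2)] in \<open>simp_all add: neg_code_def\<close>)
qed (rule comp_code[OF forest_program_nth(10)]; simp add: neg_code_def)+

lemma comp_INV: "call INV [enc_bool s, enc_gp x] (enc_gp (ginv s x)) (40 * gsize x)"
proof (induction x arbitrary: s)
  case (B x y)
  show ?case
    by (rule comp_code[OF forest_program_nth(11)]; cases s)
       (use computesD[OF B.IH(1)[of s]] computesD[OF B.IH(2)[of "\<not> s"]] in \<open>simp_all add: inv_code_def\<close>)
qed (rule comp_code[OF forest_program_nth(11)]; simp add: inv_code_def)+

lemma comp_MUL_Z: "call MUL [Atom, y] Atom 5" "call MUL [x, Atom] Atom 5"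
  by (rule comp_code[OF forest_program_nth(12)]; simp add: mul_code_def)+

text \<open>\<open>G\<close> bounds the size of an element with support \<open>S\<close>;
  \<open>K\<close> pays for the arithmetic at a leaf, or for one involution and one addition. A
  generator in \<open>S\<close> causes three recursive products and this overhead, which fits the
  factor 4. A generator outside causes one nontrivial product, and the factor
  \<open>length L + 1\<close> absorbs its overhead.\<close>

lemma comp_MUL:
  assumes "wf_gp S L b x" "wf_gp S L c y"
    and "norm_gp x < 2 ^ m" "norm_gp y < 2 ^ m" "norm_gp x * norm_gp y < 2 ^ m"
    and "(2 * length L + 1) * 2 ^ count_in S L \<le> G"
    and "1000 * (m + 1)\<^sup>2 + 200 * (m + 1) * G \<le> K"
  shows "call MUL [enc_gp x, enc_gp y] (enc_gp (gmul x y)) ((length L + 1) * 4 ^ count_in S L * K)"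
  using assms(1-6)
proof (induction L arbitrary: b c x y)
  case Nil
  have K: "1000 * (m + 1)\<^sup>2 \<le> K" using assms(7) by simp
  have sq: "1 \<le> (m + 1)\<^sup>2" "m + 1 \<le> (m + 1)\<^sup>2" by (simp_all add: power2_eq_square)
  show ?case
  proof (cases "x = Z \<or> y = Z")
    case True
    then show ?thesis
      using K sq by (elim disjE) (auto intro: computes_mono[OF comp_MUL_Z(1)] computes_mono[OF comp_MUL_Z(2)])
  next
    case False
    then obtain p q p' q' where xy: "x = C p q" "y = C p' q'"
      using Nil.prems(1,2) by (auto simp: wf_gp_Nil)
    have lt: "p < 2^m" "q < 2^m" "p' < 2^m" "q' < 2^m" using Nil.prems(3,4) by (auto simp: xy)
    have prods: "p*p' + q*q' + p*q' + q*p' < 2^m" using Nil.prems(5) by (simp add: xy algebra_simps)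
    have "60 * (m + m + 1) * (m + 1) \<le> 120 * (m + 1)\<^sup>2"
      by (simp add: power2_eq_square algebra_simps)
    then have muln: "call MULN [enc_nat i, enc_nat j] (enc_nat (i * j)) (120 * (m + 1)\<^sup>2)"
      if "i < 2^m" "j < 2^m" for i j
      using computes_mono[OF comp_MULN[OF that]] by blast
    have add: "call ADDC [enc_nat (p*p'), enc_nat (q*q'), Atom] (enc_nat (p*p' + q*q')) (30 * (m + 1))"
      "call ADDC [enc_nat (p*q'), enc_nat (q*p'), Atom] (enc_nat (p*q' + q*p')) (30 * (m + 1))"
      by (rule comp_ADD0; use prods in linarith)+
    show ?thesis
      by (rule comp_code[OF forest_program_nth(12)])
         (use K sq computesD[OF muln[OF lt(1,3)]] computesD[OF muln[OF lt(2,4)]]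
              computesD[OF muln[OF lt(1,4)]] computesD[OF muln[OF lt(2,3)]]
              computesD[OF add(1)] computesD[OF add(2)] in \<open>simp_all add: mul_code_def xy\<close>)
  qed
next
  case (Cons g L)
  let ?Y = "4 ^ count_in S L * K"
  let ?X = "(length L + 1) * ?Y"
  have K: "200 * (m + 1) * G + 1000 \<le> K"
  proof -
    have "1 \<le> (m + 1)\<^sup>2" by simp
    then show ?thesis using assms(7) by linarith
  qed
  have KY: "K \<le> ?Y" using mult_le_mono1[of 1 "4 ^ count_in S L" K] by simp
  show ?case
  proof (cases "x = Z \<or> y = Z")
    case True
    have "1 \<le> (length (g # L) + 1) * 4 ^ count_in S (g # L)" by (simp add: Suc_le_eq)
    from mult_le_mono1[OF this, of K]
    have "5 \<le> (length (g # L) + 1) * 4 ^ count_in S (g # L) * K" using K by linarith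
    then show ?thesis
      using True by (elim disjE) (auto intro: computes_mono[OF comp_MUL_Z(1)] computes_mono[OF comp_MUL_Z(2)])
  next
    case False
    then obtain x0 x1 y0 y1 where xy: "x = B x0 x1" "y = B y0 y1"
      and wf: "wf_gp S L b x0" "wf_gp S L (\<not> b) x1" "wf_gp S L c y0" "wf_gp S L (\<not> c) y1"
      and g: "g \<in> S \<or> x1 = Z \<and> y1 = Z"
      using Cons.prems(1,2) by (auto simp: wf_gp_Cons)
    have G: "(2 * length L + 1) * 2 ^ count_in S L \<le> G"
      using Cons.prems(6) by (rule order_trans[rotated]) (intro mult_le_mono power_increasing; simp)
    have norms: "norm_gp x0 < 2^m" "norm_gp x1 < 2^m" "norm_gp y0 < 2^m" "norm_gp y1 < 2^m"
      using Cons.prems(3,4) by (auto simp: xy)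
    have norm_prods: "norm_gp x0 * norm_gp y0 < 2^m" "norm_gp x0 * norm_gp y1 < 2^m" "norm_gp x1 * norm_gp y0 < 2^m"
      using Cons.prems(5) by (simp_all add: xy algebra_simps)
    have m00: "call MUL [enc_gp x0, enc_gp y0] (enc_gp (gmul x0 y0)) ?X"
      using Cons.IH[OF wf(1,3) norms(1,3) norm_prods(1) G] by (simp only: mult.assoc)
    have inv: "call INV [Atom, enc_gp y0] (enc_gp (ginv False y0)) (40 * G)"
      using computes_mono[OF comp_INV[of False y0], of "40 * G"] gsize_le[OF wf(3)] G by simp
    \<comment> \<open>If \<open>g\<close> is outside \<open>S\<close>, both \<open>x1\<close> and
      \<open>y1\<close> are \<open>Z\<close>, and products with them end within 5 steps.\<close>
    define X1 where "X1 = (if g \<in> S then ?X else 5)"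
    have m01: "call MUL [enc_gp x0, enc_gp y1] (enc_gp (gmul x0 y1)) X1"
      using Cons.IH[OF wf(1,4) norms(1,4) norm_prods(2) G] comp_MUL_Z g
      unfolding X1_def by (auto simp only: mult.assoc gmul_Z enc_gp.simps split: if_splits)
    have m10: "call MUL [enc_gp x1, enc_gp (ginv False y0)] (enc_gp (gmul x1 (ginv False y0))) X1"
      using Cons.IH[OF wf(2) wf_ginv[OF wf(3), of False], unfolded norm_ginv, OF norms(2,3) norm_prods(3) G] comp_MUL_Z g
      unfolding X1_def by (auto simp only: mult.assoc gmul.simps enc_gp.simps split: if_splits)
    have wf': "wf_gp S L (\<not> (b = c)) (gmul x0 y1)" "wf_gp S L (\<not> (b = c)) (gmul x1 (ginv False y0))"
      using wf_gmul[OF wf(1,4)] wf_gmul[OF wf(2) wf_ginv[OF wf(3)]] by (cases b; cases c; simp)+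
    have "gsize (gmul x0 y1) \<le> G" using gsize_le[OF wf'(1)] G by simp
    then have bd: "100 * (m + 1) * gsize (gmul x0 y1) \<le> 100 * (m + 1) * G" by simp
    have add: "call ADD [enc_gp (gmul x0 y1), enc_gp (gmul x1 (ginv False y0))]
        (enc_gp (gadd (gmul x0 y1) (gmul x1 (ginv False y0)))) (100 * (m + 1) * G)"
    proof (rule computes_mono[OF comp_ADD[OF wf'] bd])
      show "norm_gp (gmul x0 y1) < 2 ^ m"
        using norm_gmul[of x0 y1] norm_prods(2) by linarith
      show "norm_gp (gmul x1 (ginv False y0)) < 2 ^ m"
        using norm_gmul[of x1 "ginv False y0"] norm_prods(3) by simp
    qed
    have "G \<le> (m + 1) * G" by simp
    then have "100 * (m + 1) * G + 40 * G + 100 \<le> K"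
      using K unfolding mult.assoc by linarith
    then have ov: "100 * (m + 1) * G + 40 * G + 100 \<le> ?Y"
      using KY by linarith
    have bound: "?X + X1 + X1 + (100 * (m + 1) * G + 40 * G + 90)
        \<le> (length (g # L) + 1) * 4 ^ count_in S (g # L) * K"
    proof (cases "g \<in> S")
      case True
      have "?X + X1 + X1 + (100 * (m + 1) * G + 40 * G + 90) \<le> 3 * ?X + ?Y"
        using ov unfolding X1_def if_P[OF True] by linarith
      also have "\<dots> \<le> (length (g # L) + 1) * 4 ^ count_in S (g # L) * K"
        using True by (simp add: algebra_simps)
      finally show ?thesis .
    next
      case False
      have "?X + X1 + X1 + (100 * (m + 1) * G + 40 * G + 90) \<le> ?X + ?Y"
        using ov unfolding X1_def if_not_P[OF False] by linarith
      also have "\<dots> \<le> (length (g # L) + 1) * 4 ^ count_in S (g # L) * K"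
        using False by (simp add: algebra_simps)
      finally show ?thesis .
    qed
    show ?thesis
      by (rule comp_code[OF forest_program_nth(12)], simp_all only: xy)
         (use bound computesD[OF m00] computesD[OF m01] computesD[OF m10] computesD[OF inv] computesD[OF add]
           in \<open>simp_all add: mul_code_def del: mult_Suc_right\<close>)
  qed
qed

lemma comp_ONE: "call ONE [enc_list lab L] (enc_gp (gone L)) (20 * (length L + 1))"
proof (induction L)
  case (Cons g L)
  show ?case
    by (rule comp_code[OF forest_program_nth(7)]) (use computesD[OF Cons.IH] in \<open>simp_all add: one_code_def\<close>)
qed (rule comp_code[OF forest_program_nth(7)]; simp add: one_code_def enc_nat_1)

lemma comp_GEN:
  "(\<And>h. h \<in> set L \<Longrightarrow> ssize (lab h) \<le> M) \<Longrightarrow>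
    call GEN [enc_list lab L, lab g] (enc_gp (ggen L g)) ((60 + 20 * M) * (length L + 1))"
proof (induction L)
  case (Cons h L)
  have eq: "call EQS [lab h, lab g] (enc_bool (h = g)) (20 * M)"
    using computes_mono[OF comp_EQS[of "lab h" "lab g"]] Cons.prems[of h] by simp
  show ?case
    by (rule comp_code[OF forest_program_nth(8)]; cases "h = g")
       (use computesD[OF eq] computesD[OF Cons.IH] computesD[OF comp_ONE[of L]] Cons.prems in
         \<open>simp_all add: gen_code_def algebra_simps\<close>)
qed (rule comp_code[OF forest_program_nth(8)]; simp add: gen_code_def)

text \<open>At every node a negation may traverse the derivative of the right child, hence the
  summand \<open>40 * G\<close>.\<close>

lemma comp_DER:
  "(\<And>h. h \<in> set L \<Longrightarrow> ssize (lab h) \<le> M) \<Longrightarrow> wf_gp S L b x \<Longrightarrow> gsize x \<le> G \<Longrightarrow>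
    call DER [enc_list lab L, enc_gp x, lab g] (enc_gp (gder L g x)) (gsize x * (60 + 20 * M + 40 * G))"
proof (induction x arbitrary: L b)
  case Z
  show ?case by (rule comp_code[OF forest_program_nth(13)]) (simp_all add: der_code_def)
next
  case (C p q)
  then have "L = []" by (cases L) auto
  then show ?case by (intro comp_code[OF forest_program_nth(13)]) (simp_all add: der_code_def)
next
  case (B x y)
  then obtain h L' where L: "L = h # L'" by (cases L) auto
  let ?K = "60 + 20 * M + 40 * G"
  have eq: "call EQS [lab h, lab g] (enc_bool (h = g)) (20 * M)"
    using computes_mono[OF comp_EQS[of "lab h" "lab g"]] B.prems(1)[of h] L by simp
  have IH: "call DER [enc_list lab L', enc_gp x, lab g] (enc_gp (gder L' g x)) (gsize x * ?K)"
    "call DER [enc_list lab L', enc_gp y, lab g] (enc_gp (gder L' g y)) (gsize y * ?K)"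
  proof -
    have w: "wf_gp S L' b x" "wf_gp S L' (\<not> b) y" and M: "\<And>h. h \<in> set L' \<Longrightarrow> ssize (lab h) \<le> M"
      using B.prems(1,2) by (auto simp: L)
    have n: "gsize x \<le> G" "gsize y \<le> G" using B.prems(3) by auto
    show "call DER [enc_list lab L', enc_gp x, lab g] (enc_gp (gder L' g x)) (gsize x * ?K)"
      by (rule B.IH(1)[OF M w(1) n(1)])
    show "call DER [enc_list lab L', enc_gp y, lab g] (enc_gp (gder L' g y)) (gsize y * ?K)"
      by (rule B.IH(2)[OF M w(2) n(2)])
  qed
  have neg: "call NEG [enc_gp (gder L' g y)] (enc_gp (gneg (gder L' g y))) (40 * G)"
    using computes_mono[OF comp_NEG[of "gder L' g y"]] gsize_gder[of L' g y] B.prems(3) by simp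
  have "gsize (B x y) * ?K = ?K + gsize x * ?K + gsize y * ?K"
    by (simp add: algebra_simps)
  then show ?case
    by (intro comp_code[OF forest_program_nth(13)]; cases "h = g")
       (use computesD[OF eq] computesD[OF IH(1)] computesD[OF IH(2)] computesD[OF neg] in
         \<open>simp_all add: der_code_def L\<close>)
qed

section \<open>Vertex elimination\<close>

type_synonym factor = "nat list \<times> gp"

definition gens :: "nat set \<Rightarrow> nat set" where
  "gens X = {g. g div 2 \<in> X}"

text \<open>\<open>v\<close> is simplicial with respect to the present scopes, witnessed by
  \<open>b\<close>: multiplying all factors at \<open>v\<close> needs no generator beyond those of
  \<open>b\<close>.\<close>

definition good :: "nat \<Rightarrow> nat list \<Rightarrow> factor list \<Rightarrow> bool" where
  "good v b fs \<longleftrightarrow> (\<forall>(c, p)\<in>set fs. v \<in> set c \<longrightarrow> set c \<subseteq> set b)"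

fun findv :: "nat list \<Rightarrow> nat list \<Rightarrow> factor list \<Rightarrow> (nat \<times> nat list) option" where
  "findv [] b fs = None"
| "findv (v # s) b fs = (if good v b fs then Some (v, b) else findv s b fs)"

fun findb :: "factor list \<Rightarrow> factor list \<Rightarrow> (nat \<times> nat list) option" where
  "findb [] fs = None"
| "findb ((b, p) # r) fs = (case findv b b fs of None \<Rightarrow> findb r fs | Some x \<Rightarrow> Some x)"

fun gprod :: "nat \<Rightarrow> factor list \<Rightarrow> gp \<Rightarrow> gp" where
  "gprod v [] a = a"
| "gprod v ((c, p) # r) a = (if v \<in> set c then gprod v r (gmul a p) else gprod v r a)"

fun gprod_all :: "factor list \<Rightarrow> gp \<Rightarrow> gp" where
  "gprod_all [] a = a"
| "gprod_all ((c, p) # r) a = gprod_all r (gmul a p)"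

abbreviation avoiding :: "nat \<Rightarrow> factor list \<Rightarrow> factor list" where
  "avoiding v fs \<equiv> filter (\<lambda>(c, p). v \<notin> set c) fs"

abbreviation containing :: "nat \<Rightarrow> factor list \<Rightarrow> factor list" where
  "containing v fs \<equiv> filter (\<lambda>(c, p). v \<in> set c) fs"

text \<open>The weight \<open>1 + tau v\<close> is not among the factors; it enters here, as the
  start of the product.\<close>

definition eliminate :: "nat list \<Rightarrow> nat \<Rightarrow> nat list \<Rightarrow> factor list \<Rightarrow> factor list" where
  "eliminate L v b fs = (removeAll v b, gder L (2*v) (gder L (2*v+1) (gprod v fs (gvert L v)))) # avoiding v fs"

abbreviation den_prod :: "nat list \<Rightarrow> factor list \<Rightarrow> fop" where
  "den_prod L fs \<equiv> prod_list (map (\<lambda>(c, p). den L p) fs)"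

text \<open>\<open>max 1\<close> keeps a vanishing factor from making the product 0, so that it also
  bounds the product over any sublist.\<close>

abbreviation norm_prod :: "factor list \<Rightarrow> nat" where
  "norm_prod fs \<equiv> prod_list (map (\<lambda>(c, p). max 1 (norm_gp p)) fs)"

lemma norm_prod_pos: "0 < norm_prod fs"
  by (induction fs) auto

lemma findv_Some: "findv s b fs = Some (v, b') \<Longrightarrow> b' = b \<and> v \<in> set s \<and> good v b fs"
  by (induction s) (auto split: if_splits)

lemma findv_None: "findv s b fs = None \<Longrightarrow> v \<in> set s \<Longrightarrow> \<not> good v b fs"
  by (induction s) (auto split: if_splits)

lemma findb_Some: "findb r fs = Some (v, b) \<Longrightarrow> b \<in> fst ` set r \<and> v \<in> set b \<and> good v b fs"
  by (induction r) (auto split: option.splits dest: findv_Some)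

lemma findb_None: "findb r fs = None \<Longrightarrow> (b, p) \<in> set r \<Longrightarrow> v \<in> set b \<Longrightarrow> \<not> good v b fs"
  by (induction r) (auto split: option.splits dest: findv_None)

lemma wf_gmul_even: "wf_gp S L True x \<Longrightarrow> wf_gp S L True y \<Longrightarrow> wf_gp S L True (gmul x y)"
  using wf_gmul[of S L True x True y] by simp

lemma gprod_props:
  assumes "wf_gp S L True a" "\<And>c p. (c, p) \<in> set fs \<Longrightarrow> v \<in> set c \<Longrightarrow> wf_gp S L True p"
  shows "wf_gp S L True (gprod v fs a)"
    and "den L (gprod v fs a) = den L a * den_prod L (containing v fs)"
    and "norm_gp (gprod v fs a) \<le> norm_gp a * norm_prod (containing v fs)"
  using assms
proof (induction v fs a rule: gprod.induct)
  case (2 v c p r a)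
  case 1
  then show ?case using "2.IH" by (auto intro: wf_gmul_even)
  case 2
  show ?case
  proof (cases "v \<in> set c")
    case True
    then have wp: "wf_gp S L True p" using 2 by auto
    have "den L (gprod v r (gmul a p)) = den L (gmul a p) * den_prod L (containing v r)"
      by (rule "2.IH"(2)[OF True wf_gmul_even[OF 2(1) wp]]) (use 2 in auto)
    then show ?thesis using True by (simp add: den_gmul[OF 2(1) wp] mult.assoc)
  next
    case False
    then show ?thesis using 2 "2.IH"(5) by auto
  qed
  case 3
  show ?case
  proof (cases "v \<in> set c")
    case True
    then have "norm_gp (gprod v r (gmul a p)) \<le> norm_gp (gmul a p) * norm_prod (containing v r)"
      using 3 by (intro "2.IH"(3)) (auto intro: wf_gmul_even)
    also have "\<dots> \<le> norm_gp a * max 1 (norm_gp p) * norm_prod (containing v r)"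
      by (intro mult_le_mono1 order_trans[OF norm_gmul]) simp
    finally show ?thesis using True by (simp add: mult.assoc)
  next
    case False
    then show ?thesis using 3 "2.IH"(6) by auto
  qed
qed auto

lemma gprod_all_props:
  assumes "wf_gp S L True a" "\<And>c p. (c, p) \<in> set fs \<Longrightarrow> wf_gp S L True p"
  shows "wf_gp S L True (gprod_all fs a)"
    and "den L (gprod_all fs a) = den L a * den_prod L fs"
  using assms
proof (induction fs a rule: gprod_all.induct)
  case (2 c p r a)
  case 1
  then show ?case using "2.IH" by (auto intro: wf_gmul_even)
  case 2
  then have wp: "wf_gp S L True p" by auto
  have "den L (gprod_all r (gmul a p)) = den L (gmul a p) * den_prod L r"
    by (rule "2.IH"(2)[OF wf_gmul_even[OF 2(1) wp]]) (use 2 in auto)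
  then show ?case by (simp add: den_gmul[OF 2(1) wp] mult.assoc)
qed auto

lemma of_int_fop_eq_iff: "(of_int a :: fop) = of_int b \<longleftrightarrow> a = b"
proof
  assume "(of_int a :: fop) = of_int b"
  then have "app (of_int a) (\<lambda>S. 1) {} = app (of_int b) (\<lambda>S. 1) {}" by simp
  then show "a = b" by simp
qed simp

lemma prod_list_filter:
  assumes "\<And>x. x \<in> set xs \<Longrightarrow> even_op (f x)"
  shows "prod_list (map f xs) = prod_list (map f (filter P xs)) * prod_list (map f (filter (\<lambda>x. \<not> P x) xs))"
  using assms
proof (induction xs)
  case (Cons x xs)
  have "even_op (prod_list (map f (filter P xs)))"
    by (rule even_op_prod_list) (use Cons.prems in auto)
  from even_op_comm[OF this, of "f x"] show ?case
    using Cons by (auto simp: mult.assoc) (metis mult.assoc)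
qed simp

text \<open>The tree decomposition survives only as the property \<open>simplicial\<close> of its
  bags. \<open>z\<close> is the number to be computed and \<open>m\<close> the bit length within
  which all products stay.\<close>

locale elimination =
  fixes n :: nat and z :: nat and bags :: "nat set set" and m :: nat and L :: "nat list"
  assumes bags: "\<And>X. X \<in> bags \<Longrightarrow> X \<subseteq> {..<n}"
    and simplicial: "\<And>R. R \<subseteq> {..<n} \<Longrightarrow> R \<noteq> {} \<Longrightarrow>
      \<exists>v\<in>R. \<exists>X\<in>bags. v \<in> X \<and> (\<forall>Y\<in>bags. v \<in> Y \<longrightarrow> Y \<inter> R \<subseteq> X)"
    and L_def: "L = [0..<2*n]"
begin

text \<open>Scopes lie in bags, which bounds the cost; every bag cut down to \<open>R\<close> lies
  in a scope, which makes the search succeed. \<open>2 ^ card R\<close> reserves a factor 2 of norm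
  for the weight of each open vertex.\<close>

definition invariant :: "nat set \<Rightarrow> factor list \<Rightarrow> bool" where
  "invariant R fs \<longleftrightarrow> R \<subseteq> {..<n} \<and>
    (\<forall>c p. (c, p) \<in> set fs \<longrightarrow> distinct c \<and> wf_gp (gens (set c)) L True p \<and> (\<exists>X\<in>bags. set c \<subseteq> X \<inter> R)) \<and>
    (\<forall>X\<in>bags. \<exists>c p. (c, p) \<in> set fs \<and> X \<inter> R \<subseteq> set c) \<and>
    norm_prod fs * 2 ^ card R < 2 ^ m \<and>
    top_coeff (2*n) (weight n R * den_prod L fs) = int z"

lemma invariantD:
  assumes "invariant R fs"
  shows "R \<subseteq> {..<n}"
    and "(c, p) \<in> set fs \<Longrightarrow> distinct c"
    and "(c, p) \<in> set fs \<Longrightarrow> wf_gp (gens (set c)) L True p"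
    and "(c, p) \<in> set fs \<Longrightarrow> \<exists>X\<in>bags. set c \<subseteq> X \<inter> R"
    and "X \<in> bags \<Longrightarrow> \<exists>c p. (c, p) \<in> set fs \<and> X \<inter> R \<subseteq> set c"
    and "norm_prod fs * 2 ^ card R < 2 ^ m"
    and "top_coeff (2*n) (weight n R * den_prod L fs) = int z"
  using assms unfolding invariant_def by simp_all

text \<open>For a simplicial vertex \<open>v\<close> with bag \<open>X\<close>, a scope that covers
  \<open>X \<inter> R\<close> contains every scope at \<open>v\<close>, since each of these lies in
  a bag cut down to \<open>R\<close>.\<close>

lemma findb_ex:
  assumes inv: "invariant R fs" and R: "R \<noteq> {}"
  obtains v b where "findb fs fs = Some (v, b)"
proof (cases "findb fs fs")
  case None
  obtain v X where v: "v \<in> R" "X \<in> bags" "v \<in> X" and max: "\<And>Y. Y \<in> bags \<Longrightarrow> v \<in> Y \<Longrightarrow> Y \<inter> R \<subseteq> X"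
    using simplicial[OF invariantD(1)[OF inv] R] by metis
  obtain b p where b: "(b, p) \<in> set fs" "X \<inter> R \<subseteq> set b"
    using invariantD(5)[OF inv v(2)] by blast
  have "set c \<subseteq> set b" if c: "(c, q) \<in> set fs" "v \<in> set c" for c q
  proof -
    obtain Y where Y: "Y \<in> bags" "set c \<subseteq> Y \<inter> R"
      using invariantD(4)[OF inv c(1)] by blast
    have "Y \<inter> R \<subseteq> X" using max[OF Y(1)] c(2) Y(2) by blast
    then show ?thesis using Y b by blast
  qed
  then have "good v b fs" unfolding good_def by auto
  moreover have "v \<in> set b" using v b by blast
  ultimately show ?thesis using findb_None[OF None b(1)] by blast
qed (use that in auto)

text \<open>Applying \<open>den_gder\<close> twice writes the product at \<open>v\<close> as
  \<open>a1 + a2 * th (2*v+1) + den L x2 * tau v\<close>. The first two terms miss a generator of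
  \<open>v\<close> that nothing else supplies; in the last, \<open>tau v\<close> joins the weight,
  so \<open>v\<close> leaves \<open>R\<close>.\<close>

lemma invariant_eliminate:
  assumes inv: "invariant R fs" and find: "findb fs fs = Some (v, b)"
  shows "v \<in> R" "distinct b" "\<exists>X\<in>bags. set b \<subseteq> X"
    and "wf_gp (gens (set b)) L True (gprod v fs (gvert L v))"
    and "wf_gp (gens (set b)) L False (gder L (2*v+1) (gprod v fs (gvert L v)))"
    and "invariant (R - {v}) (eliminate L v b fs)"
proof -
  note R = invariantD(1)[OF inv] and norm = invariantD(6)[OF inv] and top = invariantD(7)[OF inv]
  have facs: "distinct c \<and> wf_gp (gens (set c)) L True p \<and> (\<exists>X\<in>bags. set c \<subseteq> X \<inter> R)"
    if "(c, p) \<in> set fs" for c p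
    using invariantD(2-4)[OF inv that] by simp
  obtain p0 where p0: "(b, p0) \<in> set fs" and vb: "v \<in> set b" and good: "good v b fs"
    using findb_Some[OF find] by auto
  from facs[OF p0] obtain X0 where X0: "X0 \<in> bags" "set b \<subseteq> X0 \<inter> R" by blast
  show vR: "v \<in> R" using X0 vb by blast
  show "distinct b" using facs[OF p0] by blast
  show "\<exists>X\<in>bags. set b \<subseteq> X" using X0 by blast
  have vn: "v < n" using vR R by auto
  have vL: "2*v \<in> set L" "2*v+1 \<in> set L" using vn by (auto simp: L_def)
  have dL: "distinct L" by (simp add: L_def)
  let ?S = "gens (set b)"
  have vS: "2*v \<in> ?S" "2*v+1 \<in> ?S" using vb by (auto simp: gens_def)
  have wfp: "wf_gp ?S L True p" if "(c, p) \<in> set fs" "v \<in> set c" for c p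
  proof -
    have "set c \<subseteq> set b" using good that unfolding good_def by blast
    then have "gens (set c) \<inter> set L \<subseteq> ?S" unfolding gens_def by auto
    with facs[OF that(1)] show ?thesis by (auto elim: wf_gp_mono)
  qed
  define x where "x = gprod v fs (gvert L v)"
  define x1 where "x1 = gder L (2*v+1) x"
  define x2 where "x2 = gder L (2*v) x1"
  have wx: "wf_gp ?S L True x"
    and dx: "den L x = (1 + tau v) * den_prod L (containing v fs)"
    and nx: "norm_gp x \<le> norm_gp (gvert L v) * norm_prod (containing v fs)"
    using gprod_props[OF wf_gvert[OF vS] wfp, of fs]
    by (simp_all add: x_def den_gvert[OF vL])
  then show "wf_gp (gens (set b)) L True (gprod v fs (gvert L v))" by (simp add: x_def)
  have wx1: "wf_gp (?S - {2*v+1}) L False x1"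
    using wf_gder[OF wx dL, of "2*v+1"] by (simp add: x1_def)
  then show "wf_gp (gens (set b)) L False (gder L (2*v+1) (gprod v fs (gvert L v)))"
    unfolding x_def x1_def by (rule wf_gp_mono) auto
  have "?S - {2*v+1} - {2*v} = gens (set (removeAll v b))"
    unfolding gens_def by auto
  then have wx2: "wf_gp (gens (set (removeAll v b))) L True x2"
    using wf_gder[OF wx1 dL, of "2*v"] by (simp add: x2_def)
  obtain a1 where a1: "free (2*v+1) a1" "den L x = a1 + den L x1 * th (2*v+1)"
    using den_gder[OF wx dL vL(2)] unfolding x1_def by blast
  obtain a2 where a2: "free (2*v) a2" "den L x1 = a2 + den L x2 * th (2*v)"
    using den_gder[OF wx1 dL vL(1)] unfolding x2_def by blast
  define rest where "rest = den_prod L (avoiding v fs)"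
  have free_rest: "free g rest" if "g div 2 = v" for g
    unfolding rest_def
    by (intro free_prod_list) (use that facs in \<open>auto intro!: free_den simp: gens_def\<close>)
  have ev: "even_op (den L p)" if "(c, p) \<in> set fs" for c p
    using even_op_den[of _ L True p] facs[OF that] by auto
  have split: "den_prod L fs = den_prod L (containing v fs) * rest"
    unfolding rest_def
    by (subst prod_list_filter[where P = "\<lambda>(c, p). v \<in> set c"])
       (auto intro: ev simp: case_prod_unfold)
  let ?w = "weight_except n R v"
  have free_w: "free g ?w" if "g div 2 = v" for g using free_weight_except that .
  have ev2: "even_op (den L x2)" using even_op_den[OF wx2] by simp
  have "weight n R * den_prod L fs = ?w * den L x * rest"
    using vR by (simp add: weight_extract[OF vn] split dx mult.assoc)
  also have "\<dots> = ?w * a1 * rest + ?w * a2 * th (2*v+1) * rest + ?w * (den L x2 * tau v) * rest"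
    by (simp add: a1(2) a2(2) tau_def distrib_left distrib_right mult.assoc)
  finally have "int z = top_coeff (2*n) (?w * a1 * rest) + top_coeff (2*n) (?w * a2 * th (2*v+1) * rest)
      + top_coeff (2*n) (?w * (den L x2 * tau v) * rest)"
    using top by simp
  moreover have "top_coeff (2*n) (?w * a1 * rest) = 0"
    by (rule top_coeff_free[of "2*v+1"]) (use vn in \<open>auto intro!: free_mult free_w free_rest a1(1)[simplified]\<close>)
  moreover have "top_coeff (2*n) (?w * a2 * th (2*v+1) * rest) = 0"
    by (rule top_coeff_free[of "2*v"]) (use vn in \<open>auto intro!: free_mult free_w free_rest free_th a2(1)\<close>)
  moreover have "?w * (den L x2 * tau v) * rest = weight n (R - {v}) * (den L x2 * rest)"
    using even_op_comm[OF ev2, of "tau v"]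
    by (simp add: weight_extract[OF vn] weight_except_remove mult.assoc)
  ultimately have top': "top_coeff (2*n) (weight n (R - {v}) * (den L x2 * rest)) = int z" by simp
  have "norm_gp x2 \<le> norm_gp x"
    unfolding x2_def x1_def by (rule order_trans[OF norm_gder norm_gder])
  also have "\<dots> \<le> 2 * norm_prod (containing v fs)"
    using nx norm_gvert[of L v] by (meson mult_le_mono1 order_trans)
  \<comment> \<open>The weight of \<open>v\<close> has contributed at most the factor 2, which the
    drop of \<open>card R\<close> pays for.\<close>
  finally have nx2: "max 1 (norm_gp x2) \<le> 2 * norm_prod (containing v fs)"
    using norm_prod_pos[of "containing v fs"] by simp
  have nsplit: "norm_prod fs = norm_prod (containing v fs) * norm_prod (avoiding v fs)"
    by (induction fs) auto
  have elim: "eliminate L v b fs = (removeAll v b, x2) # avoiding v fs"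
    by (simp add: eliminate_def x2_def x1_def x_def)
  have cR: "card R = Suc (card (R - {v}))"
    using card_Suc_Diff1[OF finite_subset[OF R] vR] by simp
  have "norm_prod (eliminate L v b fs) * 2 ^ card (R - {v}) =
      max 1 (norm_gp x2) * (norm_prod (avoiding v fs) * 2 ^ card (R - {v}))"
    by (simp add: elim mult.assoc)
  also have "\<dots> \<le> 2 * norm_prod (containing v fs) * (norm_prod (avoiding v fs) * 2 ^ card (R - {v}))"
    by (rule mult_le_mono1[OF nx2])
  also have "\<dots> = norm_prod fs * 2 ^ card R"
    by (simp only: nsplit cR power_Suc mult_ac)
  finally have norm': "norm_prod (eliminate L v b fs) * 2 ^ card (R - {v}) < 2 ^ m"
    using norm by linarith
  have facs': "distinct c \<and> wf_gp (gens (set c)) L True p \<and> (\<exists>X\<in>bags. set c \<subseteq> X \<inter> (R - {v}))"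
    if "(c, p) \<in> set (eliminate L v b fs)" for c p
  proof (cases "(c, p) = (removeAll v b, x2)")
    case True
    then show ?thesis using wx2 X0 facs[OF p0] by (auto intro!: distinct_removeAll bexI[of _ X0])
  next
    case False
    then have "(c, p) \<in> set fs" "v \<notin> set c" using that by (auto simp: elim)
    then show ?thesis using facs[of c p] by blast
  qed
  have cover': "\<exists>c p. (c, p) \<in> set (eliminate L v b fs) \<and> X \<inter> (R - {v}) \<subseteq> set c" if X: "X \<in> bags" for X
  proof -
    obtain c p where c: "(c, p) \<in> set fs" "X \<inter> R \<subseteq> set c" using invariantD(5)[OF inv X] by blast
    show ?thesis
    proof (cases "v \<in> set c")
      case True
      then have "set c \<subseteq> set b" using good c(1) unfolding good_def by blast
      then have "X \<inter> (R - {v}) \<subseteq> set (removeAll v b)" using c(2) by auto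
      moreover have "(removeAll v b, x2) \<in> set (eliminate L v b fs)" by (simp add: elim)
      ultimately show ?thesis by blast
    next
      case False
      then have "(c, p) \<in> set (eliminate L v b fs)" using c(1) by (simp add: elim)
      then show ?thesis using c(2) by blast
    qed
  qed
  show "invariant (R - {v}) (eliminate L v b fs)"
    unfolding invariant_def
  proof (intro conjI allI impI ballI)
    show "R - {v} \<subseteq> {..<n}" using R by blast
    show "top_coeff (2*n) (weight n (R - {v}) * den_prod L (eliminate L v b fs)) = int z"
      using top' by (simp add: elim rest_def)
  qed (use facs' cover' norm' in \<open>simp_all only:\<close>)
qed

text \<open>Without open vertices all scopes are empty and all factors are integers. The weight is
  the product of all \<open>tau v\<close>, whose top coefficient is 1, so the factors multiply to
  \<open>z\<close>.\<close>

lemma invariant_empty: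
  assumes inv: "invariant {} fs"
  shows "findb fs fs = None" "\<And>c p. (c, p) \<in> set fs \<Longrightarrow> wf_gp {} L True p"
    and "wf_gp {} L True (gprod_all fs (gone L))" "den L (gprod_all fs (gone L)) = of_int (int z)"
proof -
  have c: "c = []" if "(c, p) \<in> set fs" for c p
    using invariantD(4)[OF inv that] by simp
  then show wf: "wf_gp {} L True p" if "(c, p) \<in> set fs" for c p
    using invariantD(3)[OF inv that] that by (force simp: gens_def)
  show "findb fs fs = None"
  proof (cases "findb fs fs")
    case (Some x)
    obtain v b where "x = (v, b)" by (cases x)
    with Some have "b \<in> fst ` set fs" "v \<in> set b" using findb_Some[of fs fs v b] by simp_all
    then show ?thesis using c by force
  qed
  let ?x = "gprod_all fs (gone L)"
  show wx: "wf_gp {} L True ?x" using gprod_all_props(1)[OF wf_gone wf] .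
  have dx: "den L ?x = den_prod L fs"
    using gprod_all_props(2)[OF wf_gone wf, of fs] by (simp add: den_gone)
  have "\<exists>w. den K y = of_int w" if "wf_gp {} K True y" for K y
    using that by (induction K arbitrary: y) (auto simp: wf_gp_Nil wf_gp_Cons simp del: of_int_diff intro: exI[of _ 0])
  then obtain w where w: "den L ?x = of_int w" using wx by blast
  have "top_coeff (2*n) (weight n {} * of_int w) = w"
  proof -
    have "weight n {} * of_int w = of_int w * prod_list (map tau [0..<n])"
      by (simp add: weight_def mult_of_int_commute)
    then show ?thesis using top_coeff_prod_tau[of n] by (simp add: top_coeff_def)
  qed
  then have "w = int z" using invariantD(7)[OF inv] w dx by simp
  then show "den L ?x = of_int (int z)" using w by simp
qed

text \<open>The factor with scope \<open>b\<close> is consumed and makes room for the new one; hence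
  one bound on the list serves all rounds.\<close>

lemma length_eliminate:
  assumes "findb fs fs = Some (v, b)"
  shows "length (eliminate L v b fs) \<le> length fs"
proof -
  obtain p where "(b, p) \<in> set fs" "v \<in> set b" using findb_Some[OF assms] by auto
  then have "length (avoiding v fs) < length fs"
    by (intro length_filter_less[of "(b, p)"]) auto
  then show ?thesis by (simp add: eliminate_def)
qed

end

section \<open>Running time of the elimination\<close>

abbreviation enc_scope :: "nat list \<Rightarrow> sexp" where
  "enc_scope \<equiv> enc_list enc_nat"

abbreviation enc_factors :: "factor list \<Rightarrow> sexp" where
  "enc_factors \<equiv> enc_list (enc_prod enc_scope enc_gp)"

fun enc_choice :: "(nat \<times> nat list) option \<Rightarrow> sexp" where
  "enc_choice None = Atom"
| "enc_choice (Some (v, b)) = Node (enc_nat v) (enc_scope b)"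

text \<open>\<open>M\<close> bounds every polynomial quantity, and \<open>D = 4 ^ k\<close> is the number of monomials over a
  bag with \<open>k\<close> vertices.\<close>

locale bounds =
  fixes n m k M :: nat and D :: nat and L :: "nat list"
  assumes M: "4 * n + 1 \<le> M" "m + 1 \<le> M"
    and lab_le: "\<And>g. g < 2 * n \<Longrightarrow> ssize (lab g) \<le> M"
    and nat_le: "\<And>v. v \<le> n \<Longrightarrow> ssize (enc_nat v) \<le> M"
    and n_less: "n < 2 ^ m" and m_ge: "4 \<le> m"
    and D_def: "D = 4 ^ k" and L_def: "L = [0..<2*n]"
begin

lemma M_pos: "1 \<le> M" and D_pos: "1 \<le> D"
  using M by (auto simp: D_def)

lemma length_L: "2 * length L + 1 \<le> M" "length L + 1 \<le> M"
  using M by (auto simp: L_def)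

lemma lab_L: "h \<in> set L \<Longrightarrow> ssize (lab h) \<le> M"
  by (rule lab_le) (simp add: L_def)

lemma two_power_count: "count_in S L \<le> 2 * k \<Longrightarrow> 2 ^ count_in S L \<le> D"
  using power_increasing[of "count_in S L" "2 * k" "2::nat"] by (simp add: D_def power_mult)

lemma gsize_D: "wf_gp S L b x \<Longrightarrow> count_in S L \<le> 2 * k \<Longrightarrow> gsize x \<le> M * D"
  using gsize_le[of S L b x] mult_le_mono[OF length_L(1) two_power_count[of S]] by linarith

lemma run_ADD:
  assumes "wf_gp S L b x" "wf_gp S L b y" "norm_gp x < 2 ^ m" "norm_gp y < 2 ^ m" "count_in S L \<le> 2 * k"
  shows "call ADD [enc_gp x, enc_gp y] (enc_gp (gadd x y)) (100 * M^2 * D)"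
proof (rule computes_mono[OF comp_ADD[OF assms(1-4)]])
  have "100 * (m + 1) * gsize x \<le> 100 * M * (M * D)"
    using M gsize_D[OF assms(1,5)] by (intro mult_le_mono) auto
  then show "100 * (m + 1) * gsize x \<le> 100 * M^2 * D" by (simp add: power2_eq_square mult.assoc)
qed

lemma run_NEG:
  assumes "wf_gp S L b x" "count_in S L \<le> 2 * k"
  shows "call NEG [enc_gp x] (enc_gp (gneg x)) (40 * (M * D))"
  by (rule computes_mono[OF comp_NEG]) (use gsize_D[OF assms] in simp)

lemma MD_mono: "a \<le> a' \<Longrightarrow> b \<le> b' \<Longrightarrow> c * (M^a * D^b) \<le> c * (M^a' * D^b')"
  using M_pos D_pos by (intro mult_le_mono power_increasing order_refl) auto

text \<open>Bounds one multiplication up to a constant: \<open>D^2\<close> for the recursion times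
  \<open>D\<close> for the element size charged to each call, the source of 64. The three factors
  \<open>M\<close> stand for the depth, the bit length and the linear factor in the element
  size.\<close>

definition U :: nat where "U = M^3 * D^3"

lemma U_ge: "1 \<le> U" "M \<le> U" "M * D \<le> U" "M^2 \<le> U" "M^2 * D \<le> U" "M^2 * D^2 \<le> U"
  unfolding U_def
  using MD_mono[of 0 3 0 3 1] MD_mono[of 1 3 0 3 1] MD_mono[of 1 3 1 3 1] MD_mono[of 2 3 0 3 1]
    MD_mono[of 2 3 1 3 1] MD_mono[of 2 3 2 3 1] by simp_all

lemma run_MUL:
  assumes "wf_gp S L b x" "wf_gp S L c y"
    and "norm_gp x < 2 ^ m" "norm_gp y < 2 ^ m" "norm_gp x * norm_gp y < 2 ^ m"
    and S: "count_in S L \<le> 2 * k"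
  shows "call MUL [enc_gp x, enc_gp y] (enc_gp (gmul x y)) (1200 * U)"
proof (rule computes_mono[OF comp_MUL[OF assms(1-5) _ order_refl]])
  show "(2 * length L + 1) * 2 ^ count_in S L \<le> M * D"
    by (rule mult_le_mono[OF length_L(1) two_power_count[OF S]])
  have "(4::nat) ^ count_in S L = (2 ^ count_in S L)^2"
    by (simp add: power2_eq_square flip: power_mult_distrib)
  also have "\<dots> \<le> D^2" by (rule power_mono[OF two_power_count[OF S]]) simp
  finally have four: "(4::nat) ^ count_in S L \<le> D^2" .
  have "1000 * (m + 1)\<^sup>2 + 200 * (m + 1) * (M * D) \<le> 1000 * (M^2 * D) + 200 * M * (M * D)"
    using M D_pos by (intro add_mono mult_le_mono order_trans[OF power_mono[of "m+1" M 2]]) auto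
  also have "\<dots> = 1200 * (M^2 * D)" by (simp add: power2_eq_square)
  finally have "(length L + 1) * 4 ^ count_in S L * (1000 * (m + 1)\<^sup>2 + 200 * (m + 1) * (M * D))
      \<le> M * D^2 * (1200 * (M^2 * D))"
    by (intro mult_le_mono length_L(2) four)
  also have "\<dots> = 1200 * U" by (simp add: U_def power2_eq_square power3_eq_cube)
  finally show "(length L + 1) * 4 ^ count_in S L * (1000 * (m + 1)\<^sup>2 + 200 * (m + 1) * (M * D))
      \<le> 1200 * U" .
qed

lemma run_DER:
  assumes "wf_gp S L b x" "count_in S L \<le> 2 * k"
  shows "call DER [enc_list lab L, enc_gp x, lab g] (enc_gp (gder L g x)) (120 * M^2 * D^2)"
proof (rule computes_mono[OF comp_DER[OF lab_L assms(1) gsize_D[OF assms]]])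
  have MD: "M \<le> M * D" "1 \<le> M * D" using D_pos M_pos by (simp_all add: Suc_le_eq)
  have "gsize x * (60 + 20 * M + 40 * (M * D)) \<le> M * D * (120 * (M * D))"
    using MD by (intro mult_le_mono gsize_D[OF assms]) linarith
  then show "gsize x * (60 + 20 * M + 40 * (M * D)) \<le> 120 * M^2 * D^2"
    by (simp add: power2_eq_square mult_ac)
qed

lemma run_ONE: "call ONE [enc_list lab L] (enc_gp (gone L)) (20 * M)"
  by (rule computes_mono[OF comp_ONE]) (use length_L in simp)

lemma run_GEN: "call GEN [enc_list lab L, lab g] (enc_gp (ggen L g)) (80 * M^2)"
proof (rule computes_mono[OF comp_GEN[OF lab_L]])
  have "(60 + 20 * M) * (length L + 1) \<le> (80 * M) * M"
    using M_pos length_L by (intro mult_le_mono) auto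
  then show "(60 + 20 * M) * (length L + 1) \<le> 80 * M^2" by (simp add: power2_eq_square mult.assoc)
qed

lemma M_monos: "1 \<le> M^3" "M \<le> M^3" "M^2 \<le> M^3"
  using power_increasing[of 0 3 M] power_increasing[of 1 3 M] power_increasing[of 2 3 M] M_pos by simp_all

section \<open>Cost of scope tests, search and products\<close>

lemma run_MEM:
  assumes "v < n"
  shows "call MEM [enc_nat v, enc_scope c] (enc_bool (v \<in> set c)) ((20 * M + 20) * (length c + 1))"
proof (induction c)
  case (Cons u c)
  have eq: "call EQS [enc_nat v, enc_nat u] (enc_bool (v = u)) (20 * M)"
    using computes_mono[OF comp_EQS[of "enc_nat v" "enc_nat u"]] nat_le[of v] assms by simp
  show ?case
    by (rule comp_code[OF forest_program_nth(17)]; cases "v = u")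
       (use computesD[OF eq] computesD[OF Cons.IH] in \<open>simp_all add: mem_code_def\<close>)
qed (rule comp_code[OF forest_program_nth(17)]; simp add: mem_code_def)

lemma run_MEM':
  assumes "v < n" "length c + 1 \<le> M"
  shows "call MEM [enc_nat v, enc_scope c] (enc_bool (v \<in> set c)) (40 * M^2)"
proof (rule computes_mono[OF run_MEM[OF assms(1)]])
  have "(20 * M + 20) * (length c + 1) \<le> (40 * M) * M"
    using M_pos assms(2) by (intro mult_le_mono) auto
  then show "(20 * M + 20) * (length c + 1) \<le> 40 * M^2" by (simp add: power2_eq_square mult.assoc)
qed

lemma run_SUBS:
  assumes "set c \<subseteq> {..<n}" "length b + 1 \<le> M"
  shows "call SUBS [enc_scope c, enc_scope b] (enc_bool (set c \<subseteq> set b)) ((40 * M^2 + 20) * (length c + 1))"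
  using assms(1)
proof (induction c)
  case (Cons u c)
  have mem: "call MEM [enc_nat u, enc_scope b] (enc_bool (u \<in> set b)) (40 * M^2)"
    by (rule run_MEM') (use Cons.prems assms in auto)
  have IH: "call SUBS [enc_scope c, enc_scope b] (enc_bool (set c \<subseteq> set b)) ((40 * M^2 + 20) * (length c + 1))"
    by (rule Cons.IH) (use Cons.prems in auto)
  show ?case
    by (rule comp_code[OF forest_program_nth(18)]; cases "u \<in> set b")
       (use computesD[OF mem] computesD[OF IH] in \<open>simp_all add: subs_code_def algebra_simps\<close>)
qed (rule comp_code[OF forest_program_nth(18)]; simp add: subs_code_def)

lemma run_SUBS':
  assumes "set c \<subseteq> {..<n}" "length b + 1 \<le> M" "length c + 1 \<le> M"
  shows "call SUBS [enc_scope c, enc_scope b] (enc_bool (set c \<subseteq> set b)) (60 * M^3)"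
proof (rule computes_mono[OF run_SUBS[OF assms(1,2)]])
  have "(40 * M^2 + 20) * (length c + 1) \<le> (60 * M^2) * M"
    using M_pos assms(3) by (intro mult_le_mono) auto
  then show "(40 * M^2 + 20) * (length c + 1) \<le> 60 * M^3"
    by (simp add: power2_eq_square power3_eq_cube mult.assoc)
qed

lemma run_DEL:
  assumes "v < n"
  shows "call DEL [enc_nat v, enc_scope c] (enc_scope (removeAll v c)) ((20 * M + 30) * (length c + 1))"
proof (induction c)
  case (Cons u c)
  have eq: "call EQS [enc_nat v, enc_nat u] (enc_bool (v = u)) (20 * M)"
    using computes_mono[OF comp_EQS[of "enc_nat v" "enc_nat u"]] nat_le[of v] assms by simp
  show ?case
    by (rule comp_code[OF forest_program_nth(19)]; cases "v = u")
       (use computesD[OF eq] computesD[OF Cons.IH] in \<open>simp_all add: del_code_def\<close>)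
qed (rule comp_code[OF forest_program_nth(19)]; simp add: del_code_def)

lemma run_DEL':
  assumes "v < n" "length c + 1 \<le> M"
  shows "call DEL [enc_nat v, enc_scope c] (enc_scope (removeAll v c)) (50 * M^2)"
proof (rule computes_mono[OF run_DEL[OF assms(1)]])
  have "(20 * M + 30) * (length c + 1) \<le> (50 * M) * M"
    using M_pos assms(2) by (intro mult_le_mono) auto
  then show "(20 * M + 30) * (length c + 1) \<le> 50 * M^2" by (simp add: power2_eq_square mult.assoc)
qed

definition scopes_ok :: "factor list \<Rightarrow> bool" where
  "scopes_ok fs \<longleftrightarrow> (\<forall>c p. (c, p) \<in> set fs \<longrightarrow> set c \<subseteq> {..<n} \<and> length c + 1 \<le> M)"

lemma scopes_ok_Cons [simp]:
  "scopes_ok ((c, p) # fs) \<longleftrightarrow> set c \<subseteq> {..<n} \<and> length c + 1 \<le> M \<and> scopes_ok fs"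
  unfolding scopes_ok_def by auto

lemma good_Cons [simp]: "good v b ((c, p) # fs) \<longleftrightarrow> (v \<in> set c \<longrightarrow> set c \<subseteq> set b) \<and> good v b fs"
  unfolding good_def by auto

lemma run_GOOD:
  assumes "v < n" "length b + 1 \<le> M" "scopes_ok fs"
  shows "call GOOD [enc_nat v, enc_scope b, enc_factors fs] (enc_bool (good v b fs)) (140 * M^3 * (length fs + 1))"
  using assms(3)
proof (induction fs)
  case Nil
  show ?case
    by (rule comp_code[OF forest_program_nth(20)]) (use M_monos in \<open>simp_all add: good_code_def good_def\<close>)
next
  case (Cons f fs)
  obtain c p where f: "f = (c, p)" by (cases f)
  have mem: "call MEM [enc_nat v, enc_scope c] (enc_bool (v \<in> set c)) (40 * M^2)"
    by (rule run_MEM') (use Cons.prems assms f in auto)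
  have sub: "call SUBS [enc_scope c, enc_scope b] (enc_bool (set c \<subseteq> set b)) (60 * M^3)"
    by (rule run_SUBS') (use Cons.prems assms f in auto)
  have IH: "call GOOD [enc_nat v, enc_scope b, enc_factors fs] (enc_bool (good v b fs)) (140 * M^3 * (length fs + 1))"
    by (rule Cons.IH) (use Cons.prems f in auto)
  show ?case
    by (rule comp_code[OF forest_program_nth(20)]; cases "v \<in> set c"; cases "set c \<subseteq> set b")
       (use M_monos computesD[OF mem] computesD[OF sub] computesD[OF IH] in
         \<open>simp_all add: good_code_def f\<close>)
qed

lemma run_FINDV:
  assumes "length b + 1 \<le> M" "scopes_ok fs" "length fs + 1 \<le> M" "set s \<subseteq> {..<n}"
  shows "call FINDV [enc_scope s, enc_scope b, enc_factors fs] (enc_choice (findv s b fs)) (160 * M^4 * (length s + 1))"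
proof -
  define Q where "Q = M^4"
  have Q: "1 \<le> Q" unfolding Q_def by (rule one_le_power[OF M_pos])
  show ?thesis
    using assms(4) unfolding Q_def[symmetric]
  proof (induction s)
    case Nil
    show ?case
      by (rule comp_code[OF forest_program_nth(21)]) (use Q in \<open>simp_all add: findv_code_def\<close>)
  next
    case (Cons v s)
    have "140 * M^3 * (length fs + 1) \<le> 140 * M^3 * M" using assms(3) by (intro mult_le_mono) auto
    also have "\<dots> = 140 * Q" using power_add[of M 3 1] by (simp add: Q_def)
    finally have good: "call GOOD [enc_nat v, enc_scope b, enc_factors fs] (enc_bool (good v b fs)) (140 * Q)"
      by (rule computes_mono[OF run_GOOD, rotated -1]) (use assms Cons.prems in auto)
    have IH: "call FINDV [enc_scope s, enc_scope b, enc_factors fs] (enc_choice (findv s b fs)) (160 * Q * (length s + 1))"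
      by (rule Cons.IH) (use Cons.prems in auto)
    show ?case
      by (intro comp_code[OF forest_program_nth(21)]; cases "good v b fs")
         (use Q computesD[OF good] computesD[OF IH] in \<open>simp_all add: findv_code_def\<close>)
  qed
qed

lemma run_FINDB:
  assumes "scopes_ok fs" "length fs + 1 \<le> M" "scopes_ok r"
  shows "call FINDB [enc_factors r, enc_factors fs] (enc_choice (findb r fs)) (200 * M^5 * (length r + 1))"
proof -
  define Q where "Q = M^5"
  have Q: "1 \<le> Q" unfolding Q_def by (rule one_le_power[OF M_pos])
  show ?thesis
    using assms(3) unfolding Q_def[symmetric]
  proof (induction r)
    case Nil
    show ?case
      by (rule comp_code[OF forest_program_nth(22)]) (use Q in \<open>simp_all add: findb_code_def\<close>)
  next
    case (Cons f r)
    obtain b p where f: "f = (b, p)" by (cases f)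
    have "160 * M^4 * (length b + 1) \<le> 160 * M^4 * M" using Cons.prems f by (intro mult_le_mono) auto
    also have "\<dots> = 160 * Q" using power_add[of M 4 1] by (simp add: Q_def)
    finally have fv: "call FINDV [enc_scope b, enc_scope b, enc_factors fs] (enc_choice (findv b b fs)) (160 * Q)"
      by (rule computes_mono[OF run_FINDV, rotated -1]) (use assms Cons.prems f in auto)
    have IH: "call FINDB [enc_factors r, enc_factors fs] (enc_choice (findb r fs)) (200 * Q * (length r + 1))"
      by (rule Cons.IH) (use Cons.prems f in auto)
    show ?case
      by (intro comp_code[OF forest_program_nth(22)]; cases "findv b b fs")
         (use Q computesD[OF fv] computesD[OF IH] in \<open>auto simp: findb_code_def f\<close>)
  qed
qed

lemma run_FILT:
  assumes "v < n" "scopes_ok fs"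
  shows "call FILT [enc_nat v, enc_factors fs] (enc_factors (avoiding v fs)) (70 * M^2 * (length fs + 1))"
proof -
  define Q where "Q = M^2"
  have Q: "1 \<le> Q" unfolding Q_def by (rule one_le_power[OF M_pos])
  show ?thesis
    using assms(2) unfolding Q_def[symmetric]
  proof (induction fs)
    case Nil
    show ?case
      by (rule comp_code[OF forest_program_nth(24)]) (use Q in \<open>simp_all add: filt_code_def\<close>)
  next
    case (Cons f fs)
    obtain c p where f: "f = (c, p)" by (cases f)
    have mem: "call MEM [enc_nat v, enc_scope c] (enc_bool (v \<in> set c)) (40 * Q)"
      unfolding Q_def by (rule run_MEM') (use Cons.prems assms f in auto)
    have IH: "call FILT [enc_nat v, enc_factors fs] (enc_factors (avoiding v fs)) (70 * Q * (length fs + 1))"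
      by (rule Cons.IH) (use Cons.prems f in auto)
    show ?case
      by (intro comp_code[OF forest_program_nth(24)]; cases "v \<in> set c")
         (use Q computesD[OF mem] computesD[OF IH] in \<open>simp_all add: filt_code_def f\<close>)
  qed
qed

text \<open>The norm bound covers the accumulator together with the factors still to come. A
  multiplication moves norm from the list to the accumulator, so every partial product fits in
  \<open>m\<close> bits.\<close>

lemma run_PRODV:
  assumes v: "v < n" and S: "count_in S L \<le> 2 * k"
    and "scopes_ok fs" "wf_gp S L True a"
    and "\<And>c p. (c, p) \<in> set fs \<Longrightarrow> v \<in> set c \<Longrightarrow> wf_gp S L True p"
    and "max 1 (norm_gp a) * norm_prod (containing v fs) < 2 ^ m"
  shows "call PRODV [enc_nat v, enc_factors fs, enc_gp a] (enc_gp (gprod v fs a)) (1260 * U * (length fs + 1))"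
  using assms(3-6)
proof (induction fs arbitrary: a)
  case Nil
  show ?case
    by (rule comp_code[OF forest_program_nth(23)]) (use U_ge in \<open>simp_all add: prod_code_def\<close>)
next
  case (Cons f fs)
  obtain c p where f: "f = (c, p)" by (cases f)
  have mem: "call MEM [enc_nat v, enc_scope c] (enc_bool (v \<in> set c)) (40 * M^2)"
    by (rule run_MEM') (use Cons.prems v f in auto)
  show ?case
  proof (cases "v \<in> set c")
    case True
    let ?N = "norm_prod (containing v fs)"
    have wp: "wf_gp S L True p" using Cons.prems(3)[of c p] f True by simp
    have N: "max 1 (norm_gp a) * (max 1 (norm_gp p) * ?N) < 2 ^ m"
      using Cons.prems(4) f True by simp
    have le: "norm_gp a * norm_gp p \<le> max 1 (norm_gp a) * max 1 (norm_gp p)"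
      by (intro mult_le_mono) auto
    have "max 1 (norm_gp a) * max 1 (norm_gp p) * 1 \<le> max 1 (norm_gp a) * max 1 (norm_gp p) * ?N"
      using norm_prod_pos[of "containing v fs"] by (intro mult_le_mono) auto
    then have N1: "max 1 (norm_gp a) * max 1 (norm_gp p) < 2 ^ m"
      using N unfolding mult.assoc mult_1_right by linarith
    have a1: "max 1 (norm_gp a) * 1 \<le> max 1 (norm_gp a) * max 1 (norm_gp p)"
      and p1: "1 * max 1 (norm_gp p) \<le> max 1 (norm_gp a) * max 1 (norm_gp p)"
      by (intro mult_le_mono; simp)+
    have mul: "call MUL [enc_gp a, enc_gp p] (enc_gp (gmul a p)) (1200 * U)"
    proof (rule run_MUL[OF Cons.prems(2) wp _ _ _ S])
      show "norm_gp a < 2 ^ m" using a1 N1 by linarith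
      show "norm_gp p < 2 ^ m" using p1 N1 by linarith
      show "norm_gp a * norm_gp p < 2 ^ m" using le N1 by linarith
    qed
    have "1 * 1 \<le> max 1 (norm_gp a) * max 1 (norm_gp p)" by (intro mult_le_mono) auto
    then have "max 1 (norm_gp (gmul a p)) \<le> max 1 (norm_gp a) * max 1 (norm_gp p)"
      using le norm_gmul[of a p] by linarith
    from mult_le_mono1[OF this, of ?N] N
    have N2: "max 1 (norm_gp (gmul a p)) * ?N < 2 ^ m" by (simp only: mult.assoc)
    have IH: "call PRODV [enc_nat v, enc_factors fs, enc_gp (gmul a p)] (enc_gp (gprod v fs (gmul a p)))
        (1260 * U * (length fs + 1))"
      by (rule Cons.IH[OF _ wf_gmul_even[OF Cons.prems(2) wp] _ N2]) (use Cons.prems f in auto)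
    show ?thesis
      by (rule comp_code[OF forest_program_nth(23)])
         (use U_ge True computesD[OF mem] computesD[OF IH] computesD[OF mul] in \<open>simp_all add: prod_code_def f\<close>)
  next
    case False
    have IH: "call PRODV [enc_nat v, enc_factors fs, enc_gp a] (enc_gp (gprod v fs a))
        (1260 * U * (length fs + 1))"
      by (rule Cons.IH) (use Cons.prems f False in auto)
    show ?thesis
      by (rule comp_code[OF forest_program_nth(23)])
         (use U_ge False computesD[OF mem] computesD[OF IH] in \<open>simp_all add: prod_code_def f\<close>)
  qed
qed

end

text \<open>Each vertex has two generators, so at most \<open>k\<close> vertices give at most
  \<open>4 ^ k\<close> monomials.\<close>

lemma count_in_gens: "distinct L \<Longrightarrow> finite X \<Longrightarrow> count_in (gens X) L \<le> 2 * card X"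
proof -
  assume "distinct L" "finite X"
  have "count_in (gens X) L = card (set (filter (\<lambda>g. g \<in> gens X) L))"
    using \<open>distinct L\<close> by (simp only: distinct_card distinct_filter)
  also have "\<dots> \<le> card ((\<lambda>v. 2 * v) ` X \<union> (\<lambda>v. 2 * v + 1) ` X)"
  proof (rule card_mono)
    have "g \<in> (\<lambda>v. 2 * v) ` X \<union> (\<lambda>v. 2 * v + 1) ` X" if "g div 2 \<in> X" for g
    proof -
      have "g = 2 * (g div 2) \<or> g = 2 * (g div 2) + 1" by presburger
      then show ?thesis using that by blast
    qed
    then show "set (filter (\<lambda>g. g \<in> gens X) L) \<subseteq> (\<lambda>v. 2 * v) ` X \<union> (\<lambda>v. 2 * v + 1) ` X"
      unfolding gens_def by auto
  qed (use \<open>finite X\<close> in simp)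
  also have "\<dots> \<le> card X + card X"
    by (rule order_trans[OF card_Un_le]) (intro add_mono card_image_le \<open>finite X\<close>)
  finally show ?thesis by simp
qed

lemma of_int_fop_eq_iff': "(of_nat p - of_nat q :: fop) = of_int w \<longleftrightarrow> int p - int q = w"
  using of_int_fop_eq_iff[of "int p - int q" w] by simp

context bounds
begin

lemma run_PALL:
  assumes "wf_gp S L True a" "\<And>c p. (c, p) \<in> set fs \<Longrightarrow> wf_gp S L True p"
    and "max 1 (norm_gp a) * norm_prod fs < 2 ^ m" and S: "count_in S L \<le> 2 * k"
  shows "call PALL [enc_factors fs, enc_gp a] (enc_gp (gprod_all fs a)) (1220 * U * (length fs + 1))"
  using assms(1-3)
proof (induction fs arbitrary: a)
  case Nil
  show ?case
    by (rule comp_code[OF forest_program_nth(25)]) (use U_ge in \<open>simp_all add: pall_code_def\<close>)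
next
  case (Cons f fs)
  obtain c p where f: "f = (c, p)" by (cases f)
  let ?N = "norm_prod fs"
  have wp: "wf_gp S L True p" using Cons.prems(2)[of c p] f by simp
  have N: "max 1 (norm_gp a) * (max 1 (norm_gp p) * ?N) < 2 ^ m"
    using Cons.prems(3) f by simp
  have le: "norm_gp a * norm_gp p \<le> max 1 (norm_gp a) * max 1 (norm_gp p)"
    by (intro mult_le_mono) auto
  have "max 1 (norm_gp a) * max 1 (norm_gp p) * 1 \<le> max 1 (norm_gp a) * max 1 (norm_gp p) * ?N"
    using norm_prod_pos[of fs] by (intro mult_le_mono) auto
  then have N1: "max 1 (norm_gp a) * max 1 (norm_gp p) < 2 ^ m"
    using N unfolding mult.assoc mult_1_right by linarith
  have a1: "max 1 (norm_gp a) * 1 \<le> max 1 (norm_gp a) * max 1 (norm_gp p)"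
    and p1: "1 * max 1 (norm_gp p) \<le> max 1 (norm_gp a) * max 1 (norm_gp p)"
    by (intro mult_le_mono; simp)+
  have mul: "call MUL [enc_gp a, enc_gp p] (enc_gp (gmul a p)) (1200 * U)"
  proof (rule run_MUL[OF Cons.prems(1) wp _ _ _ S])
    show "norm_gp a < 2 ^ m" using a1 N1 by linarith
    show "norm_gp p < 2 ^ m" using p1 N1 by linarith
    show "norm_gp a * norm_gp p < 2 ^ m" using le N1 by linarith
  qed
  have "1 * 1 \<le> max 1 (norm_gp a) * max 1 (norm_gp p)" by (intro mult_le_mono) auto
  then have "max 1 (norm_gp (gmul a p)) \<le> max 1 (norm_gp a) * max 1 (norm_gp p)"
    using le norm_gmul[of a p] by linarith
  from mult_le_mono1[OF this, of ?N] N
  have N2: "max 1 (norm_gp (gmul a p)) * ?N < 2 ^ m" by (simp only: mult.assoc)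
  have IH: "call PALL [enc_factors fs, enc_gp (gmul a p)] (enc_gp (gprod_all fs (gmul a p)))
      (1220 * U * (length fs + 1))"
    by (rule Cons.IH[OF wf_gmul_even[OF Cons.prems(1) wp] _ N2]) (use Cons.prems f in auto)
  show ?case
    by (rule comp_code[OF forest_program_nth(25)])
       (use U_ge computesD[OF IH] computesD[OF mul] in \<open>simp_all add: pall_code_def f\<close>)
qed

text \<open>With empty support the tree is a single left spine. Its leaf satisfies
  \<open>p - q = z\<close> over the integers, so the subtraction is not truncated.\<close>

lemma comp_EXTR:
  "wf_gp {} K True x \<Longrightarrow> den K x = of_int (int z) \<Longrightarrow> norm_gp x < 2 ^ m \<Longrightarrow>
    call EXTR [enc_gp x] (enc_nat z) (40 * (m + 1) + 20 * (length K + 1))"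
proof (induction K arbitrary: x)
  case Nil
  show ?case
  proof (cases "x = Z")
    case True
    then have "z = 0" using Nil(2) of_int_fop_eq_iff[of 0 "int z"] by simp
    then show ?thesis
      by (intro comp_code[OF forest_program_nth(26)]) (use True in \<open>simp_all add: extr_code_def\<close>)
  next
    case False
    then obtain p q where x: "x = C p q" using Nil by (auto simp: wf_gp_Nil)
    then have z: "int p - int q = int z" using Nil(2) of_int_fop_eq_iff'[of p q "int z"] by simp
    then have "call SUBC [enc_nat p, enc_nat q, enc_bool False] (enc_nat (p - q - of_bool False)) (40 * (m + 1))"
      by (intro comp_SUBC) (use x Nil in auto)
    moreover have "p - q = z" using z by linarith
    ultimately have "call SUBC [enc_nat p, enc_nat q, Atom] (enc_nat z) (40 * (m + 1))" by simp
    from computesD[OF this] show ?thesis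
      by (intro comp_code[OF forest_program_nth(26)]) (use x in \<open>simp_all add: extr_code_def\<close>)
  qed
next
  case (Cons g K)
  show ?case
  proof (cases "x = Z")
    case True
    then have "z = 0" using Cons.prems(2) of_int_fop_eq_iff[of 0 "int z"] by simp
    then show ?thesis
      by (intro comp_code[OF forest_program_nth(26)]) (use True in \<open>simp_all add: extr_code_def\<close>)
  next
    case False
    then obtain y where x: "x = B y Z" "wf_gp {} K True y" using Cons.prems by (auto simp: wf_gp_Cons)
    have "call EXTR [enc_gp y] (enc_nat z) (40 * (m + 1) + 20 * (length K + 1))"
      by (rule Cons.IH[OF x(2)]) (use Cons.prems x in auto)
    from computesD[OF this] show ?thesis
      by (intro comp_code[OF forest_program_nth(26)]) (use x in \<open>simp_all add: extr_code_def\<close>)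
  qed
qed

section \<open>Cost of building the initial factors\<close>

lemma m_power: "16 \<le> (2::nat) ^ m"
  using power_increasing[OF m_ge, of "2::nat"] by simp

lemma norm_gen_pair: "norm_gp (gmul (ggen L g) (ggen L h)) \<le> 1"
  using order_trans[OF norm_gmul mult_le_mono[OF norm_ggen norm_ggen]] by simp

lemma run_gen_pair:
  assumes "g \<in> S" "h \<in> S" "count_in S L \<le> 2 * k"
  shows "call MUL [enc_gp (ggen L g), enc_gp (ggen L h)] (enc_gp (gmul (ggen L g) (ggen L h))) (1200 * U)"
  by (rule run_MUL[OF wf_ggen[OF assms(1)] wf_ggen[OF assms(2)] _ _ _ assms(3)])
     (use m_power norm_ggen[of L g] norm_ggen[of L h] mult_le_mono[OF norm_ggen[of L g] norm_ggen[of L h]] in linarith)+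

lemma run_VERT:
  assumes "2*v \<in> S" "2*v+1 \<in> S" and S: "count_in S L \<le> 2 * k"
  shows "call VERT [enc_list lab L, enc_nat v] (enc_gp (gvert L v)) (1700 * U)"
proof -
  have add: "call ADD [enc_gp (gone L), enc_gp (gmul (ggen L (2*v)) (ggen L (2*v+1)))] (enc_gp (gvert L v)) (100 * M^2 * D)"
    unfolding gvert_def
    by (rule run_ADD[OF wf_gone wf_gen_pair[OF assms(1,2)] _ _ S])
       (use m_power norm_gen_pair[of "2*v" "2*v+1"] norm_gone[of L] in linarith)+
  show ?thesis
    by (rule comp_code[OF forest_program_nth(15)])
       (use U_ge computesD[OF add] computesD[OF run_gen_pair[OF assms]] computesD[OF run_GEN[of "2*v"]]
          computesD[OF run_GEN[of "2*v+1"]] computesD[OF run_ONE]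
        in \<open>simp_all add: vert_code_def mult.assoc\<close>)
qed

lemma run_GDIFF:
  assumes "g \<in> S" "h \<in> S" and S: "count_in S L \<le> 2 * k"
  shows "call GDIFF [enc_list lab L, lab g, lab h] (enc_gp (gdiff L g h)) (400 * U)"
proof -
  have add: "call ADD [enc_gp (ggen L g), enc_gp (gneg (ggen L h))] (enc_gp (gdiff L g h)) (100 * M^2 * D)"
    unfolding gdiff_def
    by (rule run_ADD[OF wf_ggen[OF assms(1)] wf_gneg[OF wf_ggen[OF assms(2)]] _ _ S])
       (use m_power norm_ggen[of L g] norm_ggen[of L h] norm_gneg[of "ggen L h"] in linarith)+
  show ?thesis
    by (rule comp_code[OF forest_program_nth(14)])
       (use U_ge computesD[OF add] computesD[OF run_NEG[OF wf_ggen[OF assms(2), of L] S]]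
          computesD[OF run_GEN[of g]] computesD[OF run_GEN[of h]]
        in \<open>simp_all add: gdiff_code_def mult.assoc\<close>)
qed

text \<open>The operands have norm at most 8, below 16; this is the reason for
  \<open>4 \<le> m\<close>.\<close>

lemma run_EDGE:
  assumes "2*u \<in> S" "2*u+1 \<in> S" "2*v \<in> S" "2*v+1 \<in> S" and S: "count_in S L \<le> 2 * k"
  shows "call EDGE [enc_list lab L, enc_nat u, enc_nat v] (enc_gp (gedge L u v)) (5200 * U)"
proof -
  define d where "d = gdiff L (2*u) (2*v)"
  define e where "e = gdiff L (2*u+1) (2*v+1)"
  define t where "t = gmul (ggen L (2*v)) (ggen L (2*v+1))"
  define r where "r = gadd (gone L) (gneg t)"
  have ge: "gedge L u v = gadd (gone L) (gmul (gmul d e) r)"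
    by (simp add: gedge_def d_def e_def r_def t_def)
  note parts = wf_gedge_parts[OF assms(1-4), of L, folded d_def e_def t_def, folded r_def]
    norm_gedge_parts(1)[where L = L and u = u and v = v, folded d_def e_def]
    norm_gedge_parts(2)[where L = L and v = v, folded t_def, folded r_def]
  have wd: "wf_gp S L False d" and we: "wf_gp S L False e" and wt: "wf_gp S L True t"
    unfolding d_def e_def t_def using assms by (auto intro!: wf_gdiff wf_gen_pair)
  have nd: "norm_gp d \<le> 2" and ne: "norm_gp e \<le> 2" and nt: "norm_gp t \<le> 1"
    unfolding d_def e_def t_def by (rule norm_gdiff norm_gen_pair)+
  have md: "call GDIFF [enc_list lab L, lab (2*u), lab (2*v)] (enc_gp d) (400 * U)"
    and me: "call GDIFF [enc_list lab L, lab (2*u+1), lab (2*v+1)] (enc_gp e) (400 * U)"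
    unfolding d_def e_def by (rule run_GDIFF[OF _ _ S]; use assms in simp)+
  have mde: "call MUL [enc_gp d, enc_gp e] (enc_gp (gmul d e)) (1200 * U)"
    by (rule run_MUL[OF wd we _ _ _ S]) (use m_power nd ne mult_le_mono[OF nd ne] in linarith)+
  have mt: "call MUL [enc_gp (ggen L (2*v)), enc_gp (ggen L (2*v+1))] (enc_gp t) (1200 * U)"
    unfolding t_def by (rule run_gen_pair[OF assms(3,4) S])
  have nnt: "norm_gp (gneg t) \<le> 1" using nt by simp
  have mr: "call ADD [enc_gp (gone L), enc_gp (gneg t)] (enc_gp r) (100 * M^2 * D)"
    unfolding r_def
    by (rule run_ADD[OF wf_gone wf_gneg[OF wt] _ _ S]) (use m_power nnt norm_gone[of L] in linarith)+
  have mder: "call MUL [enc_gp (gmul d e), enc_gp r] (enc_gp (gmul (gmul d e) r)) (1200 * U)"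
    by (rule run_MUL[OF parts(1,2) _ _ _ S]) (use m_power parts(3,4) mult_le_mono[OF parts(3,4)] in linarith)+
  have "norm_gp (gmul (gmul d e) r) \<le> 4 * 2"
    by (rule order_trans[OF norm_gmul mult_le_mono[OF parts(3,4)]])
  then have madd: "call ADD [enc_gp (gone L), enc_gp (gmul (gmul d e) r)] (enc_gp (gedge L u v)) (100 * M^2 * D)"
    unfolding ge
    by (intro run_ADD[OF wf_gone wf_gmul_even[OF parts(1,2)] _ _ S]) (use m_power norm_gone[of L] in linarith)+
  show ?thesis
    by (rule comp_code[OF forest_program_nth(16)])
       (use U_ge computesD[OF md] computesD[OF me] computesD[OF mde] computesD[OF mt] computesD[OF mr]
          computesD[OF mder] computesD[OF madd] computesD[OF run_NEG[OF wt S]]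
          computesD[OF run_GEN[of "2*v"]] computesD[OF run_GEN[of "2*v+1"]] computesD[OF run_ONE]
        in \<open>simp_all add: edge_code_def mult.assoc\<close>)
qed

lemma run_RANGE:
  "i \<le> n \<Longrightarrow> call RANGE [enc_nat i, enc_nat n] (enc_list lab [2*i..<2*n]) (100 * M * (n - i + 1))"
proof (induction "n - i" arbitrary: i)
  case 0
  have eq: "call EQS [enc_nat n, enc_nat n] (enc_bool (enc_nat n = enc_nat n)) (20 * M)"
    using computes_mono[OF comp_EQS[of "enc_nat n" "enc_nat n"]] nat_le[of n] by simp
  show ?case
    by (rule comp_code[OF forest_program_nth(28)]) (use 0 M_pos computesD[OF eq] in \<open>simp_all add: range_code_def\<close>)
next
  case (Suc j)
  have i: "i < n" using Suc by linarith
  have eq: "call EQS [enc_nat i, enc_nat n] (enc_bool (enc_nat i = enc_nat n)) (20 * M)"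
    using computes_mono[OF comp_EQS[of "enc_nat i" "enc_nat n"]] nat_le[of i] i by simp
  have add: "call ADDC [enc_nat i, enc_nat 0, enc_bool True] (enc_nat (i + 0 + of_bool True)) (30 * (m + 1))"
    by (rule comp_ADDC) (use i n_less in auto)
  have IH: "call RANGE [enc_nat (Suc i), enc_nat n] (enc_list lab [2*Suc i..<2*n]) (100 * M * (n - Suc i + 1))"
    by (rule Suc.hyps(1)) (use Suc i in auto)
  have range: "[2*i..<2*n] = 2*i # (2*i+1) # [2*Suc i..<2*n]"
    using i by (simp add: upt_conv_Cons)
  have "n - i = Suc (n - Suc i)" using i by simp
  then have "100 * M * (n - i + 1) = 100 * M * (n - Suc i + 1) + 100 * M" by simp
  then show ?case
    by (intro comp_code[OF forest_program_nth(28)])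
       (use i M M_pos computesD[OF eq] computesD[OF add] computesD[OF IH] in \<open>simp_all add: range_code_def range\<close>)
qed

lemma run_INITB:
  "call INITB [enc_list lab L, enc_list enc_scope bs] (enc_factors (map (\<lambda>b. (b, gone L)) bs)) (50 * M * (length bs + 1))"
proof (induction bs)
  case Nil
  show ?case by (rule comp_code[OF forest_program_nth(30)]) (use M_pos in \<open>simp_all add: initb_code_def\<close>)
next
  case (Cons b bs)
  show ?case
    by (rule comp_code[OF forest_program_nth(30)])
       (use M_pos computesD[OF Cons.IH] computesD[OF run_ONE] in \<open>simp_all add: initb_code_def\<close>)
qed

text \<open>The four generators of an edge fit the bound \<open>2 * k\<close> only for
  \<open>2 \<le> k\<close>.\<close>

lemma run_INITE:
  assumes "es = [] \<or> 2 \<le> k"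
  shows "call INITE [enc_list lab L, enc_list (enc_prod enc_nat enc_nat) es, enc_factors rest]
    (enc_factors (map (\<lambda>(u, v). ([u, v], gedge L u v)) es @ rest)) (5300 * U * (length es + 1))"
  using assms
proof (induction es)
  case Nil
  show ?case by (rule comp_code[OF forest_program_nth(29)]) (use U_ge in \<open>simp_all add: inite_code_def\<close>)
next
  case (Cons e es)
  obtain u v where e: "e = (u, v)" by (cases e)
  have "card {u, v} \<le> 2" by (simp add: card_insert_if)
  then have "count_in (gens {u, v}) L \<le> 2 * k"
    using count_in_gens[of L "{u, v}"] Cons.prems L_def by auto
  then have edge: "call EDGE [enc_list lab L, enc_nat u, enc_nat v] (enc_gp (gedge L u v)) (5200 * U)"
    by (intro run_EDGE[where S = "gens {u, v}"]) (auto simp: gens_def)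
  have IH: "call INITE [enc_list lab L, enc_list (enc_prod enc_nat enc_nat) es, enc_factors rest]
    (enc_factors (map (\<lambda>(u, v). ([u, v], gedge L u v)) es @ rest)) (5300 * U * (length es + 1))"
    by (rule Cons.IH) (use Cons.prems in auto)
  show ?case
    by (rule comp_code[OF forest_program_nth(29)])
       (use U_ge computesD[OF edge] computesD[OF IH] in \<open>simp_all add: inite_code_def e\<close>)
qed

end

section \<open>Cost of the whole run\<close>

locale forest_run = elimination n z bags m L + bounds n m k M D L
  for n z bags m L k M D +
  assumes bag_card: "\<And>X. X \<in> bags \<Longrightarrow> card X \<le> k"
begin

text \<open>Cost of one elimination up to a constant: \<open>M^6\<close> comes from the nested
  search in \<open>FINDB\<close>, \<open>D^3\<close> from the multiplications.\<close>

definition W :: nat where "W = M^6 * D^3"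

lemma W_ge: "1 \<le> W" "M^6 \<le> W" "M^2 \<le> W" "M^3 \<le> W" "U \<le> W" "U * M \<le> W"
proof -
  have p: "M^a * D^b \<le> M^6 * D^3" if "a \<le> 6" "b \<le> 3" for a b
    using M_pos D_pos that by (intro mult_le_mono power_increasing) auto
  show "1 \<le> W" "M^6 \<le> W" "M^2 \<le> W" "M^3 \<le> W" "U \<le> W"
    using p[of 0 0] p[of 6 0] p[of 2 0] p[of 3 0] p[of 3 3] by (simp_all add: W_def U_def)
  have "U * M = M^4 * D^3" by (simp add: U_def eval_nat_numeral)
  then show "U * M \<le> W" using p[of 4 3] by (simp add: W_def)
qed

lemma scopes_ok_invariant:
  assumes inv: "invariant R fs"
  shows "scopes_ok fs"
  unfolding scopes_ok_def
proof (intro allI impI)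
  fix c p assume c: "(c, p) \<in> set fs"
  obtain X where X: "X \<in> bags" "set c \<subseteq> X \<inter> R" using invariantD(4)[OF inv c] by blast
  then have sub: "set c \<subseteq> {..<n}" using invariantD(1)[OF inv] by blast
  then have "card (set c) \<le> card {..<n}" by (intro card_mono) auto
  then have "length c \<le> n" using distinct_card[OF invariantD(2)[OF inv c]] by simp
  then show "set c \<subseteq> {..<n} \<and> length c + 1 \<le> M" using sub M by simp
qed

lemma run_FINDB':
  assumes "invariant R fs" "length fs + 1 \<le> M"
  shows "call FINDB [enc_factors fs, enc_factors fs] (enc_choice (findb fs fs)) (200 * W)"
proof (rule computes_mono[OF run_FINDB[OF scopes_ok_invariant[OF assms(1)] assms(2) scopes_ok_invariant[OF assms(1)]]])
  have "200 * M^5 * (length fs + 1) \<le> 200 * M^5 * M" using assms(2) by (intro mult_le_mono) auto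
  also have "\<dots> = 200 * M^6" using power_add[of M 5 1] by simp
  finally show "200 * M^5 * (length fs + 1) \<le> 200 * W" using W_ge(2) by linarith
qed

lemma norm_gprod_all: "norm_gp (gprod_all fs a) \<le> norm_gp a * norm_prod fs"
proof (induction fs a rule: gprod_all.induct)
  case (2 c p r a)
  have "norm_gp (gprod_all r (gmul a p)) \<le> norm_gp (gmul a p) * norm_prod r" by (rule 2)
  also have "\<dots> \<le> norm_gp a * max 1 (norm_gp p) * norm_prod r"
    by (intro mult_le_mono1 order_trans[OF norm_gmul]) simp
  finally show ?case by (simp add: mult.assoc)
qed simp

lemma run_SOLVE_final:
  assumes inv: "invariant {} fs" and len: "length fs + 1 \<le> M"
  shows "call SOLVE [enc_list lab L, enc_factors fs] (enc_nat z) (2000 * W)"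
proof -
  have none: "enc_choice (findb fs fs) = Atom" using invariant_empty(1)[OF inv] by simp
  have norm: "norm_prod fs < 2 ^ m" using invariantD(6)[OF inv] by simp
  have "1220 * U * (length fs + 1) \<le> 1220 * U * M" using len by (intro mult_le_mono) auto
  then have "1220 * U * (length fs + 1) \<le> 1220 * W" using W_ge(6) by linarith
  then have pall: "call PALL [enc_factors fs, enc_gp (gone L)] (enc_gp (gprod_all fs (gone L))) (1220 * W)"
    by (rule computes_mono[OF run_PALL[where S = "{}"], rotated -1])
       (use norm invariant_empty(2)[OF inv] in \<open>auto simp: wf_gone\<close>)
  have "call EXTR [enc_gp (gprod_all fs (gone L))] (enc_nat z) (40 * (m + 1) + 20 * (length L + 1))"
  proof (rule comp_EXTR[OF invariant_empty(3,4)[OF inv]])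
    show "norm_gp (gprod_all fs (gone L)) < 2 ^ m"
      using norm_gprod_all[of fs "gone L"] norm by simp
  qed
  then have extr: "call EXTR [enc_gp (gprod_all fs (gone L))] (enc_nat z) (60 * M)"
  proof (rule computes_mono)
    show "40 * (m + 1) + 20 * (length L + 1) \<le> 60 * M"
      using mult_le_mono2[OF M(2), of 40] mult_le_mono2[OF length_L(2), of 20] by linarith
  qed
  show ?thesis
    by (rule comp_code[OF forest_program_nth(27)])
       (use W_ge U_ge(2) computesD[OF run_FINDB'[OF inv len], unfolded none] computesD[OF pall] computesD[OF extr]
          computesD[OF run_ONE] in \<open>simp_all add: solve_code_def\<close>)
qed

lemma run_SOLVE_step:
  assumes inv: "invariant R fs" and len: "length fs + 1 \<le> M" and find: "findb fs fs = Some (v, b)"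
    and IH: "call SOLVE [enc_list lab L, enc_factors (eliminate L v b fs)] (enc_nat z) T"
  shows "call SOLVE [enc_list lab L, enc_factors fs] (enc_nat z) (5000 * W + T)"
proof -
  note elim = invariant_eliminate[OF inv find]
  have "v < n" using elim(1) invariantD(1)[OF inv] by auto
  have vb: "v \<in> set b" and "b \<in> fst ` set fs" and good: "good v b fs" using findb_Some[OF find] by auto
  then obtain q where q: "(b, q) \<in> set fs" by auto
  have lb: "length b + 1 \<le> M" using scopes_ok_invariant[OF inv] q unfolding scopes_ok_def by blast
  let ?S = "gens (set b)"
  obtain X where X: "X \<in> bags" "set b \<subseteq> X" using elim(3) by blast
  have "finite X" using bags[OF X(1)] by (rule finite_subset) simp
  then have "card (set b) \<le> k" using card_mono[OF _ X(2)] bag_card[OF X(1)] by (meson order_trans)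
  then have S: "count_in ?S L \<le> 2 * k" using count_in_gens[of L "set b"] by (simp add: L_def)
  have vS: "2*v \<in> ?S" "2*v+1 \<in> ?S" using vb by (auto simp: gens_def)
  define x where "x = gprod v fs (gvert L v)"
  define x1 where "x1 = gder L (2*v+1) x"
  have wfp: "wf_gp ?S L True p" if "(c, p) \<in> set fs" "v \<in> set c" for c p
  proof -
    have "set c \<subseteq> set b" using good that unfolding good_def by blast
    then have "gens (set c) \<inter> set L \<subseteq> ?S" unfolding gens_def by auto
    with invariantD(3)[OF inv that(1)] show ?thesis by (rule wf_gp_mono)
  qed
  have nsplit: "norm_prod fs = norm_prod (containing v fs) * norm_prod (avoiding v fs)"
    by (induction fs) auto
  have "finite R" using invariantD(1)[OF inv] by (rule finite_subset) simp
  then have "0 < card R" using elim(1) card_gt_0_iff by blast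
  then have two: "(2::nat) \<le> 2 ^ card R" using power_increasing[of 1 "card R" "2::nat"] by simp
  \<comment> \<open>As \<open>v \<in> R\<close>, the reserve \<open>2 ^ card R\<close> pays for the
    norm 2 of the vertex factor.\<close>
  have "max 1 (norm_gp (gvert L v)) * norm_prod (containing v fs) \<le> 2 ^ card R * (norm_prod (containing v fs) * norm_prod (avoiding v fs))"
    using norm_gvert[of L v] two norm_prod_pos[of "avoiding v fs"] by (intro mult_le_mono) auto
  also have "\<dots> < 2 ^ m" using invariantD(6)[OF inv] by (simp only: nsplit mult_ac)
  finally have N: "max 1 (norm_gp (gvert L v)) * norm_prod (containing v fs) < 2 ^ m" .
  have "1260 * U * (length fs + 1) \<le> 1260 * U * M" using len by (intro mult_le_mono) auto
  then have "1260 * U * (length fs + 1) \<le> 1260 * W" using W_ge(6) by linarith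
  then have prod: "call PRODV [enc_nat v, enc_factors fs, enc_gp (gvert L v)] (enc_gp x) (1260 * W)"
    unfolding x_def
    by (rule computes_mono[OF run_PRODV[OF \<open>v < n\<close> S scopes_ok_invariant[OF inv] wf_gvert[OF vS] _ N], rotated])
       (rule wfp)
  have der1: "call DER [enc_list lab L, enc_gp x, lab (2*v+1)] (enc_gp x1) (120 * M^2 * D^2)"
    unfolding x1_def x_def by (rule run_DER[OF elim(4) S])
  have der2: "call DER [enc_list lab L, enc_gp x1, lab (2*v)] (enc_gp (gder L (2*v) x1)) (120 * M^2 * D^2)"
    unfolding x1_def x_def by (rule run_DER[OF elim(5) S])
  have "70 * M^2 * (length fs + 1) \<le> 70 * M^2 * M" using len by (intro mult_le_mono) auto
  also have "\<dots> = 70 * M^3" using power_add[of M 2 1] by simp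
  finally have filt: "call FILT [enc_nat v, enc_factors fs] (enc_factors (avoiding v fs)) (70 * M^3)"
    by (rule computes_mono[OF run_FILT[OF \<open>v < n\<close> scopes_ok_invariant[OF inv]]])
  have IH': "call SOLVE [enc_list lab L, Node (Node (enc_scope (removeAll v b)) (enc_gp (gder L (2*v) x1)))
      (enc_factors (avoiding v fs))] (enc_nat z) T"
    using IH by (simp add: eliminate_def x1_def x_def)
  show ?thesis
    by (rule comp_code[OF forest_program_nth(27)])
       (use W_ge U_ge computesD[OF run_FINDB'[OF inv len], unfolded find enc_choice.simps]
          computesD[OF run_DEL'[OF \<open>v < n\<close> lb]] computesD[OF run_VERT[OF vS S]] computesD[OF prod]
          computesD[OF der1] computesD[OF der2] computesD[OF filt] computesD[OF IH'] in
        \<open>simp_all add: solve_code_def mult.assoc\<close>)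
qed

text \<open>One share of \<open>5000 * W\<close> for each eliminated vertex and one for the final
  product.\<close>

lemma run_SOLVE:
  "invariant R fs \<Longrightarrow> length fs + 1 \<le> M \<Longrightarrow>
    call SOLVE [enc_list lab L, enc_factors fs] (enc_nat z) (5000 * W * (card R + 1))"
proof (induction "card R" arbitrary: R fs)
  case 0
  have "finite R" using invariantD(1)[OF 0(2)] by (rule finite_subset) simp
  then have "R = {}" using 0(1) by simp
  then show ?case
    using 0 by (intro computes_mono[OF run_SOLVE_final]) auto
next
  case (Suc r)
  then have "R \<noteq> {}" by auto
  then obtain v b where find: "findb fs fs = Some (v, b)"
    using findb_ex[OF Suc.prems(1)] by blast
  note elim = invariant_eliminate[OF Suc.prems(1) find]
  have r: "r = card (R - {v})" using Suc.hyps(2) elim(1) by simp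
  have "call SOLVE [enc_list lab L, enc_factors (eliminate L v b fs)] (enc_nat z) (5000 * W * (r + 1))"
    unfolding r
    by (rule Suc.hyps(1)[OF r elim(6)]) (use length_eliminate[OF find] Suc.prems(2) in simp)
  from run_SOLVE_step[OF Suc.prems find this]
  have "call SOLVE [enc_list lab L, enc_factors fs] (enc_nat z) (5000 * W + 5000 * W * (r + 1))" .
  then show ?case unfolding Suc.hyps(2)[symmetric] by (rule computes_mono) simp
qed

end

text \<open>Each bag contributes the factor 1: the product is unchanged, but the bag becomes a
  scope, as the covering condition of the invariant demands.\<close>

definition initial_factors :: "nat list \<Rightarrow> (nat \<times> nat) list \<Rightarrow> nat list list \<Rightarrow> factor list" where
  "initial_factors L es bs = map (\<lambda>(u, v). ([u, v], gedge L u v)) es @ map (\<lambda>b. (b, gone L)) bs"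

text \<open>16 rounds the norm bound 9 of an edge factor up to a power of two, i.e. four bits per
  edge.\<close>

lemma norm_prod_initial: "norm_prod (initial_factors L es bs) \<le> 16 ^ length es"
proof -
  have "norm_prod (map (\<lambda>(u, v). ([u, v], gedge L u v)) es) \<le> 16 ^ length es"
  proof (induction es)
    case (Cons e es)
    obtain u v where e: "e = (u, v)" by (cases e)
    have "max 1 (norm_gp (gedge L u v)) \<le> 16" using norm_gedge[of L u v] by simp
    from mult_le_mono[OF this Cons.IH] show ?case by (simp add: e)
  qed simp
  moreover have "norm_prod (map (\<lambda>b. (b, gone L)) bs) = 1"
    by (induction bs) auto
  ultimately show ?thesis by (simp add: initial_factors_def)
qed

context forest_run
begin

lemma comp_MAIN:
  assumes inv: "invariant {..<n} (initial_factors L es bs)"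
    and len: "length es + 1 \<le> M" "length bs + 1 \<le> M" "length es + length bs + 1 \<le> M"
    and k: "es = [] \<or> 2 \<le> k"
  shows "call MAIN [Node (enc_nat n) (Node (enc_list (enc_prod enc_nat enc_nat) es) (Node y (enc_list enc_scope bs)))]
    (enc_nat z) (11000 * (W * M))"
proof -
  have "100 * M * (n - 0 + 1) \<le> 100 * M * M" using M by (intro mult_le_mono) auto
  then have "100 * M * (n - 0 + 1) \<le> 100 * W"
    using W_ge(3) unfolding power2_eq_square mult.assoc by linarith
  then have "call RANGE [enc_nat 0, enc_nat n] (enc_list lab [2*0..<2*n]) (100 * W)"
    by (rule computes_mono[OF run_RANGE[OF le0]])
  then have range: "call RANGE [Atom, enc_nat n] (enc_list lab L) (100 * W)" by (simp add: L_def)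
  have "50 * M * (length bs + 1) \<le> 50 * M * M" using len by (intro mult_le_mono) auto
  then have "50 * M * (length bs + 1) \<le> 50 * W"
    using W_ge(3) unfolding power2_eq_square mult.assoc by linarith
  then have initb: "call INITB [enc_list lab L, enc_list enc_scope bs] (enc_factors (map (\<lambda>b. (b, gone L)) bs)) (50 * W)"
    by (rule computes_mono[OF run_INITB])
  have "5300 * U * (length es + 1) \<le> 5300 * U * M" using len by (intro mult_le_mono) auto
  then have "5300 * U * (length es + 1) \<le> 5300 * W" using W_ge(6) unfolding mult.assoc by linarith
  then have inite: "call INITE [enc_list lab L, enc_list (enc_prod enc_nat enc_nat) es,
      enc_factors (map (\<lambda>b. (b, gone L)) bs)] (enc_factors (initial_factors L es bs)) (5300 * W)"
    unfolding initial_factors_def by (rule computes_mono[OF run_INITE[OF k]])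
  have "5000 * W * (card {..<n} + 1) \<le> 5000 * W * M" using M by (intro mult_le_mono) auto
  then have solve: "call SOLVE [enc_list lab L, enc_factors (initial_factors L es bs)] (enc_nat z) (5000 * (W * M))"
    by (intro computes_mono[OF run_SOLVE[OF inv]]) (use len in \<open>auto simp: initial_factors_def mult.assoc\<close>)
  have "call MAIN [Node (enc_nat n) (Node (enc_list (enc_prod enc_nat enc_nat) es) (Node y (enc_list enc_scope bs)))]
    (enc_nat z) (30 + 5450 * W + 5000 * (W * M))"
    by (rule comp_code[OF forest_program_nth(1)])
       (use computesD[OF range] computesD[OF initb] computesD[OF inite] computesD[OF solve] in
         \<open>simp_all add: main_code_def\<close>)
  moreover have "1 \<le> W * M" "W \<le> W * M" using W_ge(1) M_pos by (simp_all add: Suc_le_eq)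
  then have "30 + 5450 * W + 5000 * (W * M) \<le> 11000 * (W * M)" by linarith
  ultimately show ?thesis by (rule computes_mono)
qed

end

theorem theorem35:
  "\<exists>(P :: program) (C :: nat) (c :: nat).
     \<forall>(n :: nat) (E :: nat set set) (N :: nat) (F :: nat set set) (B :: nat \<Rightarrow> nat set) (x :: sexp).
       graph {..<n} E \<longrightarrow>
       tree_decomposition {..<n} E {..<N} F B \<longrightarrow>
       width {..<N} B = treewidth {..<n} E \<longrightarrow>
       encodes_instance x n E N F B \<longrightarrow>
       (\<exists>t. runs P x (enc_nat (card (forests E))) t \<and>
            t \<le> C * 64 ^ treewidth {..<n} E * (n + N) ^ c)"
\<comment> \<open>The cost is \<open>W * M = M^7 * (4^k)^3\<close> up to a constant.
  \<open>M = 20 * (n + N)^2\<close> gives \<open>20^7\<close> and the exponent 14, and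
  \<open>k\<close>, one more than the treewidth, gives the surplus 64. 11002 is 11000 plus the two
  steps of the outer call.\<close>
proof (rule exI[of _ forest_program], rule exI[of _ "11002 * 20 ^ 7 * 64"], rule exI[of _ 14], intro allI impI)
  fix n N :: nat and E F :: "nat set set" and B :: "nat \<Rightarrow> nat set" and x :: sexp
  assume gr: "graph {..<n} E" and td: "tree_decomposition {..<n} E {..<N} F B"
    and width: "width {..<N} B = treewidth {..<n} E" and enc: "encodes_instance x n E N F B"
  obtain es fs bs where es: "lists_edges es E" and bs: "lists_bags bs N B"
    and x: "x = Node (enc_nat n) (Node (enc_list (enc_prod enc_nat enc_nat) es)
      (Node (enc_list (enc_prod enc_nat enc_nat) fs) (enc_list (enc_list enc_nat) bs)))"
    using enc unfolding encodes_instance_def by blast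
  define k where "k = Suc (treewidth {..<n} E)"
  \<comment> \<open>Four bits for each of at most \<open>n^2\<close> edges, one for each vertex
    weight, and 5 to make the bound strict and to ensure \<open>4 \<le> m\<close>.\<close>
  define m where "m = 4 * n^2 + n + 5"
  define Q where "Q = n + N"
  \<comment> \<open>Large enough for \<open>m + 1\<close>, the label sizes and the number of
    factors, all at most quadratic in \<open>Q\<close>.\<close>
  define M where "M = 20 * Q^2"
  define L where "L = [0..<2*n]"
  define z where "z = card (forests E)"
  have tree: "connected_graph {..<N} F" "acyclic_edges F" "\<And>e. e \<in> F \<Longrightarrow> card e = 2"
    and bags_un: "(\<Union>i<N. B i) = {..<n}" and cover: "\<And>e. e \<in> E \<Longrightarrow> \<exists>i<N. e \<subseteq> B i"
    and conn: "\<And>v. v < n \<Longrightarrow> connected_graph {i\<in>{..<N}. v \<in> B i} F"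
    using td unfolding tree_decomposition_def tree_graph_def graph_def by auto
  have Bn: "B i \<subseteq> {..<n}" if "i < N" for i using bags_un that by blast
  \<comment> \<open>A tree has a node, so \<open>Q\<close> is positive even for the graph without
    vertices.\<close>
  have "0 < N" using tree(1) unfolding connected_graph_def by auto
  then have Q1: "1 \<le> Q" by (simp add: Q_def)
  then have Q2: "Q \<le> Q^2" "1 \<le> Q^2" by (simp_all add: power2_eq_square)
  have nQ: "n^2 \<le> Q^2" "n \<le> Q" "N \<le> Q" by (simp_all add: Q_def power_mono)
  have edge: "u \<noteq> v \<and> u < n \<and> v < n" if "(u, v) \<in> set es" for u v
  proof -
    have "{u, v} \<in> E" using es that unfolding lists_edges_def by force
    then have "{u, v} \<subseteq> {..<n}" "card {u, v} = 2" using gr unfolding graph_def by auto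
    then show ?thesis by (cases "u = v") auto
  qed
  have "length es \<le> card ({..<n} \<times> {..<n})"
  proof -
    have "distinct es" using es unfolding lists_edges_def by (simp add: distinct_map)
    then have "length es = card (set es)" by (simp add: distinct_card)
    also have "\<dots> \<le> card ({..<n} \<times> {..<n})" by (rule card_mono) (use edge in auto)
    finally show ?thesis .
  qed
  then have len_es: "length es \<le> n^2" by (simp add: power2_eq_square)
  have len_bs: "length bs = N" using bs unfolding lists_bags_def by simp
  have card_B: "card (B i) \<le> k" if "i < N" for i
  proof -
    \<comment> \<open>\<open>k\<close> is the width plus one, so the truncated subtraction in
      \<open>width\<close> does no harm even if all bags are empty.\<close>
    have "card (B i) \<le> Max ((\<lambda>i. card (B i)) ` {..<N})" using that by (intro Max_ge) auto
    then show ?thesis using width unfolding width_def k_def by linarith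
  qed
  have n2: "n < 2 ^ n" by (rule less_exp)
  interpret forest_run n z "B ` {..<N}" m L k M "4 ^ k"
  proof
    show "X \<subseteq> {..<n}" if "X \<in> B ` {..<N}" for X using that Bn by blast
    show "\<exists>v\<in>R. \<exists>X\<in>B ` {..<N}. v \<in> X \<and> (\<forall>Y\<in>B ` {..<N}. v \<in> Y \<longrightarrow> Y \<inter> R \<subseteq> X)"
      if "R \<subseteq> {..<n}" "R \<noteq> {}" for R
      using simplicial_vertex_ex[of "{..<N}" F R B] tree conn that by (simp add: subset_iff)
    show "card X \<le> k" if "X \<in> B ` {..<N}" for X using that card_B by blast
    show "4 * n + 1 \<le> M" "m + 1 \<le> M" unfolding M_def m_def using Q2 nQ by linarith+
    show "ssize (lab g) \<le> M" if "g < 2 * n" for g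
    proof -
      have "g div 2 < 2 ^ n" using that n2 by linarith
      from ssize_lab[OF this] show ?thesis unfolding M_def using Q2 nQ by linarith
    qed
    show "ssize (enc_nat v) \<le> M" if "v \<le> n" for v
    proof -
      have "v < 2 ^ n" using that n2 by linarith
      from ssize_enc_nat[OF this] show ?thesis unfolding M_def using Q2 nQ by linarith
    qed
    have "(2::nat) ^ n \<le> 2 ^ m" unfolding m_def by (rule power_increasing) auto
    then show "n < 2 ^ m" using n2 by linarith
  qed (simp_all add: L_def m_def)
  have genL: "g \<in> set L \<longleftrightarrow> g div 2 < n" for g unfolding L_def by auto
  have inv: "invariant {..<n} (initial_factors L es bs)"
    unfolding invariant_def
  proof (intro conjI allI impI ballI)
    fix c p assume "(c, p) \<in> set (initial_factors L es bs)"
    then consider u v where "(u, v) \<in> set es" "c = [u, v]" "p = gedge L u v"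
      | i where "i < N" "c = bs ! i" "p = gone L"
      unfolding initial_factors_def using len_bs by (auto simp: in_set_conv_nth)
    then have "distinct c \<and> wf_gp (gens (set c)) L True p \<and> (\<exists>X\<in>B ` {..<N}. set c \<subseteq> X \<inter> {..<n})"
    proof cases
      case 1
      have "{u, v} \<in> E" using es 1(1) unfolding lists_edges_def by force
      then obtain i where "i < N" "{u, v} \<subseteq> B i" using cover by blast
      moreover have "wf_gp (gens {u, v}) L True (gedge L u v)"
        by (rule wf_gedge) (auto simp: gens_def)
      ultimately show ?thesis using 1 edge[OF 1(1)] by auto
    next
      case 2
      then have "distinct c" "set c = B i" using bs unfolding lists_bags_def by auto
      then show ?thesis using 2 Bn[of i] wf_gone by auto
    qed
    then show "distinct c" "wf_gp (gens (set c)) L True p" "\<exists>X\<in>B ` {..<N}. set c \<subseteq> X \<inter> {..<n}"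
      by blast+
  next
    fix X assume "X \<in> B ` {..<N}"
    then obtain i where i: "i < N" "X = B i" by blast
    then have "(bs ! i, gone L) \<in> set (initial_factors L es bs)" "set (bs ! i) = X"
      using bs unfolding initial_factors_def lists_bags_def by auto
    then show "\<exists>c p. (c, p) \<in> set (initial_factors L es bs) \<and> X \<inter> {..<n} \<subseteq> set c" by blast
  next
    have "norm_prod (initial_factors L es bs) * 2 ^ card {..<n} \<le> 16 ^ length es * 2 ^ n"
      using norm_prod_initial by simp
    also have "\<dots> = 2 ^ (4 * length es + n)" by (simp add: power_add power_mult)
    also have "\<dots> < 2 ^ m" unfolding m_def using len_es by (intro power_strict_increasing) auto
    finally show "norm_prod (initial_factors L es bs) * 2 ^ card {..<n} < 2 ^ m" .
  next
    have "den_prod L (map (\<lambda>b. (b, gone L)) bs) = 1" by (induction bs) (auto simp: den_gone)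
    moreover have "den_prod L (map (\<lambda>(u, v). ([u, v], gedge L u v)) es) = prod_list (map (\<lambda>(u, v). 1 + ff u v) es)"
    proof -
      have "den L (gedge L u v) = 1 + ff u v" if "(u, v) \<in> set es" for u v
        by (rule den_gedge) (use edge[OF that] genL in auto)
      then show ?thesis by (auto intro!: arg_cong[of _ _ prod_list])
    qed
    ultimately have "den_prod L (initial_factors L es bs) = prod_list (map (\<lambda>(u, v). 1 + ff u v) es)"
      by (simp add: initial_factors_def)
    moreover have "set (map (\<lambda>(u, v). {u, v}) es) = E" using es unfolding lists_edges_def by blast
    ultimately show "top_coeff (2*n) (weight n {..<n} * den_prod L (initial_factors L es bs)) = int z"
      using forests_top_coeff[of es n] es edge unfolding lists_edges_def z_def by simp
  qed simp
  have k2: "es = [] \<or> 2 \<le> k"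
  proof (cases es)
    case (Cons e r)
    obtain u v where "e = (u, v)" by (cases e)
    then have uv: "(u, v) \<in> set es" using Cons by simp
    then have "{u, v} \<in> E" using es unfolding lists_edges_def by force
    then obtain i where i: "i < N" "{u, v} \<subseteq> B i" using cover by blast
    have "card {u, v} \<le> card (B i)" by (rule card_mono) (use i Bn[of i] finite_subset in auto)
    then show ?thesis using card_B[OF i(1)] edge[OF uv] by simp
  qed simp
  have "call MAIN [x] (enc_nat z) (11000 * (W * M))"
    unfolding x
  proof (rule comp_MAIN[OF inv _ _ _ k2])
    show "length es + 1 \<le> M" "length bs + 1 \<le> M" "length es + length bs + 1 \<le> M"
      unfolding M_def using len_es len_bs Q2 nQ by linarith+
  qed
  from computes_eval[OF this] obtain t where t: "t \<le> 11000 * (W * M)"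
    "eval forest_program [x] (forest_program ! MAIN) (enc_nat z) t" by blast
  have "evals forest_program [x] [Var 0] [x] (1 + 0)"
    using eval_Var[of 0 "[x]"] by (intro evals_Cons evals_Nil) simp
  from eval_Call[OF _ this t(2)] have run: "runs forest_program x (enc_nat z) (Suc (1 + 0 + t))"
    unfolding runs_def by (simp add: length_forest_program)
  have "1 \<le> W * M" using W_ge(1) M_pos by (simp add: Suc_le_eq)
  then have "Suc (1 + 0 + t) \<le> 11002 * (W * M)" using t(1) by linarith
  also have "W * M = M ^ 7 * (4 ^ k) ^ 3" using power_add[of M 6 1] by (simp add: W_def)
  also have "11002 * (M ^ 7 * (4 ^ k) ^ 3) = 11002 * 20 ^ 7 * 64 * 64 ^ treewidth {..<n} E * (n + N) ^ 14"
  proof -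
    have "((4::nat) ^ k) ^ 3 = (4 ^ 3) ^ k" by (metis power_mult mult.commute)
    then have "((4::nat) ^ k) ^ 3 = 64 * 64 ^ treewidth {..<n} E" by (simp add: k_def)
    moreover have "M ^ 7 = 20 ^ 7 * (n + N) ^ 14"
      unfolding M_def Q_def power_mult_distrib power_mult[symmetric] by simp
    ultimately show ?thesis by (simp only: mult_ac)
  qed
  finally show "\<exists>t. runs forest_program x (enc_nat (card (forests E))) t \<and>
      t \<le> 11002 * 20 ^ 7 * 64 * 64 ^ treewidth {..<n} E * (n + N) ^ 14"
    using run unfolding z_def by blast
qed

end
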